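(* Let $d,k\ge1$ be integers. The distribution of a Wishart-random POVM of parameters $(d,k;d,\ldots,d)$ (i.e. $s_1=\cdots=s_k=d$) is the normalized Lebesgue measure on the set of $k$-outcome POVMs on $\mathbb C^d$, i.e. on the compact convex set of $k$-tuples $(m_1,\dots,m_k)$ of positive semidefinite $d\times d$ matrices with $\sum_i m_i=I_d$.
   Context: A Wishart random matrix of parameters $(d,s)$ ($s$ a positive integer) is $W=G^*G$ with $G\in\mathcal M_{s\times d}(\mathbb C)$ having i.i.d. standard complex Gaussian entries. A Wishart-random POVM of parameters $(d,k;s_1,\dots,s_k)$ is the $k$-tuple $(M_1,\dots,M_k)$ with $M_i=S^{-1/2}W_iS^{-1/2}$, where $W_1,\dots,W_k$ are independent Wishart matrices of respective parameters $(d,s_i)$ and $S=\sum_{i=1}^kW_i$. Lebesgue measure on the set of POVMs means the restriction to this set of the translation-invariant measure on the real affine space of $k$-tuples of Hermitian $d\times d$ matrices summing to $I_d$, normalized to be a probability measure. *)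

theory Defs
  imports "HOL-Probability.Probability"
begin

text \<open>
  The dimension \<open>d\<close> and the number of outcomes \<open>k\<close> are the cardinalities of finite index types
  \<open>'d\<close> and \<open>'k\<close> (so both are at least 1). A \<open>k\<close>-tuple of \<open>d \<times> d\<close> matrices is an element of the
  Euclidean space \<^typ>\<open>complex^'d^'d^'k\<close>.
\<close>

definition conj_transpose :: "complex^'m^'n \<Rightarrow> complex^'n^'m" where
  "conj_transpose A = (\<chi> i j. cnj (A $ j $ i))"

definition hermitian :: "complex^'n^'n \<Rightarrow> bool" where
  "hermitian A \<longleftrightarrow> conj_transpose A = A"

definition pos_semidef :: "complex^'n^'n \<Rightarrow> bool" where
  "pos_semidef A \<longleftrightarrow> hermitian A \<and> (\<forall>x. 0 \<le> Re (\<Sum>i\<in>UNIV. cnj (x $ i) * (A *v x) $ i))"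

definition psd_sqrt :: "complex^'n^'n \<Rightarrow> complex^'n^'n" where
  "psd_sqrt A = (THE B. pos_semidef B \<and> B ** B = A)"

text \<open>
  \<open>S\<^sup>-\<^sup>1\<^sup>/\<^sup>2\<close> for positive definite \<open>S\<close>. Outside the positive definite matrices the value is
  irrelevant (it is some constant, since both \<^const>\<open>matrix_inv\<close> of a singular matrix and
  \<^const>\<open>psd_sqrt\<close> of a matrix that is not positive semidefinite do not depend on the matrix, so
  measurability is not affected).
\<close>

definition inv_sqrt :: "complex^'n^'n \<Rightarrow> complex^'n^'n" where
  "inv_sqrt S = psd_sqrt (matrix_inv S)"

definition povms :: "(complex^'d^'d^'k) set" where
  "povms = {m. (\<forall>i. pos_semidef (m $ i)) \<and> (\<Sum>i\<in>UNIV. m $ i) = mat 1}"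

definition hermitian_tuples_sum_id :: "(complex^'d^'d^'k) set" where
  "hermitian_tuples_sum_id = {m. (\<forall>i. hermitian (m $ i)) \<and> (\<Sum>i\<in>UNIV. m $ i) = mat 1}"

text \<open>Normalized by \<open>E |z|\<^sup>2 = 1\<close>.\<close>

definition std_complex_gaussian :: "complex measure" where
  "std_complex_gaussian = density lborel (\<lambda>z. ennreal (exp (- (cmod z)\<^sup>2) / pi))"

text \<open>
  The law of \<open>G\<^sup>* G\<close>, where \<open>G\<close> has \<open>s\<close> rows, indexed by \<open>r < s\<close>, and columns indexed by \<open>'d\<close>.
  The rows are indexed by natural numbers since the members of one POVM may have different
  parameters \<open>s\<close>.
\<close>

definition wishart :: "nat \<Rightarrow> (complex^'d^'d) measure" where
  "wishart s =
     distr (Pi\<^sub>M ({..<s} \<times> UNIV) (\<lambda>_. std_complex_gaussian)) borel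
       (\<lambda>G. \<chi> a b. \<Sum>r<s. cnj (G (r, a)) * G (r, b))"

definition wishart_random_povm ::
    "'w measure \<Rightarrow> ('k \<Rightarrow> nat) \<Rightarrow> ('w \<Rightarrow> complex^'d^'d^'k) \<Rightarrow> bool" where
  "wishart_random_povm P s M \<longleftrightarrow>
     prob_space P \<and>
     (\<exists>W :: 'k \<Rightarrow> 'w \<Rightarrow> complex^'d^'d.
        prob_space.indep_vars P (\<lambda>_. borel) W UNIV \<and>
        (\<forall>i. distr P borel (W i) = wishart (s i)) \<and>
        (\<forall>\<omega>\<in>space P. \<forall>i.
           M \<omega> $ i =
             (let R = inv_sqrt (\<Sum>j\<in>UNIV. W j \<omega>) in R ** W i \<omega> ** R)))"

text \<open>
  Translation-invariant measures on an affine subspace \<open>A\<close>, represented as Borel measures on the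
  ambient space that are concentrated on \<open>A\<close>. They are required to be nonzero and finite on compact
  sets, which determines them up to a positive factor. The vectors \<open>y - x\<close> with \<open>x, y \<in> A\<close> are the
  translations of \<open>A\<close>.
\<close>

definition translation_invariant_measure_on :: "'a::euclidean_space set \<Rightarrow> 'a measure \<Rightarrow> bool" where
  "translation_invariant_measure_on A L \<longleftrightarrow>
     sets L = sets borel \<and>
     emeasure L (- A) = 0 \<and>
     emeasure L A \<noteq> 0 \<and>
     (\<forall>K. compact K \<longrightarrow> emeasure L K < \<infinity>) \<and>
     (\<forall>x\<in>A. \<forall>y\<in>A. distr L borel (\<lambda>z. z + (y - x)) = L)"

text \<open>
  \<open>\<mu>\<close> is the normalized Lebesgue measure on the subset \<open>K\<close> of the affine space \<open>A\<close>: there is a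
  translation-invariant measure on \<open>A\<close>, and whichever one is chosen, its restriction to \<open>K\<close> has
  positive finite mass and normalizes to \<open>\<mu>\<close>.
\<close>

definition is_normalized_lebesgue :: "'a::euclidean_space set \<Rightarrow> 'a set \<Rightarrow> 'a measure \<Rightarrow> bool" where
  "is_normalized_lebesgue A K \<mu> \<longleftrightarrow>
     (\<exists>L. translation_invariant_measure_on A L) \<and>
     (\<forall>L. translation_invariant_measure_on A L \<longrightarrow>
        0 < emeasure L K \<and> emeasure L K < \<infinity> \<and> \<mu> = uniform_measure L K)"

end

theory Submission
  imports Defs
begin

text \<open>
  A square Gram matrix \<open>G\<^sup>* G\<close> of a Gaussian \<open>G\<close> has density proportional to \<open>exp (- tr W)\<close> with respect
  to Lebesgue measure on the positive definite matrices: the image of Lebesgue measure under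
  \<open>G \<mapsto> G\<^sup>* G\<close> and Lebesgue measure on Hermitian matrices scale by the same factor under
  \<open>W \<mapsto> Q W Q\<close>, and a double integral of \<open>f (G\<^sup>* W G)\<close> over \<open>G\<close> and \<open>W\<close> turns this into proportionality.

  Hence \<open>(W\<^sub>1, \<dots>, W\<^sub>k)\<close> has density proportional to \<open>exp (- tr S)\<close> on positive semidefinite tuples.
  Drop the semidefiniteness constraint, keep \<open>S\<close> positive definite, and let \<open>N\<close> be the image of
  \<open>exp (- tr S) dW\<close> under normalization \<open>W\<^sub>i \<mapsto> S\<^sup>-\<^sup>1\<^sup>/\<^sup>2 W\<^sub>i S\<^sup>-\<^sup>1\<^sup>/\<^sup>2\<close>. Translating the normalized tuple by \<open>u\<close>
  with \<open>\<Sum> u\<^sub>i = 0\<close> is the measure-preserving shear \<open>W\<^sub>i \<mapsto> W\<^sub>i + S\<^sup>1\<^sup>/\<^sup>2 u\<^sub>i S\<^sup>1\<^sup>/\<^sup>2\<close>, so \<open>N\<close> is translation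
  invariant on the affine space, and the law of the POVM is a multiple of its restriction to the POVMs.
  Translation-invariant measures being unique up to a factor, the result follows. No Jacobian
  determinant is ever computed: all factors come from this uniqueness.
\<close>

section \<open>Translation-invariant measures\<close>

text \<open>The equality s = d matters at one point. Once \<open>W\<close> has been removed from the
  double integral by left multiplication, an integral over \<open>G\<close> remains. It is
  independent of the other variable only if right multiplication by a positive definite
  \<open>Q\<close> and the congruence \<open>X \<mapsto> Q ** X ** Q\<close> scale their Lebesgue
  measures alike. For s x d matrices these factors are powers of det Q with exponents proportional
  to s and to d; when they differ, a power of det W survives in the density.

  The uniqueness argument needs finiteness on compact sets, which \<open>N\<close> does not visibly
  have, since normalization has unbounded fibres. It is borrowed from probability: the law of the
  POVM has mass 1, so \<open>N\<close> gives finite mass to the POVMs; these contain a ball of the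
  affine space, and translates of that ball cover compact sets.

  Square roots enter through a definite description, so they must be shown to exist, to be unique
  and to depend measurably on the matrix. Topology (invariance of domain, closed graphs) does this
  without diagonalization.\<close>

lemma nn_integral_swap_borel:
  fixes f :: "'a::second_countable_topology \<Rightarrow> 'b::second_countable_topology \<Rightarrow> ennreal"
  assumes "sigma_finite_measure L" "sigma_finite_measure L'"
    and sets: "sets L = sets borel" "sets L' = sets borel"
    and f: "(\<lambda>(x, y). f x y) \<in> borel_measurable (borel \<Otimes>\<^sub>M borel)"
  shows "(\<integral>\<^sup>+x. \<integral>\<^sup>+y. f x y \<partial>L' \<partial>L) = (\<integral>\<^sup>+y. \<integral>\<^sup>+x. f x y \<partial>L \<partial>L')"
proof -
  interpret pair_sigma_finite L L'
    using assms by (simp add: pair_sigma_finite_def)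
  have "(\<lambda>(x, y). f x y) \<in> borel_measurable (L \<Otimes>\<^sub>M L')"
    using f by (simp cong: measurable_cong_sets sets_pair_measure_cong add: sets)
  then show ?thesis by (rule Fubini'[symmetric])
qed

text \<open>A default value at work: \<open>emeasure\<close> is 0 off the sigma-algebra, so the
  clause \<open>emeasure L A \<noteq> 0\<close> already forces \<open>A\<close> to be Borel.\<close>

lemma translation_invariant_borel:
  "translation_invariant_measure_on A L \<Longrightarrow> A \<in> sets borel"
  unfolding translation_invariant_measure_on_def using emeasure_notin_sets by metis

lemma translation_invariant_sets:
  "translation_invariant_measure_on A L \<Longrightarrow> sets L = sets borel"
  by (simp add: translation_invariant_measure_on_def)

lemma translation_invariant_AE:
  assumes "translation_invariant_measure_on A L"
  shows "AE x in L. x \<in> A"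
proof (rule AE_I)
  show "{x \<in> space L. x \<notin> A} \<subseteq> - A" by auto
qed (use assms translation_invariant_borel[OF assms] in
      \<open>auto simp: translation_invariant_measure_on_def\<close>)

lemma translation_invariant_sigma_finite:
  fixes A :: "'a::euclidean_space set"
  assumes "translation_invariant_measure_on A L"
  shows "sigma_finite_measure L"
proof
  note L = assms[unfolded translation_invariant_measure_on_def]
  have sp: "space L = UNIV" using L by (metis sets_eq_imp_space_eq space_borel)
  show "\<exists>C. countable C \<and> C \<subseteq> sets L \<and> \<Union>C = space L \<and> (\<forall>a\<in>C. emeasure L a \<noteq> \<infinity>)"
  proof (intro exI[of _ "range (\<lambda>n::nat. cball 0 (real n))"] conjI ballI)
    show "\<Union> (range (\<lambda>n::nat. cball (0::'a) (real n))) = space L"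
      by (auto simp: sp real_arch_simple)
    show "emeasure L C \<noteq> \<infinity>" if "C \<in> range (\<lambda>n::nat. cball (0::'a) (real n))" for C
      using that L compact_cball by (metis imageE less_irrefl)
  qed (use L in auto)
qed

lemma translation_invariant_nn_integral:
  fixes A :: "'a::euclidean_space set"
  assumes L: "translation_invariant_measure_on A L" and "x \<in> A" "y \<in> A"
    and f [measurable]: "f \<in> borel_measurable borel"
  shows "(\<integral>\<^sup>+z. f (z + (y - x)) \<partial>L) = (\<integral>\<^sup>+z. f z \<partial>L)"
proof -
  have [measurable_cong]: "sets L = sets borel" by (rule translation_invariant_sets[OF L])
  have "distr L borel (\<lambda>z. z + (y - x)) = L"
    using assms by (auto simp: translation_invariant_measure_on_def)
  then have "(\<integral>\<^sup>+z. f z \<partial>L) = (\<integral>\<^sup>+z. f z \<partial>distr L borel (\<lambda>z. z + (y - x)))" by simp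
  also have "\<dots> = (\<integral>\<^sup>+z. f (z + (y - x)) \<partial>L)" by (rule nn_integral_distr) auto
  finally show ?thesis by simp
qed

lemma translation_invariant_nonempty:
  "translation_invariant_measure_on A L \<Longrightarrow> A \<noteq> {}"
  unfolding translation_invariant_measure_on_def by auto

text \<open>Together with finiteness on compact sets this supplies a test set of positive finite
  mass, by which the later arguments divide.\<close>

lemma translation_invariant_cball_pos:
  fixes A :: "'a::euclidean_space set"
  assumes L: "translation_invariant_measure_on A L"
  shows "\<exists>r::real. emeasure L (cball a r) \<noteq> 0"
proof (rule ccontr)
  have [measurable_cong, simp]: "sets L = sets borel" by (rule translation_invariant_sets[OF L])
  assume "\<not> ?thesis"
  then have "(\<Union>n::nat. cball a (real n)) \<in> null_sets L"
    by (intro null_sets_UN) (auto simp: null_sets_def)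
  also have "(\<Union>n::nat. cball a (real n)) = UNIV" by (auto simp: real_arch_simple)
  finally have "UNIV \<in> null_sets L" .
  moreover have "A \<in> sets L" using translation_invariant_borel[OF L] by simp
  ultimately have "emeasure L A = 0" by (meson emeasure_eq_0 null_setsD1 null_setsD2 subset_UNIV)
  with L show False by (simp add: translation_invariant_measure_on_def)
qed

text \<open>The Haar uniqueness argument on an affine space, with a base point \<open>a\<close> of
  \<open>A\<close> in the role of the origin. A double integral of \<open>f\<close> against a ball
  indicator is evaluated in both orders. Each shift used is a difference of two points of
  \<open>A\<close>, which is why the points are first restricted to \<open>A\<close> almost
  everywhere. The factor is the ratio of the two masses of the ball.\<close>

theorem translation_invariant_unique:
  fixes A :: "'a::euclidean_space set"
  assumes L: "translation_invariant_measure_on A L"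
    and L': "translation_invariant_measure_on A L'"
  obtains c where "c \<noteq> 0" "c \<noteq> \<infinity>" "L' = scale_measure c L"
proof -
  have [measurable_cong, simp]: "sets L = sets borel" "sets L' = sets borel"
    by (rule translation_invariant_sets, fact)+
  note sf = translation_invariant_sigma_finite[OF L] translation_invariant_sigma_finite[OF L']
  obtain a where a: "a \<in> A" using translation_invariant_nonempty[OF L] by auto
  obtain r where r: "emeasure L (cball a r) \<noteq> 0" using translation_invariant_cball_pos[OF L] by blast
  have fin: "emeasure L (cball a r) \<noteq> \<infinity>" "emeasure L' (cball a r) \<noteq> \<infinity>"
    using L L' unfolding translation_invariant_measure_on_def by (metis compact_cball less_irrefl)+
  have key: "(\<integral>\<^sup>+x. f x \<partial>L') * emeasure L (cball a r) = emeasure L' (cball a r) * (\<integral>\<^sup>+x. f x \<partial>L)"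
    if f [measurable]: "f \<in> borel_measurable borel" for f :: "'a \<Rightarrow> ennreal"
  proof -
    define g :: "'a \<Rightarrow> ennreal" where "g = indicator (cball 0 r)"
    have [measurable]: "g \<in> borel_measurable borel" unfolding g_def by (intro borel_measurable_indicator borel_closed closed_cball)
    have ga: "g (y - a) = indicator (cball a r) y" "g (a - y) = indicator (cball a r) y" for y
      by (auto simp: g_def indicator_def dist_norm norm_minus_commute)
    have "(\<integral>\<^sup>+x. f x \<partial>L') * emeasure L (cball a r) = (\<integral>\<^sup>+x. f x \<partial>L') * (\<integral>\<^sup>+y. g (y - a) \<partial>L)"
      unfolding ga by simp
    also have "\<dots> = (\<integral>\<^sup>+y. g (y - a) * (\<integral>\<^sup>+x. f x \<partial>L') \<partial>L)"
      by (subst mult.commute, subst nn_integral_multc) auto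
    also have "\<dots> = (\<integral>\<^sup>+y. g (y - a) * (\<integral>\<^sup>+x. f (x + (y - a)) \<partial>L') \<partial>L)"
      using translation_invariant_AE[OF L]
      by (intro nn_integral_cong_AE) (auto simp: translation_invariant_nn_integral[OF L' a])
    also have "\<dots> = (\<integral>\<^sup>+y. \<integral>\<^sup>+x. g (y - a) * f (x + (y - a)) \<partial>L' \<partial>L)"
      by (simp add: nn_integral_cmult)
    also have "\<dots> = (\<integral>\<^sup>+x. \<integral>\<^sup>+y. g (y - a) * f (x + (y - a)) \<partial>L \<partial>L')"
      by (rule nn_integral_swap_borel) (use sf in auto)
    \<comment> \<open>For fixed \<open>x\<close> in \<open>A\<close>, shifting \<open>y\<close> by
      \<open>a - x\<close> frees \<open>f\<close> from \<open>x\<close>. After the next swap the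
      \<open>x\<close>-integral is the \<open>L'\<close>-mass of the ball, because the ball is
      symmetric about \<open>a\<close>.\<close>
    also have "\<dots> = (\<integral>\<^sup>+x. \<integral>\<^sup>+y. g (y - x) * f y \<partial>L \<partial>L')"
    proof (rule nn_integral_cong_AE, use translation_invariant_AE[OF L'] in eventually_elim)
      fix x assume "x \<in> A"
      from translation_invariant_nn_integral[OF L this a, of "\<lambda>y. g (y - a) * f (x + (y - a))"]
      have "(\<integral>\<^sup>+y. g (y - a) * f (x + (y - a)) \<partial>L)
          = (\<integral>\<^sup>+y. g (y + (a - x) - a) * f (x + (y + (a - x) - a)) \<partial>L)" by simp
      also have "\<dots> = (\<integral>\<^sup>+y. g (y - x) * f y \<partial>L)" by (simp add: algebra_simps)
      finally show "(\<integral>\<^sup>+y. g (y - a) * f (x + (y - a)) \<partial>L) = (\<integral>\<^sup>+y. g (y - x) * f y \<partial>L)" .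
    qed
    also have "\<dots> = (\<integral>\<^sup>+y. \<integral>\<^sup>+x. g (y - x) * f y \<partial>L' \<partial>L)"
      by (rule nn_integral_swap_borel) (use sf in auto)
    also have "\<dots> = (\<integral>\<^sup>+y. (\<integral>\<^sup>+x. g (y - x) \<partial>L') * f y \<partial>L)"
      by (simp add: nn_integral_multc)
    also have "\<dots> = (\<integral>\<^sup>+y. emeasure L' (cball a r) * f y \<partial>L)"
    proof (rule nn_integral_cong_AE, use translation_invariant_AE[OF L] in eventually_elim)
      fix y assume "y \<in> A"
      from translation_invariant_nn_integral[OF L' a this, of "\<lambda>x. g (y - x)"]
      have "(\<integral>\<^sup>+x. g (y - x) \<partial>L') = (\<integral>\<^sup>+x. g (a - x) \<partial>L')" by (simp add: algebra_simps)
      then show "(\<integral>\<^sup>+x. g (y - x) \<partial>L') * f y = emeasure L' (cball a r) * f y" by (simp add: ga)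
    qed
    finally show ?thesis by (simp add: nn_integral_cmult)
  qed
  define c where "c = emeasure L' (cball a r) / emeasure L (cball a r)"
  have eq: "L' = scale_measure c L"
  proof (rule measure_eqI)
    fix B assume B: "B \<in> sets L'"
    from key[of "indicator B"] B
    have "emeasure L' B * emeasure L (cball a r) = emeasure L' (cball a r) * emeasure L B" by simp
    then have "emeasure L' B * emeasure L (cball a r) / emeasure L (cball a r)
      = emeasure L' (cball a r) * emeasure L B / emeasure L (cball a r)" by simp
    then show "emeasure L' B = emeasure (scale_measure c L) B" using r fin
      by (simp add: c_def ennreal_mult_divide_eq ennreal_times_divide mult.commute)
  qed simp
  show thesis
  proof (rule that)
    show "c \<noteq> \<infinity>" using r fin by (simp add: c_def ennreal_divide_eq_top_iff)
    have "emeasure L' A \<noteq> 0" using L' by (simp add: translation_invariant_measure_on_def)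
    then show "c \<noteq> 0" by (metis eq emeasure_scale_measure mult_zero_left)
    show "L' = scale_measure c L" by (rule eq)
  qed
qed

section \<open>Linear images, null sets and shears\<close>

lemma translation_invariant_lborel:
  "translation_invariant_measure_on UNIV (lborel :: 'a::euclidean_space measure)"
  unfolding translation_invariant_measure_on_def
proof (intro conjI ballI allI impI)
  show "distr lborel borel (\<lambda>z. z + (y - x)) = lborel" for x y :: 'a
    using lborel_distr_plus[of "y - x"] unfolding add.commute[of _ "y - x"] .
  show "emeasure lborel K < \<infinity>" if "compact K" for K :: "'a set"
    using that emeasure_compact_finite by simp
qed auto

text \<open>The continuous left inverse \<open>S\<close> keeps the image measure finite on compact
  sets: up to a null set, the preimage of \<open>K\<close> lies in the image of \<open>K\<close>
  under \<open>S\<close>, which is compact.\<close>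

lemma translation_invariant_image:
  fixes T :: "'a::euclidean_space \<Rightarrow> 'b::euclidean_space"
  assumes L: "translation_invariant_measure_on V L" and B: "T ` V \<in> sets borel"
    and T: "linear T" and S: "continuous_on UNIV S" "\<And>x. x \<in> V \<Longrightarrow> S (T x) = x"
  shows "translation_invariant_measure_on (T ` V) (distr L borel T)"
proof -
  have [measurable_cong, simp]: "sets L = sets borel" by (rule translation_invariant_sets[OF L])
  have [simp]: "space L = UNIV" using sets_eq_imp_space_eq[of L borel] by simp
  have T' [measurable]: "T \<in> borel_measurable borel"
    using T by (simp add: borel_measurable_continuous_onI linear_continuous_on linear_conv_bounded_linear)
  note LD = L[unfolded translation_invariant_measure_on_def]
  have V: "V \<in> sets borel" by (rule translation_invariant_borel[OF L])
  show ?thesis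
    unfolding translation_invariant_measure_on_def
  proof (intro conjI ballI allI impI)
    have "emeasure L (T -` (- T ` V)) \<le> emeasure L (- V)" using V by (intro emeasure_mono) auto
    then show "emeasure (distr L borel T) (- T ` V) = 0" using LD B by (simp add: emeasure_distr)
    have "emeasure L V \<le> emeasure L (T -` (T ` V))"
      using measurable_sets_borel[OF T' B] by (intro emeasure_mono) auto
    then have "emeasure L (T -` T ` V) \<noteq> 0" using LD by (metis le_zero_eq)
    then show "emeasure (distr L borel T) (T ` V) \<noteq> 0" using B by (simp add: emeasure_distr)
    fix K :: "'b set" assume K: "compact K"
    have SK: "compact (S ` K)" using K S by (meson compact_continuous_image continuous_on_subset subset_UNIV)
    have [measurable]: "K \<in> sets borel" "S ` K \<in> sets borel" using K SK by (auto intro: borel_compact)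
    have "emeasure L (T -` K) \<le> emeasure L (S ` K)"
    proof (rule emeasure_mono_AE)
      show "AE x in L. x \<in> T -` K \<longrightarrow> x \<in> S ` K"
        using translation_invariant_AE[OF L] by eventually_elim (metis S(2) image_eqI vimageD)
    qed simp
    also have "\<dots> < \<infinity>" using LD SK by blast
    finally show "emeasure (distr L borel T) K < \<infinity>" by (simp add: emeasure_distr)
  next
    fix x y assume "x \<in> T ` V" "y \<in> T ` V"
    then obtain u v where uv: "u \<in> V" "v \<in> V" "x = T u" "y = T v" by auto
    have "distr (distr L borel T) borel (\<lambda>z. z + (y - x)) = distr L borel (\<lambda>z. T (z + (v - u)))"
      using T by (subst distr_distr) (auto simp: comp_def uv linear_add linear_diff)
    also have "\<dots> = distr (distr L borel (\<lambda>z. z + (v - u))) borel T"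
      by (subst distr_distr) (auto simp: comp_def)
    also have "distr L borel (\<lambda>z. z + (v - u)) = L" using LD uv by blast
    finally show "distr (distr L borel T) borel (\<lambda>z. z + (y - x)) = distr L borel T" .
  qed simp
qed

lemma translation_invariant_image_scale:
  fixes T :: "'a::euclidean_space \<Rightarrow> 'b::euclidean_space"
  assumes L: "translation_invariant_measure_on V L" and L': "translation_invariant_measure_on (T ` V) L'"
    and T: "linear T" and S: "continuous_on UNIV S" "\<And>x. x \<in> V \<Longrightarrow> S (T x) = x"
  obtains c where "c \<noteq> 0" "c \<noteq> \<infinity>"
    "\<And>f. f \<in> borel_measurable borel \<Longrightarrow> (\<integral>\<^sup>+x. f (T x) \<partial>L) = c * (\<integral>\<^sup>+x. f x \<partial>L')"
proof -
  have [measurable_cong, simp]: "sets L = sets borel" "sets L' = sets borel"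
    by (rule translation_invariant_sets, fact)+
  have T' [measurable]: "T \<in> borel_measurable borel"
    using T by (simp add: borel_measurable_continuous_onI linear_continuous_on linear_conv_bounded_linear)
  obtain c where c: "c \<noteq> 0" "c \<noteq> \<infinity>" "distr L borel T = scale_measure c L'"
    using translation_invariant_unique[OF L'
      translation_invariant_image[OF L translation_invariant_borel[OF L'] T S]] by auto
  show thesis
  proof (rule that[OF c(1,2)])
    fix f :: "'b \<Rightarrow> ennreal" assume [measurable]: "f \<in> borel_measurable borel"
    have "(\<integral>\<^sup>+x. f (T x) \<partial>L) = (\<integral>\<^sup>+x. f x \<partial>distr L borel T)" by (simp add: nn_integral_distr)
    then show "(\<integral>\<^sup>+x. f (T x) \<partial>L) = c * (\<integral>\<^sup>+x. f x \<partial>L')" by (simp add: c(3) nn_integral_scale_measure)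
  qed
qed

text \<open>The mass of \<open>B\<close> equals its average over the shifts by
  \<open>t *\<^sub>R e\<close> with \<open>t\<close> in [0,1]. After swapping the integrals, the
  inner one measures the trace of \<open>B\<close> on a line parallel to \<open>e\<close>, which is
  countable. Singular matrices are discarded this way, with \<open>mat 1\<close> as
  direction.\<close>

lemma translation_invariant_null_set:
  fixes A :: "'a::euclidean_space set"
  assumes L: "translation_invariant_measure_on A L" and x0: "x0 \<in> A"
    and e: "\<And>t::real. x0 + t *\<^sub>R e \<in> A"
    and B: "B \<in> sets borel" and ctbl: "\<And>x. countable {t::real. x + t *\<^sub>R e \<in> B}"
  shows "emeasure L B = 0"
proof -
  have [measurable_cong, simp]: "sets L = sets borel" by (rule translation_invariant_sets[OF L])
  have [measurable]: "B \<in> sets borel" by fact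
  let ?I = "\<lambda>t::real. indicator {0..1} t :: ennreal"
  let ?B = "\<lambda>x. indicator B x :: ennreal"
  have "emeasure L B = (\<integral>\<^sup>+t. ?I t \<partial>lborel) * emeasure L B" by simp
  also have "\<dots> = (\<integral>\<^sup>+t. ?I t * (\<integral>\<^sup>+x. ?B x \<partial>L) \<partial>lborel)"
    by (simp add: nn_integral_multc)
  also have "\<dots> = (\<integral>\<^sup>+t. ?I t * (\<integral>\<^sup>+x. ?B (x + t *\<^sub>R e) \<partial>L) \<partial>lborel)"
  proof -
    have "(\<integral>\<^sup>+x. ?B (x + t *\<^sub>R e) \<partial>L) = (\<integral>\<^sup>+x. ?B x \<partial>L)" for t
      using translation_invariant_nn_integral[OF L x0 e, of ?B t] B
      by (simp only: add_diff_cancel_left' borel_measurable_indicator)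
    then show ?thesis by (simp only:)
  qed
  also have "\<dots> = (\<integral>\<^sup>+t. \<integral>\<^sup>+x. ?I t * ?B (x + t *\<^sub>R e) \<partial>L \<partial>lborel)"
    by (simp add: nn_integral_cmult)
  also have "\<dots> = (\<integral>\<^sup>+x. \<integral>\<^sup>+t. ?I t * ?B (x + t *\<^sub>R e) \<partial>lborel \<partial>L)"
    by (rule nn_integral_swap_borel)
      (auto simp: translation_invariant_sigma_finite[OF L] lborel.sigma_finite_measure_axioms)
  also have "\<dots> = (\<integral>\<^sup>+x. 0 \<partial>L)"
  proof (rule nn_integral_cong)
    fix x
    have "(\<integral>\<^sup>+t. ?I t * ?B (x + t *\<^sub>R e) \<partial>lborel) \<le> (\<integral>\<^sup>+t. indicator {t. x + t *\<^sub>R e \<in> B} t \<partial>lborel)"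
      by (intro nn_integral_mono) (auto simp: indicator_def)
    also have "\<dots> = emeasure lborel {t. x + t *\<^sub>R e \<in> B}"
    proof (rule nn_integral_indicator)
      have "(\<lambda>t. x + t *\<^sub>R e) \<in> borel_measurable borel" by measurable
      from measurable_sets_borel[OF this B] show "{t. x + t *\<^sub>R e \<in> B} \<in> sets lborel"
        by (simp add: vimage_def)
    qed
    also have "\<dots> = 0" by (rule emeasure_lborel_countable[OF ctbl])
    finally show "(\<integral>\<^sup>+t. ?I t * ?B (x + t *\<^sub>R e) \<partial>lborel) = 0" by simp
  qed
  finally show ?thesis by simp
qed

text \<open>The shift \<open>u\<close> becomes a constant translation once the value of \<open>\<pi>\<close> is integrated
  independently along the section \<open>\<sigma>\<close>.\<close>

lemma translation_invariant_shear:
  fixes L :: "'a::euclidean_space measure" and H :: "'b::euclidean_space measure"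
  assumes L: "translation_invariant_measure_on V L" and H: "translation_invariant_measure_on U H"
    and V: "subspace V" and U: "subspace U"
    and p: "linear \<pi>" "\<And>x. x \<in> V \<Longrightarrow> \<pi> x \<in> U"
    and s: "linear \<sigma>" "\<And>h. h \<in> U \<Longrightarrow> \<sigma> h \<in> V" "\<And>h. \<pi> (\<sigma> h) = h"
    and u [measurable]: "u \<in> borel_measurable borel" and u': "\<And>h. u h \<in> V" "\<And>h. \<pi> (u h) = 0"
    and f [measurable]: "f \<in> borel_measurable borel"
  shows "(\<integral>\<^sup>+x. f (x + u (\<pi> x)) \<partial>L) = (\<integral>\<^sup>+x. f x \<partial>L)"
proof -
  have [measurable_cong, simp]: "sets L = sets borel" "sets H = sets borel"
    by (rule translation_invariant_sets, fact)+
  have [measurable]: "\<pi> \<in> borel_measurable borel" "\<sigma> \<in> borel_measurable borel"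
    using p s by (simp_all add: borel_measurable_continuous_onI linear_continuous_on linear_conv_bounded_linear)
  note sf = translation_invariant_sigma_finite[OF L] translation_invariant_sigma_finite[OF H]
  note Lt = translation_invariant_nn_integral[OF L subspace_0[OF V], simplified]
  note Ht = translation_invariant_nn_integral[OF H subspace_0[OF U], simplified]
  obtain r where r: "emeasure H (cball 0 r) \<noteq> 0" using translation_invariant_cball_pos[OF H] by blast
  have fin: "emeasure H (cball 0 r) \<noteq> \<infinity>"
    using H unfolding translation_invariant_measure_on_def by (metis compact_cball less_irrefl)
  define g :: "'b \<Rightarrow> ennreal" where "g = indicator (cball 0 r)"
  have [measurable]: "g \<in> borel_measurable borel"
    unfolding g_def by (intro borel_measurable_indicator borel_closed closed_cball)
  have g: "(\<integral>\<^sup>+h. g h \<partial>H) = emeasure H (cball 0 r)" by (simp add: g_def)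
  \<comment> \<open>The right-hand side does not mention \<open>w\<close>, so applying this to
    \<open>u\<close> and to the zero shift gives the same value.\<close>
  have key: "emeasure H (cball 0 r) * (\<integral>\<^sup>+x. f (x + w (\<pi> x)) \<partial>L)
     = (\<integral>\<^sup>+h. \<integral>\<^sup>+x. g (h - \<pi> x) * f (x - \<sigma> (\<pi> x) + \<sigma> h) \<partial>L \<partial>H)"
    if w [measurable]: "w \<in> borel_measurable borel" and w': "\<And>h. w h \<in> V" "\<And>h. \<pi> (w h) = 0" for w
  proof -
    have "emeasure H (cball 0 r) * (\<integral>\<^sup>+x. f (x + w (\<pi> x)) \<partial>L)
      = (\<integral>\<^sup>+h. g h * (\<integral>\<^sup>+x. f (x + w (\<pi> x)) \<partial>L) \<partial>H)" by (simp add: nn_integral_multc g)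
    also have "\<dots> = (\<integral>\<^sup>+h. g h * (\<integral>\<^sup>+x. f (x + \<sigma> h + w (\<pi> x + h)) \<partial>L) \<partial>H)"
    proof (rule nn_integral_cong_AE, use translation_invariant_AE[OF H] in eventually_elim)
      fix h assume "h \<in> U"
      from Lt[OF s(2)[OF this], of "\<lambda>x. f (x + w (\<pi> x))"]
      show "g h * (\<integral>\<^sup>+x. f (x + w (\<pi> x)) \<partial>L) = g h * (\<integral>\<^sup>+x. f (x + \<sigma> h + w (\<pi> x + h)) \<partial>L)"
        using p s(3) by (simp add: linear_add)
    qed
    also have "\<dots> = (\<integral>\<^sup>+h. \<integral>\<^sup>+x. g h * f (x + \<sigma> h + w (\<pi> x + h)) \<partial>L \<partial>H)"
      by (simp add: nn_integral_cmult)
    also have "\<dots> = (\<integral>\<^sup>+x. \<integral>\<^sup>+h. g h * f (x + \<sigma> h + w (\<pi> x + h)) \<partial>H \<partial>L)"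
      by (rule nn_integral_swap_borel) (use sf in auto)
    also have "\<dots> = (\<integral>\<^sup>+x. \<integral>\<^sup>+h. g (h - \<pi> x) * f (x - \<sigma> (\<pi> x) + \<sigma> h + w h) \<partial>H \<partial>L)"
    proof (rule nn_integral_cong_AE, use translation_invariant_AE[OF L] in eventually_elim)
      fix x assume "x \<in> V"
      then have "- \<pi> x \<in> U" using p U by (simp add: subspace_neg)
      from Ht[OF this, of "\<lambda>h. g h * f (x + \<sigma> h + w (\<pi> x + h))"]
      show "(\<integral>\<^sup>+h. g h * f (x + \<sigma> h + w (\<pi> x + h)) \<partial>H)
        = (\<integral>\<^sup>+h. g (h - \<pi> x) * f (x - \<sigma> (\<pi> x) + \<sigma> h + w h) \<partial>H)"
        using s(1) by (simp add: linear_diff algebra_simps)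
    qed
    also have "\<dots> = (\<integral>\<^sup>+h. \<integral>\<^sup>+x. g (h - \<pi> x) * f (x - \<sigma> (\<pi> x) + \<sigma> h + w h) \<partial>L \<partial>H)"
      by (rule nn_integral_swap_borel) (use sf in auto)
    also have "\<dots> = (\<integral>\<^sup>+h. \<integral>\<^sup>+x. g (h - \<pi> x) * f (x - \<sigma> (\<pi> x) + \<sigma> h) \<partial>L \<partial>H)"
    proof (rule nn_integral_cong)
      fix h
      from Lt[OF w'(1)[of h], of "\<lambda>x. g (h - \<pi> x) * f (x - \<sigma> (\<pi> x) + \<sigma> h)"]
      show "(\<integral>\<^sup>+x. g (h - \<pi> x) * f (x - \<sigma> (\<pi> x) + \<sigma> h + w h) \<partial>L)
        = (\<integral>\<^sup>+x. g (h - \<pi> x) * f (x - \<sigma> (\<pi> x) + \<sigma> h) \<partial>L)"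
        using p s(1) w' by (simp add: linear_add algebra_simps)
    qed
    finally show ?thesis .
  qed
  have z: "emeasure H (cball 0 r) * (\<integral>\<^sup>+x. f (x + 0) \<partial>L)
     = (\<integral>\<^sup>+h. \<integral>\<^sup>+x. g (h - \<pi> x) * f (x - \<sigma> (\<pi> x) + \<sigma> h) \<partial>L \<partial>H)"
    by (rule key[of "\<lambda>_. 0"]) (use V p in \<open>auto simp: subspace_0 linear_0\<close>)
  have "emeasure H (cball 0 r) * (\<integral>\<^sup>+x. f (x + u (\<pi> x)) \<partial>L) = emeasure H (cball 0 r) * (\<integral>\<^sup>+x. f x \<partial>L)"
    using key[OF u u'] z by simp
  then show ?thesis using r fin by (simp add: ennreal_mult_cancel_left)
qed

text \<open>The preimage of a closed set is a countable union of projections of compact sets.\<close>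

lemma measurable_on_closed_graph:
  fixes f :: "'a::euclidean_space \<Rightarrow> 'b::euclidean_space"
  assumes cl: "closed {(x, y). R x y}" and f: "\<And>x y. R x y \<longleftrightarrow> x \<in> D \<and> y = f x"
  shows "D \<in> sets borel" "f \<in> borel_measurable (restrict_space borel D)"
proof -
  have pre: "{x \<in> D. f x \<in> C} \<in> sets borel" if "closed C" for C
  proof -
    let ?K = "\<lambda>m n::nat. {(x, y). R x y} \<inter> (cball 0 (real m) \<times> (cball 0 (real n) \<inter> C))"
    have "compact (?K m n)" for m n
      using that by (intro closed_Int_compact cl compact_Times compact_Int_closed) auto
    then have "compact (fst ` ?K m n)" for m n
      by (intro compact_continuous_image continuous_on_fst continuous_on_id)
    then have "fst ` ?K m n \<in> sets borel" for m n by (rule borel_compact)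
    then have "(\<Union>m n. fst ` ?K m n) \<in> sets borel" by (intro sets.countable_UN image_subsetI)
    also have "(\<Union>m n. fst ` ?K m n) = {x \<in> D. f x \<in> C}"
    proof (intro set_eqI iffI)
      fix x assume x: "x \<in> {x \<in> D. f x \<in> C}"
      obtain m n :: nat where "norm x \<le> real m" "norm (f x) \<le> real n" using real_arch_simple by metis
      then have "(x, f x) \<in> ?K m n" using x f by auto
      then have "fst (x, f x) \<in> fst ` ?K m n" by (rule imageI)
      then show "x \<in> (\<Union>m n. fst ` ?K m n)" by (simp only: fst_conv) blast
    qed (auto simp: f)
    finally show ?thesis .
  qed
  from pre[of UNIV] show D: "D \<in> sets borel" by simp
  show "f \<in> borel_measurable (restrict_space borel D)"
  proof (rule borel_measurableI)
    fix S :: "'b set" assume "open S"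
    then have "D - {x \<in> D. f x \<in> - S} \<in> sets borel" using D pre[of "- S"] by (auto simp: closed_Compl)
    also have "D - {x \<in> D. f x \<in> - S} = f -` S \<inter> space (restrict_space borel D)"
      by (auto simp: space_restrict_space)
    finally show "f -` S \<inter> space (restrict_space borel D) \<in> sets (restrict_space borel D)"
      using D by (subst sets_restrict_space_iff) (auto simp: space_restrict_space)
  qed
qed

section \<open>Positive definite matrices\<close>

lemma bounded_bilinear_matrix_mult:
  "bounded_bilinear ((**) :: complex^'n^'m \<Rightarrow> complex^'k^'n \<Rightarrow> complex^'k^'m)"
  unfolding bilinear_conv_bounded_bilinear[symmetric] bilinear_def
  by (auto intro!: linearI simp: vec_eq_iff matrix_matrix_mult_def sum.distrib scaleR_sum_right algebra_simps)

lemma bounded_bilinear_matrix_vector_mult: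
  "bounded_bilinear ((*v) :: complex^'n^'m \<Rightarrow> complex^'n \<Rightarrow> complex^'m)"
  unfolding bilinear_conv_bounded_bilinear[symmetric] bilinear_def
  by (auto intro!: linearI simp: vec_eq_iff matrix_vector_mult_def sum.distrib scaleR_sum_right algebra_simps)

interpretation mm: bounded_bilinear "(**) :: complex^'n^'m \<Rightarrow> complex^'k^'n \<Rightarrow> complex^'k^'m"
  by (rule bounded_bilinear_matrix_mult)

interpretation mv: bounded_bilinear "(*v) :: complex^'n^'m \<Rightarrow> complex^'n \<Rightarrow> complex^'m"
  by (rule bounded_bilinear_matrix_vector_mult)

lemma bounded_linear_conj_transpose:
  "bounded_linear (conj_transpose :: complex^'n^'m \<Rightarrow> complex^'m^'n)"
  unfolding linear_conv_bounded_linear[symmetric]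
  by (rule linearI) (auto simp: vec_eq_iff conj_transpose_def)

lemmas linear_conj_transpose = bounded_linear.linear[OF bounded_linear_conj_transpose]
lemmas conj_transpose_0 [simp] = linear_0[OF linear_conj_transpose]
lemmas conj_transpose_add = linear_add[OF linear_conj_transpose]
lemmas conj_transpose_diff = linear_diff[OF linear_conj_transpose]
lemmas conj_transpose_scaleR = linear_scale[OF linear_conj_transpose]

lemmas [continuous_intros] = mm.continuous_on mv.continuous_on bounded_linear.continuous_on[OF bounded_linear_conj_transpose]

lemma borel_measurable_matrix_mult [measurable (raw)]:
  fixes f :: "'a \<Rightarrow> complex^'n^'m" and g :: "'a \<Rightarrow> complex^'k^'n"
  assumes "f \<in> borel_measurable M" "g \<in> borel_measurable M"
  shows "(\<lambda>x. f x ** g x) \<in> borel_measurable M"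
  by (rule borel_measurable_continuous_Pair[OF assms]) (intro continuous_intros)

lemma borel_measurable_conj_transpose [measurable]:
  "conj_transpose \<in> borel_measurable borel"
  by (intro borel_measurable_continuous_onI continuous_intros)

lemma conj_transpose_conj_transpose [simp]: "conj_transpose (conj_transpose A) = A"
  by (simp add: conj_transpose_def vec_eq_iff)

lemma conj_transpose_mult: "conj_transpose (A ** B) = conj_transpose B ** conj_transpose A"
  by (simp add: conj_transpose_def vec_eq_iff matrix_matrix_mult_def mult.commute)

lemma conj_transpose_mat_1 [simp]: "conj_transpose (mat 1) = mat 1"
  by (simp add: conj_transpose_def vec_eq_iff mat_def)

text \<open>The \<open>\<bullet>\<close> of \<open>complex^'n\<close> is the real part of the
  Hermitian form, and \<open>conj_transpose\<close> is the adjoint for it as well. All positivity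
  arguments therefore run over the real inner product.\<close>

lemma inner_conj_transpose: "(conj_transpose A *v x) \<bullet> y = x \<bullet> (A *v y)"
proof -
  have c: "u \<bullet> v = Re (cnj u * v)" for u v :: complex by (simp add: inner_complex_def)
  have 1: "cnj ((conj_transpose A *v x) $ i) * y $ i = (\<Sum>j\<in>UNIV. cnj (x $ j) * A $ j $ i * y $ i)" for i
    by (simp add: conj_transpose_def matrix_vector_mult_def sum_distrib_left sum_distrib_right mult_ac)
  have 2: "cnj (x $ j) * (A *v y) $ j = (\<Sum>i\<in>UNIV. cnj (x $ j) * A $ j $ i * y $ i)" for j
    by (simp add: matrix_vector_mult_def sum_distrib_left mult_ac)
  have "(conj_transpose A *v x) \<bullet> y = (\<Sum>i\<in>UNIV. \<Sum>j\<in>UNIV. Re (cnj (x $ j) * A $ j $ i * y $ i))"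
    by (simp only: inner_vec_def c 1 Re_sum)
  also have "\<dots> = (\<Sum>j\<in>UNIV. \<Sum>i\<in>UNIV. Re (cnj (x $ j) * A $ j $ i * y $ i))"
    by (rule sum.swap)
  also have "\<dots> = x \<bullet> (A *v y)"
    by (simp only: inner_vec_def c 2 Re_sum)
  finally show ?thesis .
qed

lemma pos_semidef_iff_inner: "pos_semidef A \<longleftrightarrow> hermitian A \<and> (\<forall>x. 0 \<le> x \<bullet> (A *v x))"
  by (simp add: pos_semidef_def inner_vec_def inner_complex_def Re_sum)

lemma norm_matrix_vector_mult_le:
  fixes A :: "complex^'n^'m"
  shows "norm (A *v x) \<le> norm A * norm x"
proof -
  have "norm ((A *v x) $ i) \<le> norm (A $ i) * norm x" for i
  proof -
    have "norm ((A *v x) $ i) \<le> (\<Sum>j\<in>UNIV. norm (A $ i $ j) * norm (x $ j))"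
      unfolding matrix_vector_mult_def by (simp add: norm_mult[symmetric] norm_sum)
    also have "\<dots> \<le> norm (A $ i) * norm x"
      unfolding norm_vec_def using L2_set_mult_ineq[of "\<lambda>j. norm (A $ i $ j)" "\<lambda>j. norm (x $ j)" UNIV]
      by simp
    finally show ?thesis .
  qed
  then have "norm (A *v x) \<le> L2_set (\<lambda>i. norm (A $ i) * norm x) UNIV"
    unfolding norm_vec_def[of "A *v x"] by (intro L2_set_mono) auto
  also have "\<dots> = norm A * norm x" unfolding norm_vec_def[of A] by (simp add: L2_set_left_distrib)
  finally show ?thesis .
qed

lemma abs_form_le: "\<bar>x \<bullet> (A *v x)\<bar> \<le> norm A * (norm x)\<^sup>2" for A :: "complex^'n^'n"
proof -
  have "\<bar>x \<bullet> (A *v x)\<bar> \<le> norm x * norm (A *v x)" by (rule Cauchy_Schwarz_ineq2)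
  also have "\<dots> \<le> norm x * (norm A * norm x)" by (intro mult_left_mono norm_matrix_vector_mult_le) auto
  finally show ?thesis by (simp add: power2_eq_square mult_ac)
qed

lemma subspace_hermitian: "subspace {A. hermitian A}"
  by (auto simp: subspace_def hermitian_def conj_transpose_add conj_transpose_scaleR)

lemma hermitian_mat_1 [simp]: "hermitian (mat 1)"
  by (simp add: hermitian_def)

lemma hermitian_congruence: "hermitian A \<Longrightarrow> hermitian (conj_transpose Q ** A ** Q)"
  by (simp add: hermitian_def conj_transpose_mult matrix_mul_assoc)

lemma form_congruence: "x \<bullet> ((conj_transpose Q ** A ** Q) *v x) = (Q *v x) \<bullet> (A *v (Q *v x))"
  by (simp add: matrix_vector_mul_assoc[symmetric] inner_conj_transpose inner_commute)
    (metis conj_transpose_conj_transpose inner_conj_transpose inner_commute)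

lemma invertible_iff_ker: "invertible A \<longleftrightarrow> (\<forall>x. A *v x = 0 \<longrightarrow> x = 0)" for A :: "complex^'n^'n"
  by (simp add: invertible_left_inverse matrix_left_invertible_ker)

lemma pos_semidef_congruence: "pos_semidef A \<Longrightarrow> pos_semidef (conj_transpose Q ** A ** Q)"
  by (simp add: pos_semidef_iff_inner hermitian_congruence form_congruence)

definition pos_def :: "complex^'n^'n \<Rightarrow> bool" where
  "pos_def A \<longleftrightarrow> hermitian A \<and> (\<forall>x. x \<noteq> 0 \<longrightarrow> 0 < x \<bullet> (A *v x))"

lemma pos_def_imp_pos_semidef: "pos_def A \<Longrightarrow> pos_semidef A"
  unfolding pos_def_def pos_semidef_iff_inner
  by (metis inner_zero_left less_eq_real_def)

text \<open>Along \<open>x + t *\<^sub>R (A *v x)\<close> the form is linear plus quadratic in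
  \<open>t\<close>, with slope twice the squared norm of \<open>A *v x\<close> at 0; it would be
  negative for small negative \<open>t\<close>.\<close>

lemma pos_semidef_form_eq_0:
  fixes A :: "complex^'n^'n"
  assumes A: "pos_semidef A" and x: "x \<bullet> (A *v x) = 0"
  shows "A *v x = 0"
proof (rule ccontr)
  assume "A *v x \<noteq> 0"
  define y where "y = A *v x"
  define c where "c = y \<bullet> (A *v y)"
  define n where "n = y \<bullet> y"
  have n: "n > 0" using \<open>A *v x \<noteq> 0\<close> by (simp add: n_def y_def)
  have c: "c \<ge> 0" using A by (simp add: c_def pos_semidef_iff_inner)
  have xy: "x \<bullet> (A *v y) = n"
    using A inner_conj_transpose[of A x y] by (simp add: pos_semidef_iff_inner hermitian_def n_def y_def)
  have form: "(x + t *\<^sub>R y) \<bullet> (A *v (x + t *\<^sub>R y)) = 2 * t * n + t\<^sup>2 * c" for t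
    using x xy by (simp add: mv.add_right mv.scaleR_right inner_add_left inner_add_right c_def
        n_def[symmetric] y_def[symmetric] power2_eq_square) (simp add: n_def inner_commute algebra_simps)
  \<comment> \<open>The form is tested at \<open>t = - n / d\<close>. Adding 1 keeps the denominator
    positive when \<open>c = 0\<close>, and the value is still negative.\<close>
  define d where "d = c + 1"
  have d: "d > 0" "c = d - 1" using c by (simp_all add: d_def)
  have "0 \<le> 2 * (- n / d) * n + (- n / d)\<^sup>2 * c"
    using A unfolding form[symmetric] by (simp add: pos_semidef_iff_inner)
  also have "\<dots> = - (n\<^sup>2 * (d + 1) / d\<^sup>2)"
    using d(1) unfolding d(2) by (simp add: divide_simps power2_eq_square) (simp add: algebra_simps)
  also have "\<dots> < 0" using n d by simp
  finally show False by simp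
qed

lemma pos_def_iff: "pos_def A \<longleftrightarrow> pos_semidef A \<and> invertible A"
proof
  assume A: "pos_def A"
  then have "invertible A" unfolding invertible_iff_ker pos_def_def by (metis inner_zero_right less_irrefl)
  with A show "pos_semidef A \<and> invertible A" by (simp add: pos_def_imp_pos_semidef)
next
  assume A: "pos_semidef A \<and> invertible A"
  then have "x \<bullet> (A *v x) \<noteq> 0" if "x \<noteq> 0" for x
    using that pos_semidef_form_eq_0[of A x] by (auto simp: invertible_iff_ker)
  with A show "pos_def A" unfolding pos_def_def pos_semidef_iff_inner by (metis less_eq_real_def)
qed

lemma pos_def_invertible: "pos_def A \<Longrightarrow> invertible A"
  by (simp add: pos_def_iff)

lemma pos_def_hermitian: "pos_def A \<Longrightarrow> hermitian A"
  by (simp add: pos_def_def)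

lemma pos_def_congruence: "pos_def A \<Longrightarrow> invertible Q \<Longrightarrow> pos_def (conj_transpose Q ** A ** Q)"
  for Q :: "complex^'n^'n"
  by (auto simp: pos_def_def hermitian_congruence form_congruence invertible_iff_ker)

lemma pos_def_mat_1: "pos_def (mat 1)"
  by (simp add: pos_def_def)

lemma pos_semidef_gram: "pos_semidef (conj_transpose G ** G)" for G :: "complex^'n^'n"
  using pos_semidef_congruence[OF pos_def_imp_pos_semidef[OF pos_def_mat_1], of G] by simp

lemma pos_def_gram_iff: "pos_def (conj_transpose G ** G) \<longleftrightarrow> invertible G" for G :: "complex^'n^'n"
proof
  assume "pos_def (conj_transpose G ** G)"
  then show "invertible G"
    by (metis invertible_iff_ker matrix_vector_mul_assoc mv.zero_right pos_def_invertible)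
next
  assume "invertible G"
  then show "pos_def (conj_transpose G ** G)" using pos_def_congruence[OF pos_def_mat_1] by simp
qed

text \<open>The minimum of the form on the compact unit sphere serves as \<open>m\<close>;
  homogeneity extends the bound to all vectors.\<close>

lemma pos_def_lower_bound:
  fixes A :: "complex^'n^'n"
  assumes "pos_def A"
  obtains m where "m > 0" "\<And>x. m * (norm x)\<^sup>2 \<le> x \<bullet> (A *v x)"
proof -
  let ?S = "sphere (0::complex^'n) 1"
  have "?S \<noteq> {}" by (simp add: sphere_eq_empty)
  moreover have "continuous_on ?S (\<lambda>x. x \<bullet> (A *v x))" by (intro continuous_intros)
  ultimately obtain u where u: "u \<in> ?S" "\<And>x. x \<in> ?S \<Longrightarrow> u \<bullet> (A *v u) \<le> x \<bullet> (A *v x)"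
    using continuous_attains_inf[OF compact_sphere, of 0 1 "\<lambda>x. x \<bullet> (A *v x)"] by blast
  show thesis
  proof (rule that)
    show "u \<bullet> (A *v u) > 0" using assms u(1) unfolding pos_def_def by (metis mem_sphere_0 norm_zero zero_neq_one)
    show "u \<bullet> (A *v u) * (norm x)\<^sup>2 \<le> x \<bullet> (A *v x)" for x
    proof (cases "x = 0")
      case False
      then have "u \<bullet> (A *v u) \<le> (x /\<^sub>R norm x) \<bullet> (A *v (x /\<^sub>R norm x))" by (intro u(2)) simp
      also have "\<dots> = x \<bullet> (A *v x) / (norm x)\<^sup>2"
        by (simp add: mv.scaleR_right power2_eq_square divide_inverse)
      finally show ?thesis using False by (simp add: field_simps)
    qed simp
  qed
qed

text \<open>Openness inside the Hermitian matrices, the form in which invariance of domain needs it: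
  a perturbation of norm below the lower bound of the form cannot destroy positivity.\<close>

lemma pos_def_open:
  assumes "pos_def A"
  obtains m where "m > 0" "\<And>B. hermitian B \<Longrightarrow> dist B A < m \<Longrightarrow> pos_def B"
proof -
  obtain m where m: "m > 0" "\<And>x. m * (norm x)\<^sup>2 \<le> x \<bullet> (A *v x)" using pos_def_lower_bound[OF assms] by blast
  show thesis
  proof (rule that[OF m(1)])
    fix B assume B: "hermitian B" "dist B A < m"
    show "pos_def B" unfolding pos_def_def
    proof (intro conjI allI impI B(1))
      fix x :: "complex^'a" assume x: "x \<noteq> 0"
      have "\<bar>x \<bullet> ((B - A) *v x)\<bar> \<le> norm (B - A) * (norm x)\<^sup>2" by (rule abs_form_le)
      also have "\<dots> < m * (norm x)\<^sup>2" using B(2) x by (simp add: dist_norm)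
      finally show "0 < x \<bullet> (B *v x)" using m(2)[of x] by (simp add: mv.diff_left inner_diff_right)
    qed
  qed
qed

lemma closed_pos_semidef: "closed {A::complex^'n^'n. pos_semidef A}"
proof -
  have "closed {A::complex^'n^'n. conj_transpose A = A}"
    by (intro closed_Collect_eq continuous_intros)
  moreover have "closed {A::complex^'n^'n. \<forall>x. 0 \<le> x \<bullet> (A *v x)}"
    by (intro closed_Collect_all closed_Collect_le continuous_intros)
  ultimately show ?thesis unfolding pos_semidef_iff_inner hermitian_def
    by (rule closed_Collect_conj)
qed

section \<open>Uniqueness and existence of square roots\<close>

lemma pos_semidef_square: "pos_semidef B \<Longrightarrow> pos_semidef (B ** B)"
  using pos_semidef_gram[of B] by (simp add: pos_semidef_def hermitian_def)

text \<open>With \<open>D = B - C\<close>, the positive semidefinite matrices \<open>DBD\<close> and \<open>DCD\<close> have traces that sum to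
  \<open>tr (D (B\<^sup>2 - C\<^sup>2)) = 0\<close>.\<close>

lemma pos_semidef_square_inj:
  fixes B C :: "complex^'n^'n"
  assumes B: "pos_semidef B" and C: "pos_semidef C" and eq: "B ** B = C ** C"
  shows "B = C"
proof -
  define D where "D = B - C"
  have D: "conj_transpose D = D"
    using B C by (simp add: D_def conj_transpose_diff pos_semidef_def hermitian_def)
  have herm: "conj_transpose B = B" "conj_transpose C = C" using B C by (auto simp: pos_semidef_def hermitian_def)
  let ?e = "\<lambda>i. axis i 1 :: complex^'n"
  have col: "M *v ?e i = column i M" for M :: "complex^'n^'n" and i
    by (simp add: vec_eq_iff matrix_vector_mult_def axis_def column_def if_distrib cong: if_cong)
  have tr: "(\<Sum>i\<in>UNIV. ?e i \<bullet> (M *v ?e i)) = Re (trace M)" for M :: "complex^'n^'n"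
    by (simp add: col inner_axis' trace_def column_def inner_complex_def)
  have sum0: "Re (trace (D ** B ** D)) + Re (trace (D ** C ** D)) = 0"
  proof -
    have "trace (D ** C ** D) = trace (D ** D ** C)"
      by (metis matrix_mul_assoc trace_mul_sym)
    then have "trace (D ** B ** D) + trace (D ** C ** D) = trace (D ** (B ** D + D ** C))"
      by (simp add: matrix_mul_assoc matrix_add_ldistrib trace_add)
    also have "B ** D + D ** C = B ** B - C ** C"
      by (simp add: D_def mm.diff_left mm.diff_right)
    finally show ?thesis by (simp add: eq flip: plus_complex.sel(1)) (simp add: trace_def)
  qed
  have form: "?e i \<bullet> ((D ** M ** D) *v ?e i) = (D *v ?e i) \<bullet> (M *v (D *v ?e i))" for i M
    using form_congruence[of "?e i" D M] by (simp add: D)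
  have nn: "0 \<le> ?e i \<bullet> ((D ** B ** D) *v ?e i)" "0 \<le> ?e i \<bullet> ((D ** C ** D) *v ?e i)" for i
    using B C unfolding form pos_semidef_iff_inner by auto
  have "(\<Sum>i\<in>UNIV. ?e i \<bullet> ((D ** B ** D) *v ?e i)) = 0" "(\<Sum>i\<in>UNIV. ?e i \<bullet> ((D ** C ** D) *v ?e i)) = 0"
    using sum0 sum_nonneg[of UNIV "\<lambda>i. ?e i \<bullet> ((D ** B ** D) *v ?e i)", OF nn(1)]
      sum_nonneg[of UNIV "\<lambda>i. ?e i \<bullet> ((D ** C ** D) *v ?e i)", OF nn(2)] unfolding tr by auto
  \<comment> \<open>The vanishing diagonal terms put \<open>D *v ?e i\<close> into the kernels of
    \<open>B\<close> and \<open>C\<close>, hence into that of \<open>D\<close>; self-adjointness of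
    \<open>D\<close> then makes \<open>D *v ?e i\<close> itself vanish.\<close>
  then have "?e i \<bullet> ((D ** B ** D) *v ?e i) = 0" "?e i \<bullet> ((D ** C ** D) *v ?e i) = 0" for i
    using nn by (simp_all add: sum_nonneg_eq_0_iff)
  then have "B *v (D *v ?e i) = 0" "C *v (D *v ?e i) = 0" for i
    using pos_semidef_form_eq_0[OF B] pos_semidef_form_eq_0[OF C] unfolding form by auto
  then have DD: "D *v (D *v ?e i) = 0" for i by (subst D_def) (simp add: mv.diff_left)
  have "D *v ?e i = 0" for i
  proof -
    have "(D *v ?e i) \<bullet> (D *v ?e i) = ?e i \<bullet> (D *v (D *v ?e i))"
      using inner_conj_transpose[of D "?e i" "D *v ?e i"] by (simp add: D)
    then show ?thesis by (simp add: DD)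
  qed
  then have "D = 0" by (simp add: col vec_eq_iff column_def)
  then show ?thesis by (simp add: D_def)
qed

text \<open>The trace is written \<open>mat 1 \<bullet> A\<close> throughout, so that bilinearity
  and the Cauchy-Schwarz inequality for \<open>\<bullet>\<close> apply to it.\<close>

lemma inner_mat_1: "mat 1 \<bullet> A = Re (trace A)" for A :: "complex^'n^'n"
proof -
  have "(if i = j then 1 else 0) \<bullet> z = (if j = i then Re z else 0)" for i j :: 'n and z :: complex
    by (auto simp: inner_complex_def)
  then show ?thesis by (simp add: inner_vec_def mat_def trace_def Re_sum)
qed

text \<open>This has two uses: it turns the Gaussian weight into a function of the Gram matrix
  alone, and by Cauchy-Schwarz it bounds \<open>G\<close> in terms of its Gram matrix.\<close>

lemma norm_gram: "(norm G)\<^sup>2 = mat 1 \<bullet> (conj_transpose G ** G)" for G :: "complex^'n^'n"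
proof -
  have c: "u \<bullet> v = Re (cnj u * v)" for u v :: complex by (simp add: inner_complex_def)
  have "mat 1 \<bullet> (conj_transpose G ** G) = (\<Sum>i\<in>UNIV. \<Sum>k\<in>UNIV. Re (cnj (G $ k $ i) * G $ k $ i))"
    unfolding inner_mat_1 trace_def matrix_matrix_mult_def conj_transpose_def by (simp only: vec_lambda_beta Re_sum)
  also have "\<dots> = (\<Sum>k\<in>UNIV. \<Sum>i\<in>UNIV. Re (cnj (G $ k $ i) * G $ k $ i))" by (rule sum.swap)
  also have "\<dots> = (norm G)\<^sup>2" unfolding power2_norm_eq_inner by (simp only: inner_vec_def c)
  finally show ?thesis by simp
qed

lemma norm_hermitian_square: "hermitian B \<Longrightarrow> (norm B)\<^sup>2 = mat 1 \<bullet> (B ** B)" for B :: "complex^'n^'n"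
  using norm_gram[of B] by (simp add: hermitian_def)

text \<open>Squaring is proper on Hermitian matrices: Cauchy-Schwarz with \<open>mat 1\<close>
  bounds \<open>B\<close> by the norm of \<open>B ** B\<close>, which is where the radius
  \<open>?r\<close> comes from. Inside each ball the set is thus cut out of a compact image, and
  closedness can be checked ball by ball.\<close>

lemma closed_pos_semidef_squares:
  "closed ((\<lambda>B::complex^'n^'n. B ** B) ` {B. pos_semidef B})" (is "closed ?S")
proof -
  let ?m = "norm (mat 1 :: complex^'n^'n)"
  have cl: "closed (cball A r \<inter> ?S)" for A r
  proof -
    let ?r = "sqrt (?m * (norm A + r))"
    have eq: "cball A r \<inter> ?S = cball A r \<inter> (\<lambda>B::complex^'n^'n. B ** B) ` ({B. pos_semidef B} \<inter> cball 0 ?r)"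
    proof (intro set_eqI iffI)
      fix X assume X: "X \<in> cball A r \<inter> ?S"
      then obtain B where B: "pos_semidef B" "X = B ** B" by auto
      have "norm X \<le> norm A + r"
        using X norm_triangle_ineq[of A "X - A"] by (auto simp: dist_norm norm_minus_commute)
      moreover have "(norm B)\<^sup>2 \<le> ?m * norm X"
        using B norm_hermitian_square[of B] norm_cauchy_schwarz[of "mat 1" X] by (simp add: pos_semidef_def)
      ultimately have "(norm B)\<^sup>2 \<le> ?m * (norm A + r)"
        by (meson mult_left_mono norm_ge_zero order_trans)
      then have "norm B \<le> ?r" by (simp add: real_le_rsqrt)
      then show "X \<in> cball A r \<inter> (\<lambda>B. B ** B) ` ({B. pos_semidef B} \<inter> cball 0 ?r)" using X B by auto
    qed auto
    have "compact ((\<lambda>B::complex^'n^'n. B ** B) ` ({B. pos_semidef B} \<inter> cball 0 ?r))"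
      by (intro compact_continuous_image continuous_intros closed_Int_compact closed_pos_semidef compact_cball)
    then show ?thesis unfolding eq by (intro closed_Int closed_cball compact_imp_closed)
  qed
  have "X \<in> ?S" if "X \<in> closure ?S" for X
  proof -
    have "X \<in> ball X 1 \<inter> closure ?S" using that by simp
    also have "\<dots> \<subseteq> closure (ball X 1 \<inter> ?S)" by (rule open_Int_closure_subset) simp
    also have "\<dots> \<subseteq> cball X 1 \<inter> ?S" by (rule closure_minimal[OF _ cl]) auto
    finally show ?thesis by simp
  qed
  then have "closure ?S \<subseteq> ?S" by (rule subsetI)
  then show ?thesis by (simp only: closure_subset_eq)
qed

text \<open>Squaring maps the connected set of positive definite matrices onto an open (by invariance of
  domain) and closed subset of itself.\<close>

lemma pos_def_sqrt_exists:
  fixes A :: "complex^'n^'n"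
  assumes "pos_def A"
  obtains B where "pos_def B" "B ** B = A"
proof -
  let ?P = "{A::complex^'n^'n. pos_def A}"
  let ?H = "{A::complex^'n^'n. hermitian A}"
  let ?sq = "\<lambda>B::complex^'n^'n. B ** B"
  have sub: "?sq ` ?P \<subseteq> ?P"
  proof
    fix X assume "X \<in> ?sq ` ?P"
    then obtain B where "pos_def B" "X = conj_transpose B ** B" by (auto simp: pos_def_def hermitian_def)
    then show "X \<in> ?P" by (simp add: pos_def_gram_iff pos_def_invertible)
  qed
  have PH: "?P \<subseteq> ?H" by (auto simp: pos_def_hermitian)
  have opP: "openin (top_of_set ?H) ?P"
    unfolding openin_euclidean_subtopology_iff
  proof (intro conjI PH ballI)
    fix X :: "complex^'n^'n" assume "X \<in> ?P"
    then obtain m where "m > 0" "\<And>B. hermitian B \<Longrightarrow> dist B X < m \<Longrightarrow> pos_def B"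
      using pos_def_open[of X] by blast
    then show "\<exists>e>0. \<forall>B\<in>?H. dist B X < e \<longrightarrow> B \<in> ?P" by auto
  qed
  have cont: "continuous_on ?P ?sq" by (intro continuous_intros)
  have inj: "inj_on ?sq ?P"
    by (rule inj_onI) (metis mem_Collect_eq pos_def_imp_pos_semidef pos_semidef_square_inj)
  have fim: "?sq \<in> ?P \<rightarrow> ?H"
  proof (rule funcsetI)
    fix B assume "B \<in> ?P"
    then have "?sq B \<in> ?sq ` ?P" by (rule imageI)
    then show "?sq B \<in> ?H" using sub PH by (meson subsetD)
  qed
  have "openin (top_of_set ?H) (?sq ` ?P)"
    by (rule invariance_of_domain_subspaces[OF opP subspace_hermitian subspace_hermitian order_refl cont fim inj])
  then have "openin (top_of_set ?P) (?sq ` ?P)" by (rule openin_subset_trans[OF _ sub PH])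
  moreover have "closedin (top_of_set ?P) (?sq ` ?P)"
  proof -
    \<comment> \<open>A semidefinite root of an invertible matrix is invertible, hence definite. So
      the image is the trace on \<open>?P\<close> of the closed set of all semidefinite
      squares.\<close>
    have eq: "?sq ` ?P = ?P \<inter> ?sq ` {B. pos_semidef B}"
    proof (intro set_eqI iffI)
      fix X assume "X \<in> ?P \<inter> ?sq ` {B. pos_semidef B}"
      then obtain B where B: "pos_semidef B" "X = B ** B" "invertible X" by (auto simp: pos_def_iff)
      then have "invertible B" by (metis invertible_iff_ker matrix_vector_mul_assoc mv.zero_right)
      with B show "X \<in> ?sq ` ?P" by (auto simp: pos_def_iff)
    qed (use sub in \<open>auto simp: pos_def_imp_pos_semidef\<close>)
    show ?thesis unfolding eq by (rule closedin_closed_Int[OF closed_pos_semidef_squares])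
  qed
  moreover have "connected ?P"
  proof (intro convex_connected convexI)
    fix X Y :: "complex^'n^'n" and u v :: real
    assume *: "X \<in> ?P" "Y \<in> ?P" "0 \<le> u" "0 \<le> v" "u + v = 1"
    then have "0 < u * (x \<bullet> (X *v x)) + v * (x \<bullet> (Y *v x))" if "x \<noteq> 0" for x
      using that unfolding pos_def_def
      by (smt (verit) mem_Collect_eq mult_nonneg_nonneg mult_pos_pos)
    then show "u *\<^sub>R X + v *\<^sub>R Y \<in> ?P"
      using * by (auto simp: pos_def_def hermitian_def conj_transpose_add conj_transpose_scaleR mv.add_left mv.scaleR_left inner_add_right)
  qed
  moreover have "?sq ` ?P \<noteq> {}" using pos_def_mat_1 by auto
  ultimately have "?sq ` ?P = ?P" by (meson connected_clopen)
  then have "A \<in> ?sq ` ?P" using assms by simp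
  then show thesis using that by auto
qed

section \<open>Inverse square roots\<close>

lemma matrix_inv_mult:
  fixes A :: "complex^'n^'n"
  assumes "invertible A"
  shows "A ** matrix_inv A = mat 1" "matrix_inv A ** A = mat 1"
  using someI_ex[OF assms[unfolded invertible_def]] by (simp_all add: matrix_inv_def)

lemma matrix_inv_eqI: "A ** B = mat 1 \<Longrightarrow> matrix_inv A = B" for A B :: "complex^'n^'n"
proof -
  assume AB: "A ** B = mat 1"
  then have "invertible A" by (auto simp: invertible_def matrix_left_right_inverse)
  then have "matrix_inv A ** (A ** B) = B" by (simp add: matrix_inv_mult matrix_mul_assoc)
  then show ?thesis by (simp add: AB)
qed

lemma psd_sqrt_eqI: "pos_semidef B \<Longrightarrow> psd_sqrt (B ** B) = B"
  unfolding psd_sqrt_def by (rule the_equality) (auto intro: pos_semidef_square_inj)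

lemma pos_def_square: "pos_def B \<Longrightarrow> pos_def (B ** B)" for B :: "complex^'n^'n"
  using pos_def_gram_iff[of B] by (simp add: pos_def_invertible pos_def_hermitian[unfolded hermitian_def])

lemma pos_def_inverse:
  fixes A B :: "complex^'n^'n"
  assumes "pos_def A" "A ** B = mat 1"
  shows "pos_def B"
proof -
  have "conj_transpose B ** A = mat 1"
    using assms by (metis conj_transpose_mat_1 conj_transpose_mult hermitian_def pos_def_hermitian)
  then have "conj_transpose B ** A ** B = B" by simp
  moreover have "invertible B" using assms(2) by (auto simp: invertible_left_inverse)
  ultimately show ?thesis using pos_def_congruence[OF assms(1)] by metis
qed

text \<open>Describes the graph of \<open>inv_sqrt\<close> over the positive definite matrices
  without inverses or descriptions. The left-hand side is closed in \<open>(S, R)\<close>, and it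
  forces \<open>S\<close> to be positive definite; this is what the measurability argument by closed
  graphs requires.\<close>

lemma inv_sqrt_iff:
  fixes S R :: "complex^'n^'n"
  shows "pos_semidef R \<and> R ** R ** S = mat 1 \<longleftrightarrow> pos_def S \<and> R = inv_sqrt S"
proof
  assume R: "pos_semidef R \<and> R ** R ** S = mat 1"
  then have S: "S ** (R ** R) = mat 1" by (simp add: matrix_left_right_inverse)
  then have "(S ** R) ** R = mat 1" by (simp add: matrix_mul_assoc)
  then have "invertible R" unfolding invertible_left_inverse by blast
  with R have "pos_def R" by (simp add: pos_def_iff)
  from pos_def_inverse[OF pos_def_square[OF this] conjunct2[OF R]] have "pos_def S" .
  moreover have "inv_sqrt S = R"
    using R by (simp add: inv_sqrt_def matrix_inv_eqI[OF S] psd_sqrt_eqI)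
  ultimately show "pos_def S \<and> R = inv_sqrt S" by simp
next
  assume S: "pos_def S \<and> R = inv_sqrt S"
  then obtain T where T: "S ** T = mat 1" using pos_def_invertible invertible_def by blast
  then obtain B where B: "pos_def B" "B ** B = T" using pos_def_sqrt_exists pos_def_inverse S by metis
  then have "R = B"
    using S T psd_sqrt_eqI[of B] by (simp add: inv_sqrt_def matrix_inv_eqI[OF T] pos_def_imp_pos_semidef)
  then show "pos_semidef R \<and> R ** R ** S = mat 1"
    using B T by (simp add: pos_def_imp_pos_semidef matrix_left_right_inverse)
qed

lemma inv_sqrt:
  fixes S :: "complex^'n^'n"
  assumes "pos_def S"
  shows pos_def_inv_sqrt: "pos_def (inv_sqrt S)"
    and inv_sqrt_congruence: "inv_sqrt S ** S ** inv_sqrt S = mat 1"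
proof -
  let ?R = "inv_sqrt S"
  have R: "pos_semidef ?R" "?R ** ?R ** S = mat 1" using inv_sqrt_iff[of ?R S] assms by auto
  have 1: "?R ** (?R ** S) = mat 1" using R(2) by (simp add: matrix_mul_assoc)
  then have 2: "?R ** S ** ?R = mat 1" by (simp add: matrix_left_right_inverse[of ?R])
  then show "?R ** S ** ?R = mat 1" .
  from 2 have "invertible ?R" unfolding invertible_left_inverse by blast
  with R(1) show "pos_def ?R" by (simp add: pos_def_iff)
qed

lemma closed_inv_sqrt_graph:
  "closed {(S::complex^'n^'n, R). pos_semidef R \<and> R ** R ** S = mat 1}"
proof -
  have "closed (snd -` {R::complex^'n^'n. pos_semidef R} :: ((complex^'n^'n) \<times> (complex^'n^'n)) set)"
    by (intro closed_vimage closed_pos_semidef continuous_intros)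
  then have "closed {p::(complex^'n^'n) \<times> (complex^'n^'n). pos_semidef (snd p)}" by (simp add: vimage_def)
  moreover have "closed {p::(complex^'n^'n) \<times> (complex^'n^'n). snd p ** snd p ** fst p = mat 1}"
    by (intro closed_Collect_eq continuous_intros)
  ultimately show ?thesis by (simp add: case_prod_unfold closed_Collect_conj)
qed

lemma borel_pos_def [measurable]: "{S::complex^'n^'n. pos_def S} \<in> sets borel"
  and inv_sqrt_measurable_pos_def:
    "(inv_sqrt :: complex^'n^'n \<Rightarrow> _) \<in> borel_measurable (restrict_space borel {S. pos_def S})"
  by (rule measurable_on_closed_graph[OF closed_inv_sqrt_graph], simp add: inv_sqrt_iff)+

lemma borel_invertible [measurable]: "{S::complex^'n^'n. invertible S} \<in> sets borel"
proof -
  have "continuous_on UNIV (\<lambda>S::complex^'n^'n. det S)" unfolding det_def by (intro continuous_intros)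
  then have "open {S::complex^'n^'n. det S \<noteq> 0}" by (intro open_Collect_neq continuous_intros) auto
  then show ?thesis by (simp add: invertible_det_nz)
qed

lemma borel_measurable_inv_sqrt [measurable]:
  "(inv_sqrt :: complex^'n^'n \<Rightarrow> complex^'n^'n) \<in> borel_measurable borel"
proof -
  \<comment> \<open>Off the positive definite matrices \<open>inv_sqrt\<close> takes only two
    default values. For invertible \<open>S\<close> the inverse is not semidefinite, so the
    \<open>THE\<close> in \<open>psd_sqrt\<close> has no candidate; for singular \<open>S\<close>
    already the \<open>SOME\<close> in \<open>matrix_inv\<close> has none.\<close>
  define c where "c = (THE B::complex^'n^'n. False)"
  define c' where "c' = psd_sqrt (SOME B::complex^'n^'n. False)"
  have inv: "inv_sqrt S = c" if "invertible S" "\<not> pos_def S" for S :: "complex^'n^'n"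
  proof -
    have "\<not> pos_semidef (matrix_inv S)"
    proof
      assume "pos_semidef (matrix_inv S)"
      moreover have "matrix_inv S ** S = mat 1" by (rule matrix_inv_mult(2)[OF that(1)])
      moreover from this have "invertible (matrix_inv S)" by (metis invertible_left_inverse matrix_left_right_inverse)
      ultimately show False using pos_def_inverse pos_def_iff that(2) by metis
    qed
    then have "(pos_semidef B \<and> B ** B = matrix_inv S) = False" for B
      using pos_semidef_square[of B] by auto
    then show ?thesis by (simp only: inv_sqrt_def psd_sqrt_def c_def)
  qed
  have sing: "inv_sqrt S = c'" if "\<not> invertible S" for S :: "complex^'n^'n"
  proof -
    have "(S ** B = mat 1 \<and> B ** S = mat 1) = False" for B using that by (auto simp: invertible_def)
    then show ?thesis by (simp only: inv_sqrt_def matrix_inv_def c'_def)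
  qed
  have eq: "inv_sqrt S = (if pos_def S then inv_sqrt S else if invertible S then c else c')"
    for S :: "complex^'n^'n" using inv sing by auto
  have "(\<lambda>S. if pos_def S then inv_sqrt S else if invertible S then c else c') \<in> borel_measurable borel"
    by (subst measurable_If_restrict_space_iff)
      (auto intro!: inv_sqrt_measurable_pos_def measurable_restrict_space1 measurable_If simp: borel_invertible)
  then show ?thesis by (simp only: eq[symmetric])
qed

section \<open>Lebesgue measure on Hermitian matrices and on tuples\<close>

text \<open>A null set in one coordinate yields a null box even if other factors have infinite mass,
  since 0 times infinity is 0 in \<open>ennreal\<close>.\<close>

lemma AE_PiM_finite:
  assumes M: "\<And>i. sigma_finite_measure (M i)" and I: "finite I"
    and P: "\<And>i. i \<in> I \<Longrightarrow> AE x in M i. P i x"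
  shows "AE x in PiM I M. \<forall>i\<in>I. P i (x i)"
proof (rule AE_finite_allI[OF I])
  fix i assume i: "i \<in> I"
  interpret product_sigma_finite M using M by (simp add: product_sigma_finite_def)
  obtain N where N: "N \<in> null_sets (M i)" "{x \<in> space (M i). \<not> P i x} \<subseteq> N"
    using AE_E[OF P[OF i]] by (auto simp: null_sets_def)
  let ?N = "\<Pi>\<^sub>E j\<in>I. if j = i then N else space (M j)"
  have sets: "(if j = i then N else space (M j)) \<in> sets (M j)" for j using N by auto
  have "emeasure (PiM I M) ?N = 0"
    using N i sets by (subst emeasure_PiM[OF I]) (auto intro!: prod_zero bexI[of _ i] simp: I)
  then have "?N \<in> null_sets (PiM I M)"
    using sets by (auto simp: null_sets_def intro!: sets_PiM_I_finite I)
  then show "AE x in PiM I M. P i (x i)"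
  proof (rule AE_I')
    show "{x \<in> space (PiM I M). \<not> P i (x i)} \<subseteq> ?N"
      using N(2) i by (auto simp: space_PiM PiE_iff extensional_def)
  qed
qed

text \<open>Carries a finite product from a function space to a Euclidean space:
  \<open>\<iota> i\<close> inserts and \<open>\<pi> i\<close> reads off the coordinate
  \<open>i\<close>. The continuous \<open>\<pi> i\<close> confine the preimage of a compact set to a
  box of compact sets. It serves both for the entries of a matrix and for the members of a
  tuple.\<close>

lemma translation_invariant_PiM:
  fixes L :: "'a::euclidean_space measure" and \<iota> :: "'i \<Rightarrow> 'a \<Rightarrow> 'b::euclidean_space"
  assumes L: "translation_invariant_measure_on A L" and I: "finite I"
    and lin: "\<And>i. i \<in> I \<Longrightarrow> linear (\<iota> i)"
    and p: "\<And>i. i \<in> I \<Longrightarrow> continuous_on UNIV (\<pi> i)"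
      "\<And>i x. i \<in> I \<Longrightarrow> \<pi> i (\<Sum>i\<in>I. \<iota> i (x i)) = x i"
    and B: "B \<in> sets borel" "\<And>z. z \<in> B \<longleftrightarrow> (\<exists>x. (\<forall>i\<in>I. x i \<in> A) \<and> z = (\<Sum>i\<in>I. \<iota> i (x i)))"
  shows "translation_invariant_measure_on B (distr (PiM I (\<lambda>_. L)) borel (\<lambda>x. \<Sum>i\<in>I. \<iota> i (x i)))"
proof -
  define T where "T = (\<lambda>x. \<Sum>i\<in>I. \<iota> i (x i))"
  have sets [measurable_cong, simp]: "sets L = sets borel" by (rule translation_invariant_sets[OF L])
  have [simp]: "space L = UNIV" using sets_eq_imp_space_eq[of L borel] by simp
  note LD = L[unfolded translation_invariant_measure_on_def]
  have A: "A \<in> sets L" using translation_invariant_borel[OF L] by simp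
  interpret product_sigma_finite "\<lambda>_. L"
    using translation_invariant_sigma_finite[OF L] by (simp add: product_sigma_finite_def)
  let ?P = "PiM I (\<lambda>_. L)"
  have meas: "\<iota> i \<in> borel_measurable borel" if "i \<in> I" for i
    using lin[OF that] by (simp add: borel_measurable_continuous_onI linear_continuous_on linear_conv_bounded_linear)
  have T [measurable]: "T \<in> borel_measurable ?P"
    unfolding T_def using meas by (intro borel_measurable_sum measurable_compose[OF measurable_component_singleton]) auto
  have emT: "emeasure (distr ?P borel T) X = emeasure ?P (T -` X \<inter> space ?P)" if "X \<in> sets borel" for X
    using that by (simp add: emeasure_distr)
  show ?thesis
    unfolding translation_invariant_measure_on_def T_def[symmetric]
  proof (intro conjI ballI allI impI)
    have "AE x in ?P. \<forall>i\<in>I. x i \<in> A"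
      by (intro AE_PiM_finite I translation_invariant_AE[OF L] sigma_finite_measures)
    then have "AE x in ?P. T x \<in> B"
      by eventually_elim (auto simp: B(2) T_def)
    then have "AE x in distr ?P borel T. x \<in> B" using B(1) by (subst AE_distr_iff) auto
    then show "emeasure (distr ?P borel T) (- B) = 0"
      using B(1) AE_iff_measurable[of "- B" "distr ?P borel T" "\<lambda>x. x \<in> B"] by auto
    have "emeasure ?P (\<Pi>\<^sub>E i\<in>I. A) = (\<Prod>i\<in>I. emeasure L A)" using A by (subst emeasure_PiM[OF I]) auto
    then have pos: "emeasure ?P (\<Pi>\<^sub>E i\<in>I. A) \<noteq> 0" using LD by (simp add: I)
    have "emeasure ?P (\<Pi>\<^sub>E i\<in>I. A) \<le> emeasure ?P (T -` B \<inter> space ?P)"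
    proof (rule emeasure_mono[OF _ measurable_sets[OF T B(1)]])
      show "(\<Pi>\<^sub>E i\<in>I. A) \<subseteq> T -` B \<inter> space ?P"
      proof
        fix x assume "x \<in> (\<Pi>\<^sub>E i\<in>I. A)"
        then have "T x \<in> B" "x \<in> space ?P" unfolding B(2) T_def by (auto simp: space_PiM PiE_iff)
        then show "x \<in> T -` B \<inter> space ?P" by simp
      qed
    qed
    with pos have "emeasure ?P (T -` B \<inter> space ?P) \<noteq> 0" by (metis le_zero_eq)
    then show "emeasure (distr ?P borel T) B \<noteq> 0" by (simp add: emT B(1))
    fix K :: "'b set" assume K: "compact K"
    have cK: "compact (\<pi> i ` K)" if "i \<in> I" for i
      using K p(1)[OF that] by (meson compact_continuous_image continuous_on_subset subset_UNIV)
    have "emeasure ?P (T -` K \<inter> space ?P) \<le> emeasure ?P (\<Pi>\<^sub>E i\<in>I. \<pi> i ` K)"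
    proof (rule emeasure_mono)
      show "T -` K \<inter> space ?P \<subseteq> (\<Pi>\<^sub>E i\<in>I. \<pi> i ` K)"
      proof
        fix x assume x: "x \<in> T -` K \<inter> space ?P"
        then have "x i \<in> \<pi> i ` K" if "i \<in> I" for i
          using p(2)[OF that, of x] by (auto simp: T_def intro!: rev_image_eqI)
        then show "x \<in> (\<Pi>\<^sub>E i\<in>I. \<pi> i ` K)" using x by (auto simp: space_PiM PiE_iff)
      qed
      show "(\<Pi>\<^sub>E i\<in>I. \<pi> i ` K) \<in> sets ?P" by (intro sets_PiM_I_finite I) (auto intro: borel_compact cK)
    qed
    also have "\<dots> = (\<Prod>i\<in>I. emeasure L (\<pi> i ` K))"
      by (intro emeasure_PiM I) (auto intro: borel_compact cK)
    also have "\<dots> < \<infinity>" using LD cK by (auto simp: less_top[symmetric] ennreal_prod_eq_top)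
    finally show "emeasure (distr ?P borel T) K < \<infinity>" using K by (simp add: emT borel_compact)
  next
    fix y z assume "y \<in> B" "z \<in> B"
    then obtain u v where uv: "\<forall>i\<in>I. u i \<in> A" "\<forall>i\<in>I. v i \<in> A" "y = T u" "z = T v"
      unfolding B(2) T_def by blast
    define s where "s = (\<lambda>x. \<lambda>i\<in>I. x i + (v i - u i))"
    have s [measurable]: "s \<in> measurable ?P ?P"
      unfolding s_def by (intro measurable_restrict) (auto intro!: borel_measurable_add measurable_component_singleton)
    have shift: "emeasure L ((\<lambda>x. x + (v i - u i)) -` X) = emeasure L X" if "i \<in> I" "X \<in> sets L" for i X
    proof -
      have "distr L borel (\<lambda>x. x + (v i - u i)) = L" using LD uv that by blast
      then have "emeasure L X = emeasure (distr L borel (\<lambda>x. x + (v i - u i))) X" by simp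
      then show ?thesis using that by (simp add: emeasure_distr)
    qed
    have "distr ?P ?P s = ?P"
    proof (rule PiM_eqI[OF I])
      fix X :: "'i \<Rightarrow> 'a set" assume X: "\<And>i. i \<in> I \<Longrightarrow> X i \<in> sets L"
      have pre: "(\<lambda>x. x + (v i - u i)) -` X i \<in> sets L" if "i \<in> I" for i
        using X[OF that] by (simp add: measurable_sets_borel[OF borel_measurable_add])
      have "emeasure (distr ?P ?P s) (Pi\<^sub>E I X) = emeasure ?P (s -` Pi\<^sub>E I X \<inter> space ?P)"
        by (intro emeasure_distr sets_PiM_I_finite I X s)
      also have "s -` Pi\<^sub>E I X \<inter> space ?P = (\<Pi>\<^sub>E i\<in>I. (\<lambda>x. x + (v i - u i)) -` X i)"
        by (auto simp: s_def space_PiM PiE_iff)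
      also have "emeasure ?P \<dots> = (\<Prod>i\<in>I. emeasure L ((\<lambda>x. x + (v i - u i)) -` X i))"
        by (rule emeasure_PiM[OF I pre])
      also have "\<dots> = (\<Prod>i\<in>I. emeasure L (X i))" by (intro prod.cong refl shift X)
      finally show "emeasure (distr ?P ?P s) (Pi\<^sub>E I X) = (\<Prod>i\<in>I. emeasure L (X i))" .
    qed simp
    moreover have "T (s x) = T x + (z - y)" for x
      using lin by (simp add: T_def s_def uv linear_add linear_diff sum.distrib sum_subtractf)
    ultimately show "distr (distr ?P borel T) borel (\<lambda>x. x + (z - y)) = distr ?P borel T"
      using distr_distr[of T ?P borel s ?P] by (subst distr_distr) (auto simp: comp_def)
  qed simp
qed

lemma translation_invariant_pair:
  fixes L :: "'a::euclidean_space measure" and M :: "'b::euclidean_space measure"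
  assumes L: "translation_invariant_measure_on A L" and M: "translation_invariant_measure_on B M"
  shows "translation_invariant_measure_on (A \<times> B) (L \<Otimes>\<^sub>M M)"
proof -
  have sets [measurable_cong, simp]: "sets L = sets borel" "sets M = sets borel"
    by (rule translation_invariant_sets, fact)+
  have space [simp]: "space L = UNIV" "space M = UNIV" using sets[THEN sets_eq_imp_space_eq] by simp_all
  note LD = L[unfolded translation_invariant_measure_on_def]
  note MD = M[unfolded translation_invariant_measure_on_def]
  note AB = translation_invariant_borel[OF L] translation_invariant_borel[OF M]
  interpret M: sigma_finite_measure M by (rule translation_invariant_sigma_finite[OF M])
  interpret L: sigma_finite_measure L by (rule translation_invariant_sigma_finite[OF L])
  interpret pair_sigma_finite L M ..
  have setsP: "sets (L \<Otimes>\<^sub>M M) = sets borel" by (simp add: borel_prod[symmetric] cong: sets_pair_measure_cong)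
  show ?thesis
    unfolding translation_invariant_measure_on_def
  proof (intro conjI ballI allI impI setsP)
    have "- (A \<times> B) = ((- A) \<times> UNIV) \<union> (UNIV \<times> (- B))" by auto
    moreover have "emeasure (L \<Otimes>\<^sub>M M) ((- A) \<times> UNIV) = 0" "emeasure (L \<Otimes>\<^sub>M M) (UNIV \<times> (- B)) = 0"
      using AB LD MD by (simp_all add: M.emeasure_pair_measure_Times)
    ultimately show "emeasure (L \<Otimes>\<^sub>M M) (- (A \<times> B)) = 0"
      using AB emeasure_subadditive[of "(- A) \<times> UNIV" "L \<Otimes>\<^sub>M M" "UNIV \<times> (- B)"] by auto
    show "emeasure (L \<Otimes>\<^sub>M M) (A \<times> B) \<noteq> 0"
      using AB LD MD by (simp add: M.emeasure_pair_measure_Times)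
    fix K :: "('a \<times> 'b) set" assume "compact K"
    then have K: "compact (fst ` K)" "compact (snd ` K)"
      by (auto intro!: compact_continuous_image continuous_intros)
    have "emeasure (L \<Otimes>\<^sub>M M) K \<le> emeasure (L \<Otimes>\<^sub>M M) (fst ` K \<times> snd ` K)"
      using K by (intro emeasure_mono) (auto intro!: pair_measureI borel_compact intro: rev_image_eqI)
    also have "\<dots> < \<infinity>"
      using K LD MD by (auto simp: M.emeasure_pair_measure_Times borel_compact ennreal_mult_less_top)
    finally show "emeasure (L \<Otimes>\<^sub>M M) K < \<infinity>" .
  next
    fix x y assume xy: "x \<in> A \<times> B" "y \<in> A \<times> B"
    let ?f = "\<lambda>z. z + (fst y - fst x)" and ?g = "\<lambda>z. z + (snd y - snd x)"
    have fg: "distr L borel ?f = L" "distr M borel ?g = M" using xy LD MD by auto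
    have "distr L borel ?f \<Otimes>\<^sub>M distr M borel ?g
        = distr (L \<Otimes>\<^sub>M M) (borel \<Otimes>\<^sub>M borel) (\<lambda>(a, b). (?f a, ?g b))"
      by (rule pair_measure_distr) (auto simp: fg M.sigma_finite_measure_axioms)
    also have "(\<lambda>(a, b). (?f a, ?g b)) = (\<lambda>z. z + (y - x))" by (auto simp: fun_eq_iff prod_eq_iff)
    finally show "distr (L \<Otimes>\<^sub>M M) borel (\<lambda>z. z + (y - x)) = L \<Otimes>\<^sub>M M" by (simp add: fg borel_prod)
  qed
qed

text \<open>A linear bijection onto the Hermitian matrices: the symmetric part becomes real, the
  antisymmetric part imaginary, and adding real and imaginary parts entrywise inverts it. It needs
  no order on the index type, unlike a parametrization by the entries above the diagonal.\<close>

definition herm_of_real :: "real^'n^'n \<Rightarrow> complex^'n^'n" where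
  "herm_of_real X = (\<chi> i j. Complex ((X $ i $ j + X $ j $ i) / 2) ((X $ i $ j - X $ j $ i) / 2))"

definition herm_lebesgue :: "(complex^'n^'n) measure" where
  "herm_lebesgue = distr lborel borel herm_of_real"

lemma closed_hermitian: "closed {A::complex^'n^'n. hermitian A}"
  unfolding hermitian_def by (intro closed_Collect_eq continuous_intros)

lemma herm_lebesgue:
  "translation_invariant_measure_on {A::complex^'n^'n. hermitian A} herm_lebesgue"
proof -
  have lin: "linear (herm_of_real :: real^'n^'n \<Rightarrow> complex^'n^'n)"
    by (rule linearI) (auto simp: herm_of_real_def vec_eq_iff complex_eq_iff field_simps)
  define S :: "complex^'n^'n \<Rightarrow> real^'n^'n" where "S = (\<lambda>A. \<chi> i j. Re (A $ i $ j) + Im (A $ i $ j))"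
  have S: "S (herm_of_real X) = X" for X :: "real^'n^'n"
    by (simp add: S_def herm_of_real_def vec_eq_iff field_simps)
  have S': "herm_of_real (S A) = A" if "hermitian A" for A :: "complex^'n^'n"
  proof -
    have "herm_of_real (S A) $ i $ j = A $ i $ j" for i j
    proof -
      have "conj_transpose A $ i $ j = A $ i $ j" using that by (simp add: hermitian_def)
      then have "Re (A $ j $ i) = Re (A $ i $ j)" "Im (A $ j $ i) = - Im (A $ i $ j)"
        by (auto simp: conj_transpose_def complex_eq_iff)
      then show ?thesis by (simp add: herm_of_real_def S_def complex_eq_iff)
    qed
    then show ?thesis by (simp add: vec_eq_iff)
  qed
  have range: "range (herm_of_real :: real^'n^'n \<Rightarrow> complex^'n^'n) = {A. hermitian A}"
  proof (intro set_eqI iffI)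
    fix A :: "complex^'n^'n" assume "A \<in> {A. hermitian A}"
    then show "A \<in> range herm_of_real" using S'[of A] by (metis mem_Collect_eq rangeI)
  qed (auto simp: hermitian_def conj_transpose_def herm_of_real_def vec_eq_iff complex_eq_iff field_simps)
  have "continuous_on UNIV S" unfolding S_def by (intro continuous_intros)
  then have "translation_invariant_measure_on (range herm_of_real)
      (distr lborel borel (herm_of_real :: real^'n^'n \<Rightarrow> complex^'n^'n))"
    by (intro translation_invariant_image[OF translation_invariant_lborel _ lin, of S])
      (auto simp: S range borel_closed closed_hermitian)
  then show ?thesis by (simp add: range herm_lebesgue_def)
qed

lemma sets_herm_lebesgue [measurable_cong, simp]: "sets herm_lebesgue = sets borel"
  by (simp add: herm_lebesgue_def)

section \<open>Jacobians of multiplications and congruences\<close>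

text \<open>For each \<open>p\<close> separately, uniqueness yields some factor, but a pointwise
  choice need not be measurable in \<open>p\<close>. Testing on one fixed ball gives a formula for
  the factor, whose measurability comes from Tonelli.\<close>

lemma measurable_jacobian:
  fixes T :: "'p::euclidean_space \<Rightarrow> 'a::euclidean_space \<Rightarrow> 'a"
  assumes L: "translation_invariant_measure_on V L"
    and meas: "(\<lambda>(p, x). T p x) \<in> borel_measurable (borel \<Otimes>\<^sub>M borel)"
    and T: "\<And>p. p \<in> D \<Longrightarrow> linear (T p)" "\<And>p. p \<in> D \<Longrightarrow> T p ` V = V"
    and S: "\<And>p. p \<in> D \<Longrightarrow> continuous_on UNIV (S p)" "\<And>p x. p \<in> D \<Longrightarrow> x \<in> V \<Longrightarrow> S p (T p x) = x"
  obtains j where "j \<in> borel_measurable borel" "\<And>p. p \<in> D \<Longrightarrow> j p \<noteq> 0" "\<And>p. p \<in> D \<Longrightarrow> j p \<noteq> \<infinity>"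
    "\<And>p f. p \<in> D \<Longrightarrow> f \<in> borel_measurable borel \<Longrightarrow> (\<integral>\<^sup>+x. f (T p x) \<partial>L) = j p * (\<integral>\<^sup>+x. f x \<partial>L)"
proof -
  have sets [measurable_cong, simp]: "sets L = sets borel" by (rule translation_invariant_sets[OF L])
  interpret sigma_finite_measure L by (rule translation_invariant_sigma_finite[OF L])
  obtain r where r: "emeasure L (cball 0 r) \<noteq> 0" using translation_invariant_cball_pos[OF L] by blast
  have fin: "emeasure L (cball 0 r) \<noteq> \<infinity>"
    using L unfolding translation_invariant_measure_on_def by (metis compact_cball less_irrefl)
  define g :: "'a \<Rightarrow> ennreal" where "g = indicator (cball 0 r)"
  have [measurable]: "g \<in> borel_measurable borel"
    unfolding g_def by (intro borel_measurable_indicator borel_closed closed_cball)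
  have g: "(\<integral>\<^sup>+x. g x \<partial>L) = emeasure L (cball 0 r)" by (simp add: g_def)
  define j where "j = (\<lambda>p. (\<integral>\<^sup>+x. g (T p x) \<partial>L) / emeasure L (cball 0 r))"
  have "\<exists>c. c \<noteq> 0 \<and> c \<noteq> \<infinity> \<and> (\<forall>f\<in>borel_measurable borel. (\<integral>\<^sup>+x. f (T p x) \<partial>L) = c * (\<integral>\<^sup>+x. f x \<partial>L))"
    if p: "p \<in> D" for p
    using translation_invariant_image_scale[OF L, of "T p" L "S p"] L T[OF p] S(1)[OF p] S(2)[OF p] by metis
  then have "\<forall>p\<in>D. \<exists>c. c \<noteq> 0 \<and> c \<noteq> \<infinity> \<and>
      (\<forall>f\<in>borel_measurable borel. (\<integral>\<^sup>+x. f (T p x) \<partial>L) = c * (\<integral>\<^sup>+x. f x \<partial>L))"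
    by (rule ballI)
  from bchoice[OF this] obtain c where c0: "\<forall>p\<in>D. c p \<noteq> 0 \<and> c p \<noteq> \<infinity> \<and>
      (\<forall>f\<in>borel_measurable borel. (\<integral>\<^sup>+x. f (T p x) \<partial>L) = c p * (\<integral>\<^sup>+x. f x \<partial>L))" ..
  have c: "c p \<noteq> 0" "c p \<noteq> \<infinity>"
      "\<And>f. f \<in> borel_measurable borel \<Longrightarrow> (\<integral>\<^sup>+x. f (T p x) \<partial>L) = c p * (\<integral>\<^sup>+x. f x \<partial>L)"
    if "p \<in> D" for p using bspec[OF c0 that] by auto
  have j: "j p = c p" if "p \<in> D" for p
    using c(3)[OF that, of g] r fin by (simp add: j_def g ennreal_mult_divide_eq)
  show thesis
  proof (rule that)
    have "(\<lambda>(p, x). g (T p x)) \<in> borel_measurable (borel \<Otimes>\<^sub>M borel)"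
      using measurable_compose[OF meas, of g borel] by (simp add: case_prod_unfold)
    then have "(\<lambda>(p, x). g (T p x)) \<in> borel_measurable (borel \<Otimes>\<^sub>M L)"
      by (simp cong: measurable_cong_sets sets_pair_measure_cong)
    then show "j \<in> borel_measurable borel" unfolding j_def
      using borel_measurable_nn_integral_fst[of "\<lambda>(p, x). g (T p x)" borel] by simp
    show "j p \<noteq> \<infinity>" if "p \<in> D" for p using c(2)[OF that] j[OF that] by simp
  qed (simp_all add: j c)
qed

text \<open>In closed form the factor is |det Q| to the power -2n, with n = \<open>CARD('n)\<close>,
  and so are the factors for right multiplication and for congruence below. Only their agreement on
  positive definite matrices is used, and it is proved without determinants.\<close>

lemma left_mult_jacobian:
  obtains j :: "complex^'n^'n \<Rightarrow> ennreal" where "j \<in> borel_measurable borel"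
    "\<And>Q. invertible Q \<Longrightarrow> j Q \<noteq> 0" "\<And>Q. invertible Q \<Longrightarrow> j Q \<noteq> \<infinity>"
    "\<And>Q f. invertible Q \<Longrightarrow> f \<in> borel_measurable borel \<Longrightarrow>
       (\<integral>\<^sup>+G. f (Q ** G) \<partial>lborel) = j Q * (\<integral>\<^sup>+G. f G \<partial>(lborel :: (complex^'n^'n) measure))"
proof (rule measurable_jacobian[OF translation_invariant_lborel,
      of "(**)" "{Q::complex^'n^'n. invertible Q}" "\<lambda>Q G. matrix_inv Q ** G"])
  fix Q :: "complex^'n^'n" assume Q: "Q \<in> {Q. invertible Q}"
  then have inv: "Q ** (matrix_inv Q ** G) = G" "matrix_inv Q ** (Q ** G) = G" for G
    by (simp_all add: matrix_mul_assoc matrix_inv_mult)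
  show "linear ((**) Q)" by (rule linearI) (simp_all add: mm.add_right mm.scaleR_right)
  show "(**) Q ` UNIV = UNIV" by (metis inv(1) surj_def)
  show "matrix_inv Q ** (Q ** G) = G" for G by (rule inv)
next
  fix j :: "complex^'n^'n \<Rightarrow> ennreal"
  assume "j \<in> borel_measurable borel"
    "\<And>p. p \<in> {Q. invertible Q} \<Longrightarrow> j p \<noteq> 0" "\<And>p. p \<in> {Q. invertible Q} \<Longrightarrow> j p \<noteq> \<infinity>"
    "\<And>p (f :: complex^'n^'n \<Rightarrow> ennreal). p \<in> {Q. invertible Q} \<Longrightarrow> f \<in> borel_measurable borel \<Longrightarrow>
      (\<integral>\<^sup>+x. f (p ** x) \<partial>lborel) = j p * (\<integral>\<^sup>+x. f x \<partial>lborel)"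
  then show thesis by (intro that[of j]) auto
qed (auto intro!: continuous_intros)

lemma right_mult_jacobian:
  obtains j :: "complex^'n^'n \<Rightarrow> ennreal" where "j \<in> borel_measurable borel"
    "\<And>Q. invertible Q \<Longrightarrow> j Q \<noteq> 0" "\<And>Q. invertible Q \<Longrightarrow> j Q \<noteq> \<infinity>"
    "\<And>Q f. invertible Q \<Longrightarrow> f \<in> borel_measurable borel \<Longrightarrow>
       (\<integral>\<^sup>+G. f (G ** Q) \<partial>lborel) = j Q * (\<integral>\<^sup>+G. f G \<partial>(lborel :: (complex^'n^'n) measure))"
proof (rule measurable_jacobian[OF translation_invariant_lborel,
      of "\<lambda>Q G. G ** Q" "{Q::complex^'n^'n. invertible Q}" "\<lambda>Q G. G ** matrix_inv Q"])
  fix Q :: "complex^'n^'n" assume Q: "Q \<in> {Q. invertible Q}"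
  then have inv: "G ** matrix_inv Q ** Q = G" "G ** Q ** matrix_inv Q = G" for G
    by (simp_all add: matrix_mul_assoc[symmetric] matrix_inv_mult)
  show "linear (\<lambda>G. G ** Q)" by (rule linearI) (simp_all add: mm.add_left mm.scaleR_left)
  show "(\<lambda>G. G ** Q) ` UNIV = UNIV" by (metis inv(1) surj_def)
  show "G ** Q ** matrix_inv Q = G" for G by (rule inv)
next
  fix j :: "complex^'n^'n \<Rightarrow> ennreal"
  assume "j \<in> borel_measurable borel"
    "\<And>p. p \<in> {Q. invertible Q} \<Longrightarrow> j p \<noteq> 0" "\<And>p. p \<in> {Q. invertible Q} \<Longrightarrow> j p \<noteq> \<infinity>"
    "\<And>p (f :: complex^'n^'n \<Rightarrow> ennreal). p \<in> {Q. invertible Q} \<Longrightarrow> f \<in> borel_measurable borel \<Longrightarrow>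
      (\<integral>\<^sup>+x. f (x ** p) \<partial>lborel) = j p * (\<integral>\<^sup>+x. f x \<partial>lborel)"
  then show thesis by (intro that[of j]) auto
qed (auto intro!: continuous_intros)

lemma linear_congruence: "linear (\<lambda>X. A ** X ** B :: complex^'n^'n)"
  by (auto intro!: linearI simp: mm.add_left mm.add_right mm.scaleR_left mm.scaleR_right)

lemma congruence_inverse:
  fixes G X :: "complex^'n^'n"
  assumes "invertible G"
  shows "conj_transpose (matrix_inv G) ** (conj_transpose G ** X ** G) ** matrix_inv G = X"
    and "conj_transpose G ** (conj_transpose (matrix_inv G) ** X ** matrix_inv G) ** G = X"
proof -
  note inv = matrix_inv_mult[OF assms]
  have 1: "conj_transpose (matrix_inv G) ** conj_transpose G = mat 1"
      "conj_transpose G ** conj_transpose (matrix_inv G) = mat 1"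
    by (simp_all add: inv flip: conj_transpose_mult)
  have "conj_transpose (matrix_inv G) ** (conj_transpose G ** X ** G) ** matrix_inv G
      = conj_transpose (matrix_inv G) ** conj_transpose G ** X ** (G ** matrix_inv G)"
    by (simp add: matrix_mul_assoc)
  then show "conj_transpose (matrix_inv G) ** (conj_transpose G ** X ** G) ** matrix_inv G = X"
    by (simp add: 1 inv)
  have "conj_transpose G ** (conj_transpose (matrix_inv G) ** X ** matrix_inv G) ** G
      = conj_transpose G ** conj_transpose (matrix_inv G) ** X ** (matrix_inv G ** G)"
    by (simp add: matrix_mul_assoc)
  then show "conj_transpose G ** (conj_transpose (matrix_inv G) ** X ** matrix_inv G) ** G = X"
    by (simp add: 1 inv)
qed

lemma congruence_jacobian:
  obtains j :: "complex^'n^'n \<Rightarrow> ennreal" where "j \<in> borel_measurable borel"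
    "\<And>G. invertible G \<Longrightarrow> j G \<noteq> 0" "\<And>G. invertible G \<Longrightarrow> j G \<noteq> \<infinity>"
    "\<And>G f. invertible G \<Longrightarrow> f \<in> borel_measurable borel \<Longrightarrow>
       (\<integral>\<^sup>+X. f (conj_transpose G ** X ** G) \<partial>herm_lebesgue) = j G * (\<integral>\<^sup>+X. f X \<partial>herm_lebesgue)"
proof (rule measurable_jacobian[OF herm_lebesgue, of "\<lambda>G X. conj_transpose G ** X ** G"
      "{G::complex^'n^'n. invertible G}" "\<lambda>G X. conj_transpose (matrix_inv G) ** X ** matrix_inv G"])
  fix G :: "complex^'n^'n" assume G: "G \<in> {G. invertible G}"
  show "(\<lambda>X. conj_transpose G ** X ** G) ` {X. hermitian X} = {X. hermitian X}"
  proof (intro set_eqI iffI)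
    fix X assume "X \<in> {X::complex^'n^'n. hermitian X}"
    then show "X \<in> (\<lambda>X. conj_transpose G ** X ** G) ` {X. hermitian X}"
      using G by (intro image_eqI[of _ _ "conj_transpose (matrix_inv G) ** X ** matrix_inv G"])
        (simp_all add: congruence_inverse hermitian_congruence)
  qed (auto simp: hermitian_congruence)
next
  fix j :: "complex^'n^'n \<Rightarrow> ennreal"
  assume "j \<in> borel_measurable borel"
    "\<And>p. p \<in> {Q. invertible Q} \<Longrightarrow> j p \<noteq> 0" "\<And>p. p \<in> {Q. invertible Q} \<Longrightarrow> j p \<noteq> \<infinity>"
    "\<And>p (f :: complex^'n^'n \<Rightarrow> ennreal). p \<in> {Q. invertible Q} \<Longrightarrow> f \<in> borel_measurable borel \<Longrightarrow>
      (\<integral>\<^sup>+x. f (conj_transpose p ** x ** p) \<partial>herm_lebesgue) = j p * (\<integral>\<^sup>+x. f x \<partial>herm_lebesgue)"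
  then show thesis by (intro that[of j]) auto
qed (auto intro!: continuous_intros linear_congruence simp: congruence_inverse)

text \<open>Links Lebesgue measure on all matrices to two copies of the Hermitian one. In the proof,
  \<open>?S\<close> is the inverse of \<open>?T\<close>: it returns the Hermitian part and the
  anti-Hermitian part divided by the imaginary unit.\<close>

lemma hermitian_decomposition_lborel:
  obtains c where "c \<noteq> 0" "c \<noteq> \<infinity>" "\<And>f. f \<in> borel_measurable borel \<Longrightarrow>
    (\<integral>\<^sup>+X. \<integral>\<^sup>+Y. f (X + map_matrix ((*) \<i>) Y) \<partial>herm_lebesgue \<partial>herm_lebesgue) = c * (\<integral>\<^sup>+G. f G \<partial>(lborel :: (complex^'n^'n) measure))"
proof -
  let ?H = "{A::complex^'n^'n. hermitian A}"
  let ?T = "\<lambda>(X::complex^'n^'n, Y::complex^'n^'n). X + map_matrix ((*) \<i>) Y"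
  let ?S = "\<lambda>G::complex^'n^'n. ((1/2) *\<^sub>R (G + conj_transpose G),
      map_matrix ((*) (- \<i> / 2)) (G - conj_transpose G))"
  interpret H: sigma_finite_measure "herm_lebesgue :: (complex^'n^'n) measure"
    by (rule translation_invariant_sigma_finite[OF herm_lebesgue])
  have L: "translation_invariant_measure_on (?H \<times> ?H) (herm_lebesgue \<Otimes>\<^sub>M herm_lebesgue)"
    by (intro translation_invariant_pair herm_lebesgue)
  have lin: "linear ?T"
    by (rule linearI) (auto simp: vec_eq_iff map_matrix_def algebra_simps)
  have S: "?S (?T x) = x" if "x \<in> ?H \<times> ?H" for x
    using that by (auto simp: vec_eq_iff map_matrix_def hermitian_def conj_transpose_def field_simps)
  have surj: "G \<in> ?T ` (?H \<times> ?H)" for G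
  proof (rule image_eqI[of _ _ "?S G"])
    show "G = ?T (?S G)" by (simp add: vec_eq_iff map_matrix_def conj_transpose_def field_simps)
    show "?S G \<in> ?H \<times> ?H"
      by (auto simp: vec_eq_iff map_matrix_def conj_transpose_def hermitian_def field_simps)
  qed
  then have L': "translation_invariant_measure_on (?T ` (?H \<times> ?H)) lborel"
    using translation_invariant_lborel by (metis UNIV_eq_I)
  have "continuous_on UNIV ?S" unfolding map_matrix_def by (intro continuous_intros)
  then obtain c where c: "c \<noteq> 0" "c \<noteq> \<infinity>"
    "\<And>f. f \<in> borel_measurable borel \<Longrightarrow>
      (\<integral>\<^sup>+x. f (?T x) \<partial>(herm_lebesgue \<Otimes>\<^sub>M herm_lebesgue)) = c * (\<integral>\<^sup>+G. f G \<partial>lborel)"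
    using translation_invariant_image_scale[OF L L' lin _ S] by blast
  show thesis
  proof (rule that[OF c(1,2)])
    fix f :: "complex^'n^'n \<Rightarrow> ennreal" assume f: "f \<in> borel_measurable borel"
    have "?T \<in> borel_measurable borel"
      using lin by (simp add: borel_measurable_continuous_onI linear_continuous_on linear_conv_bounded_linear)
    then have "(\<lambda>x. f (?T x)) \<in> borel_measurable (borel \<Otimes>\<^sub>M borel)"
      using f by (simp add: borel_prod)
    then have "(\<lambda>x. f (?T x)) \<in> borel_measurable (herm_lebesgue \<Otimes>\<^sub>M herm_lebesgue)"
      by (simp cong: measurable_cong_sets sets_pair_measure_cong)
    from H.nn_integral_fst[OF this] c(3)[OF f]
    show "(\<integral>\<^sup>+X. \<integral>\<^sup>+Y. f (X + map_matrix ((*) \<i>) Y) \<partial>herm_lebesgue \<partial>herm_lebesgue) = c * (\<integral>\<^sup>+G. f G \<partial>lborel)"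
      by simp
  qed
qed

lemma ennreal_square_eq_iff: "a * a = b * b \<longleftrightarrow> a = b" for a b :: ennreal
proof
  assume "a * a = b * b"
  then show "a = b"
    by (cases a; cases b) (auto simp: ennreal_mult[symmetric] ennreal_mult_top ennreal_top_mult square_eq_iff)
qed simp

lemma translation_invariant_cancel:
  fixes a b :: ennreal and L :: "'a::euclidean_space measure"
  assumes L: "translation_invariant_measure_on A L"
    and eq: "\<And>f. f \<in> borel_measurable borel \<Longrightarrow> a * integral\<^sup>N L f = b * integral\<^sup>N L f"
  shows "a = b"
proof -
  have [simp]: "sets L = sets borel" by (rule translation_invariant_sets[OF L])
  obtain r where r: "emeasure L (cball 0 r) \<noteq> 0" using translation_invariant_cball_pos[OF L] by blast
  have fin: "emeasure L (cball 0 r) \<noteq> \<infinity>"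
    using L unfolding translation_invariant_measure_on_def by (metis compact_cball less_irrefl)
  have "(indicator (cball 0 r) :: 'a \<Rightarrow> ennreal) \<in> borel_measurable borel"
    by (intro borel_measurable_indicator borel_closed closed_cball)
  then show ?thesis using eq[of "indicator (cball 0 r)"] r fin
    by (simp add: mult.commute[of a] mult.commute[of b] ennreal_mult_cancel_left borel_closed)
qed

text \<open>\<open>X \<mapsto> QXQ\<close> acts on both summands of \<open>M\<^sub>n = Herm \<oplus> i Herm\<close> with Jacobian \<open>h\<close>, so \<open>h\<^sup>2 = l r\<close>;
  taking adjoints exchanges \<open>l\<close> and \<open>r\<close>.\<close>

lemma jacobian_hermitian_eq:
  fixes Q :: "complex^'n^'n"
  assumes Q: "hermitian Q"
    and l: "\<And>f. f \<in> borel_measurable borel \<Longrightarrow> (\<integral>\<^sup>+G. f (Q ** G) \<partial>lborel) = l * (\<integral>\<^sup>+G. f G \<partial>(lborel :: (complex^'n^'n) measure))"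
    and r: "\<And>f. f \<in> borel_measurable borel \<Longrightarrow> (\<integral>\<^sup>+G. f (G ** Q) \<partial>lborel) = r * (\<integral>\<^sup>+G. f G \<partial>(lborel :: (complex^'n^'n) measure))"
    and h: "\<And>f. f \<in> borel_measurable borel \<Longrightarrow>
       (\<integral>\<^sup>+X. f (Q ** X ** Q) \<partial>herm_lebesgue) = h * (\<integral>\<^sup>+X. f X \<partial>herm_lebesgue)"
  shows "l = r" "h = r"
proof -
  have ctQ: "conj_transpose Q = Q" using Q by (simp add: hermitian_def)
  obtain c where c: "c \<noteq> 0" "c \<noteq> \<infinity>" "\<And>f. f \<in> borel_measurable borel \<Longrightarrow>
      (\<integral>\<^sup>+G. f (conj_transpose G) \<partial>lborel) = c * (\<integral>\<^sup>+G. f G \<partial>(lborel :: (complex^'n^'n) measure))"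
  proof (rule translation_invariant_image_scale[OF translation_invariant_lborel, of conj_transpose lborel conj_transpose])
    have "range (conj_transpose :: complex^'n^'n \<Rightarrow> _) = UNIV" by (metis conj_transpose_conj_transpose surj_def)
    then show "translation_invariant_measure_on (range (conj_transpose :: complex^'n^'n \<Rightarrow> _)) lborel"
      by (simp add: translation_invariant_lborel)
  qed (auto intro!: continuous_intros linear_conj_transpose)
  \<comment> \<open>Here \<open>c\<close> is the factor of the adjoint map. It need not be known: it
    occurs on both sides and cancels, as does the constant of the decomposition in the second
    half.\<close>
  have "(c * l) * (\<integral>\<^sup>+G. f G \<partial>lborel) = (c * r) * (\<integral>\<^sup>+G. f G \<partial>lborel)"
    if f [measurable]: "f \<in> borel_measurable borel" for f :: "complex^'n^'n \<Rightarrow> ennreal"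
  proof -
    have "(c * l) * (\<integral>\<^sup>+G. f G \<partial>lborel) = (\<integral>\<^sup>+G. f (Q ** conj_transpose G) \<partial>lborel)"
      by (simp add: c(3)[of "\<lambda>G. f (Q ** G)"] l[OF f] mult.assoc)
    also have "\<dots> = (\<integral>\<^sup>+G. f (conj_transpose (G ** Q)) \<partial>lborel)" by (simp add: conj_transpose_mult ctQ)
    also have "\<dots> = (c * r) * (\<integral>\<^sup>+G. f G \<partial>lborel)"
      by (simp add: r[of "\<lambda>G. f (conj_transpose G)"] c(3) mult_ac)
    finally show ?thesis .
  qed
  from translation_invariant_cancel[OF translation_invariant_lborel this] show lr: "l = r" using c by (simp add: ennreal_mult_cancel_left)
  obtain c where c: "c \<noteq> 0" "c \<noteq> \<infinity>" "\<And>f. f \<in> borel_measurable borel \<Longrightarrow>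
    (\<integral>\<^sup>+X. \<integral>\<^sup>+Y. f (X + map_matrix ((*) \<i>) Y) \<partial>herm_lebesgue \<partial>herm_lebesgue) = c * (\<integral>\<^sup>+G. f G \<partial>(lborel :: (complex^'n^'n) measure))"
    using hermitian_decomposition_lborel by blast
  have iQ: "Q ** map_matrix ((*) \<i>) Y ** Q = map_matrix ((*) \<i>) (Q ** Y ** Q)" for Y
    by (simp add: vec_eq_iff map_matrix_def matrix_matrix_mult_def sum_distrib_left sum_distrib_right mult_ac)
  have im [measurable]: "map_matrix ((*) \<i>) \<in> borel_measurable (borel :: (complex^'n^'n) measure)"
    unfolding map_matrix_def by (intro borel_measurable_continuous_onI continuous_intros)
  interpret H: sigma_finite_measure "herm_lebesgue :: (complex^'n^'n) measure"
    by (rule translation_invariant_sigma_finite[OF herm_lebesgue])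
  have "(c * (h * h)) * (\<integral>\<^sup>+G. f G \<partial>lborel) = (c * (r * r)) * (\<integral>\<^sup>+G. f G \<partial>lborel)"
    if f [measurable]: "f \<in> borel_measurable borel" for f :: "complex^'n^'n \<Rightarrow> ennreal"
  proof -
    let ?i = "map_matrix ((*) \<i>)"
    have "(c * (r * r)) * (\<integral>\<^sup>+G. f G \<partial>lborel) = c * (\<integral>\<^sup>+G. f (Q ** G ** Q) \<partial>lborel)"
      by (simp add: l[of "\<lambda>G. f (G ** Q)"] r lr mult_ac)
    also have "\<dots> = (\<integral>\<^sup>+X. \<integral>\<^sup>+Y. f (Q ** X ** Q + ?i (Q ** Y ** Q)) \<partial>herm_lebesgue \<partial>herm_lebesgue)"
      by (simp add: c(3)[symmetric] mm.add_left mm.add_right iQ)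
    also have "\<dots> = (\<integral>\<^sup>+X. h * (\<integral>\<^sup>+Y. f (Q ** X ** Q + ?i Y) \<partial>herm_lebesgue) \<partial>herm_lebesgue)"
      by (intro nn_integral_cong h[of "\<lambda>Y. f (_ + ?i Y)"]) measurable
    also have "\<dots> = h * (\<integral>\<^sup>+X. (\<integral>\<^sup>+Y. f (Q ** X ** Q + ?i Y) \<partial>herm_lebesgue) \<partial>herm_lebesgue)"
      by (rule nn_integral_cmult) measurable
    also have "\<dots> = h * (h * (\<integral>\<^sup>+X. (\<integral>\<^sup>+Y. f (X + ?i Y) \<partial>herm_lebesgue) \<partial>herm_lebesgue))"
      by (subst h[of "\<lambda>X. \<integral>\<^sup>+Y. f (X + ?i Y) \<partial>herm_lebesgue"]) auto
    finally show ?thesis by (simp add: c(3) mult_ac)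
  qed
  from translation_invariant_cancel[OF translation_invariant_lborel this] show "h = r"
    using c by (simp add: ennreal_mult_cancel_left ennreal_square_eq_iff)
qed

section \<open>Gram matrices\<close>

text \<open>The square root of a positive definite \<open>S\<close>, built from
  \<open>inv_sqrt\<close> rather than \<open>psd_sqrt\<close> so that its measurability is
  inherited.\<close>

definition msqrt :: "complex^'n^'n \<Rightarrow> complex^'n^'n" where
  "msqrt S = S ** inv_sqrt S"

lemma borel_measurable_msqrt [measurable]: "msqrt \<in> borel_measurable borel"
  unfolding msqrt_def by measurable

lemma msqrt:
  fixes S :: "complex^'n^'n"
  assumes "pos_def S"
  shows pos_def_msqrt: "pos_def (msqrt S)" and msqrt_square: "msqrt S ** msqrt S = S"
    and inv_sqrt_msqrt: "inv_sqrt S ** msqrt S = mat 1" "msqrt S ** inv_sqrt S = mat 1"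
proof -
  show 1: "inv_sqrt S ** msqrt S = mat 1"
    using inv_sqrt_congruence[OF assms] by (simp add: msqrt_def matrix_mul_assoc)
  then show "msqrt S ** inv_sqrt S = mat 1" by (simp add: matrix_left_right_inverse)
  show "pos_def (msqrt S)" by (rule pos_def_inverse[OF pos_def_inv_sqrt[OF assms] 1])
  have "msqrt S ** msqrt S = S ** (inv_sqrt S ** S ** inv_sqrt S)"
    by (simp add: msqrt_def matrix_mul_assoc)
  then show "msqrt S ** msqrt S = S" by (simp add: inv_sqrt_congruence[OF assms])
qed

lemma borel_measurable_matrix_inv [measurable]:
  "(matrix_inv :: complex^'n^'n \<Rightarrow> complex^'n^'n) \<in> borel_measurable borel"
proof -
  define c where "c = (SOME B::complex^'n^'n. False)"
  have cl: "closed {(A::complex^'n^'n, B). A ** B = mat 1}"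
    unfolding case_prod_unfold by (intro closed_Collect_eq continuous_intros)
  have "A ** B = mat 1 \<longleftrightarrow> A \<in> {A. invertible A} \<and> B = matrix_inv A" for A B :: "complex^'n^'n"
    using matrix_inv_eqI[of A B] matrix_inv_mult[of A]
    by (auto simp: invertible_def matrix_left_right_inverse)
  from measurable_on_closed_graph(2)[OF cl this]
  have "(\<lambda>A. if invertible A then matrix_inv A else c) \<in> borel_measurable (borel :: (complex^'n^'n) measure)"
    by (subst measurable_If_restrict_space_iff) (auto simp: borel_invertible)
  moreover have "(if invertible A then matrix_inv A else c) = matrix_inv A" for A
  proof (cases "invertible A")
    case False
    then have "(A ** B = mat 1 \<and> B ** A = mat 1) = False" for B by (auto simp: invertible_def)
    with False show ?thesis by (simp only: matrix_inv_def c_def if_False)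
  qed simp
  ultimately show ?thesis by simp
qed

text \<open>The determinant of \<open>G + t *\<^sub>R mat 1\<close> is a polynomial in
  \<open>t\<close>. It is not the zero polynomial: at \<open>t = norm G + 1\<close> a kernel vector
  would be stretched by \<open>G\<close> by more than \<open>norm G\<close>.\<close>

lemma shift_singular_finite:
  fixes G :: "complex^'n^'n"
  shows "finite {t::real. \<not> invertible (G + t *\<^sub>R mat 1)}"
proof -
  define p where "p = (\<Sum>\<sigma> | \<sigma> permutes (UNIV::'n set). of_int (sign \<sigma>) *
      (\<Prod>i\<in>UNIV. [:G $ i $ \<sigma> i, if i = \<sigma> i then 1 else 0:]))"
  have p: "poly p (of_real t) = det (G + t *\<^sub>R mat 1)" for t
    unfolding p_def det_def
    by (auto simp: poly_sum poly_prod mat_def of_real_def intro!: sum.cong prod.cong arg_cong2[of _ _ _ _ "(*)"])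
  have "p \<noteq> 0"
  proof
    assume "p = 0"
    then have "\<not> invertible (G + (norm G + 1) *\<^sub>R mat 1)"
      using p[of "norm G + 1"] by (simp add: invertible_det_nz)
    then obtain x where x: "x \<noteq> 0" "(G + (norm G + 1) *\<^sub>R mat 1) *v x = 0" by (auto simp: invertible_iff_ker)
    then have "norm (G *v x) = norm ((norm G + 1) *\<^sub>R x)"
      by (metis add_eq_0_iff matrix_vector_mul_lid mv.add_left mv.scaleR_left norm_minus_cancel)
    then have "norm (G *v x) = (norm G + 1) * norm x" by simp
    with norm_matrix_vector_mult_le[of G x] x(1) show False by (simp add: algebra_simps)
  qed
  then have "finite {z. poly p z = 0}" by (rule poly_roots_finite)
  then have "finite ((of_real :: real \<Rightarrow> complex) -` {z. poly p z = 0})"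
    by (rule finite_vimageI) (simp add: inj_def)
  then show ?thesis by (simp add: vimage_def p invertible_det_nz)
qed

lemma singular_null_lborel: "AE G in lborel. invertible (G :: complex^'n^'n)"
proof (rule AE_I')
  have "- {G::complex^'n^'n. invertible G} \<in> sets borel" 
    using sets.compl_sets[of _ borel, OF borel_invertible] by (simp add: Compl_eq_Diff_UNIV)
  then have "emeasure lborel (- {G::complex^'n^'n. invertible G}) = 0"
    using shift_singular_finite
    by (intro translation_invariant_null_set[OF translation_invariant_lborel, of 0 "mat 1"])
      (auto intro: countable_finite)
  then show "- {G::complex^'n^'n. invertible G} \<in> null_sets lborel"
    using borel_invertible by (auto simp: null_sets_def)
qed auto

text \<open>On a line in direction \<open>mat 1\<close> the form increases strictly, so beyond any
  semidefinite matrix all are definite. Each such line thus meets the boundary of the cone at most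
  once.\<close>

lemma pos_semidef_singular_null: "AE X in herm_lebesgue. pos_semidef (X :: complex^'n^'n) \<longrightarrow> pos_def X"
proof (rule AE_I')
  let ?B = "{X::complex^'n^'n. pos_semidef X} - {X. pos_def X}"
  have B: "?B \<in> sets borel" using borel_closed[OF closed_pos_semidef] borel_pos_def by (rule sets.Diff)
  have less: False if "s < t" "X + s *\<^sub>R mat 1 \<in> ?B" "X + t *\<^sub>R mat 1 \<in> ?B" for s t and X :: "complex^'n^'n"
  proof -
    have "0 < x \<bullet> ((X + t *\<^sub>R mat 1) *v x)" if "x \<noteq> 0" for x
    proof -
      have "(X + t *\<^sub>R mat 1) *v x = (X + s *\<^sub>R mat 1) *v x + (t - s) *\<^sub>R x"
        by (simp add: mv.add_left mv.scaleR_left scaleR_diff_left)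
      moreover have "0 \<le> x \<bullet> ((X + s *\<^sub>R mat 1) *v x)"
        using \<open>X + s *\<^sub>R mat 1 \<in> ?B\<close> by (simp add: pos_semidef_iff_inner)
      moreover have "0 < x \<bullet> ((t - s) *\<^sub>R x)" using \<open>s < t\<close> that by simp
      ultimately show ?thesis by (simp add: inner_add_right)
    qed
    with that(3) show False by (auto simp: pos_def_def pos_semidef_iff_inner)
  qed
  have "countable {t. X + t *\<^sub>R mat 1 \<in> ?B}" for X
  proof (cases "\<exists>s. X + s *\<^sub>R mat 1 \<in> ?B")
    case True
    then obtain s where s: "X + s *\<^sub>R mat 1 \<in> ?B" ..
    have "{t. X + t *\<^sub>R mat 1 \<in> ?B} \<subseteq> {s}"
      using less s by (metis (mono_tags, lifting) linorder_neqE_linordered_idom mem_Collect_eq singletonI subsetI)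
    then show ?thesis by (rule countable_subset) simp
  next
    case False
    then have "{t. X + t *\<^sub>R mat 1 \<in> ?B} = {}" by blast
    then show ?thesis by (simp only: countable_empty)
  qed
  then have "emeasure herm_lebesgue ?B = 0"
    by (intro translation_invariant_null_set[OF herm_lebesgue _ _ B, of 0 "mat 1"])
      (auto simp: hermitian_def conj_transpose_scaleR)
  then show "?B \<in> null_sets herm_lebesgue" using B by (simp add: null_sets_def)
qed auto

text \<open>Every Hermitian \<open>X\<close> becomes positive definite after adding
  \<open>real n *\<^sub>R mat 1\<close> with \<open>n > norm X\<close>. If the cone were null,
  countably many null translates would cover all Hermitian matrices. The ball only serves to make
  the mass finite.\<close>

lemma emeasure_pos_def:
  obtains n where "emeasure herm_lebesgue ({X::complex^'n^'n. pos_def X} \<inter> cball 0 n) \<noteq> 0"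
    "emeasure herm_lebesgue ({X::complex^'n^'n. pos_def X} \<inter> cball 0 n) \<noteq> \<infinity>"
proof -
  let ?P = "{X::complex^'n^'n. pos_def X}" and ?H = "{X::complex^'n^'n. hermitian X}"
  note L = herm_lebesgue[where 'n = 'n, unfolded translation_invariant_measure_on_def]
  have shift: "emeasure herm_lebesgue {X. X + real n *\<^sub>R mat 1 \<in> ?P} = emeasure herm_lebesgue ?P" for n
  proof -
    have "(\<integral>\<^sup>+X. indicator ?P (X + (real n *\<^sub>R mat 1 - 0)) \<partial>herm_lebesgue) = (\<integral>\<^sup>+X. indicator ?P X \<partial>herm_lebesgue)"
      by (rule translation_invariant_nn_integral[OF herm_lebesgue])
        (auto simp: hermitian_def conj_transpose_scaleR borel_pos_def)
    moreover have "{X. X + real n *\<^sub>R mat 1 \<in> ?P} \<in> sets borel"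
      using measurable_sets_borel[OF _ borel_pos_def, of "\<lambda>X. X + real n *\<^sub>R mat 1"] by (simp add: vimage_def)
    moreover have "indicator ?P (X + real n *\<^sub>R mat 1) = (indicator {X. X + real n *\<^sub>R mat 1 \<in> ?P} X :: ennreal)" for X
      by (simp add: indicator_def)
    ultimately show ?thesis using borel_pos_def by (simp del: mem_Collect_eq)
  qed
  have ne: "emeasure herm_lebesgue ?P \<noteq> 0"
  proof
    assume 0: "emeasure herm_lebesgue ?P = 0"
    have "{X. X + real n *\<^sub>R mat 1 \<in> ?P} \<in> null_sets herm_lebesgue" for n
      using shift[of n] 0 measurable_sets_borel[OF _ borel_pos_def, of "\<lambda>X. X + real n *\<^sub>R mat 1"]
      by (simp add: null_sets_def vimage_def)
    then have "(\<Union>n. {X. X + real n *\<^sub>R mat 1 \<in> ?P}) \<in> null_sets herm_lebesgue" by (rule null_sets_UN)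
    moreover have "?H \<subseteq> (\<Union>n. {X. X + real n *\<^sub>R mat 1 \<in> ?P})"
    proof
      fix X assume X: "X \<in> ?H"
      obtain n where n: "norm X < real n" using reals_Archimedean2 by blast
      have "0 < x \<bullet> ((X + real n *\<^sub>R mat 1) *v x)" if "x \<noteq> 0" for x
      proof -
        have "norm X * (norm x)\<^sup>2 < real n * (norm x)\<^sup>2" using n that by simp
        then show ?thesis using abs_form_le[of x X]
          by (simp add: mv.add_left mv.scaleR_left inner_add_right power2_norm_eq_inner)
      qed
      then have "X + real n *\<^sub>R mat 1 \<in> ?P"
        using X by (simp add: pos_def_def hermitian_def conj_transpose_add conj_transpose_scaleR)
      then show "X \<in> (\<Union>n. {X. X + real n *\<^sub>R mat 1 \<in> ?P})" by blast
    qed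
    ultimately have "emeasure herm_lebesgue ?H = 0"
      by (meson borel_closed closed_hermitian emeasure_eq_0 null_setsD1 null_setsD2 sets_herm_lebesgue)
    with L show False by simp
  qed
  have "\<exists>n::nat. emeasure herm_lebesgue (?P \<inter> cball 0 (real n)) \<noteq> 0"
  proof (rule ccontr)
    assume "\<not> ?thesis"
    then have "?P \<inter> cball 0 (real n) \<in> null_sets herm_lebesgue" for n
      using borel_pos_def borel_closed[OF closed_cball] by (auto simp: null_sets_def)
    then have "(\<Union>n. ?P \<inter> cball 0 (real n)) \<in> null_sets herm_lebesgue" by (rule null_sets_UN)
    moreover have "(\<Union>n. ?P \<inter> cball 0 (real n)) = ?P" by (auto simp: real_arch_simple)
    ultimately have "?P \<in> null_sets herm_lebesgue" by (simp only:)
    then show False using ne by (simp add: null_sets_def)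
  qed
  then obtain n :: nat where n: "emeasure herm_lebesgue (?P \<inter> cball 0 (real n)) \<noteq> 0" ..
  have "emeasure herm_lebesgue (?P \<inter> cball 0 (real n)) \<le> emeasure herm_lebesgue (cball 0 (real n) :: (complex^'n^'n) set)"
    by (rule emeasure_mono) (auto intro: borel_closed)
  also have "\<dots> < \<infinity>" using L compact_cball by blast
  finally show thesis using that[OF n] by simp
qed

text \<open>Computes the integral of \<open>h W * gl G * f (?ct G ** W ** G)\<close> over
  \<open>G\<close> and \<open>W\<close> in two ways. With \<open>W\<close> fixed,
  \<open>G \<mapsto> msqrt W ** G\<close> turns \<open>?ct G ** W ** G\<close> into a plain Gram
  matrix. With \<open>G\<close> fixed, \<open>V = ?ct G ** W ** G\<close> becomes the variable,
  leaving \<open>f V\<close> with a weight that is constant on the positive definite cone.\<close>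

theorem gram_pushforward:
  obtains k where "k \<noteq> 0" "k \<noteq> \<infinity>"
    "\<And>f. f \<in> borel_measurable borel \<Longrightarrow> (\<integral>\<^sup>+G. f (conj_transpose G ** G) \<partial>(lborel :: (complex^'n^'n) measure))
       = k * (\<integral>\<^sup>+X. indicator {X. pos_def X} X * f X \<partial>(herm_lebesgue :: (complex^'n^'n) measure))"
proof -
  let ?P = "{X::complex^'n^'n. pos_def X}" and ?I = "{G::complex^'n^'n. invertible G}"
  let ?H = "herm_lebesgue :: (complex^'n^'n) measure"
  let ?ct = "conj_transpose :: complex^'n^'n \<Rightarrow> complex^'n^'n"
  define pd :: "complex^'n^'n \<Rightarrow> ennreal" where "pd = indicator ?P"
  \<comment> \<open>\<open>gl\<close> removes the singular \<open>G\<close>, where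
    \<open>matrix_inv\<close> is arbitrary; they form a null set, so it drops out at the
    end.\<close>
  define gl :: "complex^'n^'n \<Rightarrow> ennreal" where "gl = indicator ?I"
  have meas [measurable]: "pd \<in> borel_measurable borel" "gl \<in> borel_measurable borel"
    unfolding pd_def gl_def using borel_pos_def borel_invertible by auto
  obtain l :: "complex^'n^'n \<Rightarrow> ennreal" where l [measurable]: "l \<in> borel_measurable borel"
    and l': "\<And>Q. invertible Q \<Longrightarrow> l Q \<noteq> 0" "\<And>Q. invertible Q \<Longrightarrow> l Q \<noteq> \<infinity>"
    "\<And>Q (f :: complex^'n^'n \<Rightarrow> ennreal). invertible Q \<Longrightarrow> f \<in> borel_measurable borel \<Longrightarrow>
       (\<integral>\<^sup>+G. f (Q ** G) \<partial>lborel) = l Q * (\<integral>\<^sup>+G. f G \<partial>lborel)"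
    using left_mult_jacobian[where 'n = 'n] by blast
  obtain r :: "complex^'n^'n \<Rightarrow> ennreal" where "r \<in> borel_measurable borel" and
    r': "\<And>Q. invertible Q \<Longrightarrow> r Q \<noteq> 0" "\<And>Q. invertible Q \<Longrightarrow> r Q \<noteq> \<infinity>"
    "\<And>Q (f :: complex^'n^'n \<Rightarrow> ennreal). invertible Q \<Longrightarrow> f \<in> borel_measurable borel \<Longrightarrow>
       (\<integral>\<^sup>+G. f (G ** Q) \<partial>lborel) = r Q * (\<integral>\<^sup>+G. f G \<partial>lborel)"
    using right_mult_jacobian[where 'n = 'n] by blast
  obtain j :: "complex^'n^'n \<Rightarrow> ennreal" where j [measurable]: "j \<in> borel_measurable borel"
    and j': "\<And>Q. invertible Q \<Longrightarrow> j Q \<noteq> 0" "\<And>Q. invertible Q \<Longrightarrow> j Q \<noteq> \<infinity>"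
    "\<And>G f. invertible G \<Longrightarrow> f \<in> borel_measurable borel \<Longrightarrow>
       (\<integral>\<^sup>+X. f (?ct G ** X ** G) \<partial>?H) = j G * (\<integral>\<^sup>+X. f X \<partial>?H)"
    using congruence_jacobian[where 'n = 'n] by blast
  have jr: "j Q = r Q" if "pos_def Q" for Q
  proof -
    have Q: "invertible Q" "hermitian Q" "?ct Q = Q"
      using that pos_def_hermitian[OF that] by (auto simp: pos_def_iff hermitian_def)
    show ?thesis
      by (rule jacobian_hermitian_eq(2)[OF Q(2) l'(3)[OF Q(1)] r'(3)[OF Q(1)] j'(3)[OF Q(1), unfolded Q(3)]])
  qed
  have j_mult: "j (G ** Q) = j G * j Q" if "invertible G" "invertible Q" for G Q
  proof (rule translation_invariant_cancel[OF herm_lebesgue])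
    fix f :: "complex^'n^'n \<Rightarrow> ennreal" assume f [measurable]: "f \<in> borel_measurable borel"
    have "j (G ** Q) * integral\<^sup>N ?H f = (\<integral>\<^sup>+X. f (?ct (G ** Q) ** X ** (G ** Q)) \<partial>?H)"
      using that f by (subst j'(3)) (auto simp: invertible_mult)
    also have "\<dots> = (\<integral>\<^sup>+X. f (?ct Q ** (?ct G ** X ** G) ** Q) \<partial>?H)"
      by (simp add: conj_transpose_mult matrix_mul_assoc)
    also have "\<dots> = j G * (\<integral>\<^sup>+X. f (?ct Q ** X ** Q) \<partial>?H)"
      using that(1) by (rule j'(3)) measurable
    also have "\<dots> = j G * j Q * integral\<^sup>N ?H f"
      using j'(3)[OF that(2) f] by (simp add: mult.assoc)
    finally show "j (G ** Q) * integral\<^sup>N ?H f = j G * j Q * integral\<^sup>N ?H f" .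
  qed
  obtain n where n: "emeasure ?H (?P \<inter> cball 0 n) \<noteq> 0" "emeasure ?H (?P \<inter> cball 0 n) \<noteq> \<infinity>"
    using emeasure_pos_def[where 'n = 'n] by blast
  define c1 where "c1 = emeasure ?H (?P \<inter> cball 0 n)"
  define ind :: "complex^'n^'n \<Rightarrow> ennreal" where "ind = indicator (cball 0 n)"
  have [measurable]: "ind \<in> borel_measurable borel"
    unfolding ind_def by (intro borel_measurable_indicator borel_closed closed_cball)
  \<comment> \<open>The division cancels the factor that \<open>G \<mapsto> msqrt W ** G\<close>
    produces, and the cutoff by \<open>ind\<close> makes the remaining \<open>W\<close>-integral the
    finite positive constant \<open>c1\<close>.\<close>
  define h where "h = (\<lambda>W. pd W * ind W / l (msqrt W))"
  have [measurable]: "h \<in> borel_measurable borel" unfolding h_def by measurable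
  have h0: "h W = 0" if "\<not> pos_def W" for W using that by (simp add: h_def pd_def)
  have hl: "h W * l (msqrt W) = pd W * ind W" for W
  proof (cases "pos_def W")
    case True
    then have "invertible (msqrt W)" using pos_def_msqrt pos_def_invertible by blast
    then show ?thesis using l'(1,2)[of "msqrt W"] ennreal_mult_divide_eq[of "l (msqrt W)" 1]
      by (simp add: h_def ennreal_divide_times)
  qed (simp add: h_def pd_def)
  define c2 where "c2 = (\<integral>\<^sup>+G. gl G * j G * h (?ct (matrix_inv G) ** matrix_inv G) \<partial>lborel)"
  \<comment> \<open>The weight does not depend on \<open>V\<close> inside the cone. Replacing
    \<open>G\<close> by \<open>G ** Q\<close> with \<open>Q = msqrt V\<close> removes
    \<open>V\<close> from the argument of \<open>h\<close>; the substitution costs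
    \<open>r Q\<close>, while \<open>j (G ** Q)\<close> contributes \<open>j Q\<close>, and these
    agree because \<open>Q\<close> is positive definite.\<close>
  have inner: "(\<integral>\<^sup>+G. gl G * j G * h (?ct (matrix_inv G) ** V ** matrix_inv G) \<partial>lborel) = pd V * c2" for V
  proof (cases "pos_def V")
    case False
    have "gl G * j G * h (?ct (matrix_inv G) ** V ** matrix_inv G) = 0" for G
    proof (cases "invertible G")
      case True
      have "\<not> pos_def (?ct (matrix_inv G) ** V ** matrix_inv G)"
        using pos_def_congruence[OF _ True, of "?ct (matrix_inv G) ** V ** matrix_inv G"] False
        by (auto simp: congruence_inverse True)
      then show ?thesis by (simp add: h0)
    qed (simp add: gl_def)
    then show ?thesis using False by (simp only: nn_integral_const) (simp add: pd_def)
  next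
    case True
    define Q where "Q = msqrt V"
    have Q: "pos_def Q" "Q ** Q = V" "invertible Q" "?ct Q = Q"
      using msqrt[OF True] pos_def_hermitian[of Q] by (auto simp: Q_def pos_def_iff hermitian_def)
    let ?E = "\<lambda>G. gl G * j G * h (?ct (matrix_inv G) ** V ** matrix_inv G)"
    have E: "?E (G ** Q) = j Q * (gl G * j G * h (?ct (matrix_inv G) ** matrix_inv G))" for G
    proof (cases "invertible G")
      case True
      have "(G ** Q) ** (matrix_inv Q ** matrix_inv G) = G ** (Q ** matrix_inv Q) ** matrix_inv G"
        by (simp only: matrix_mul_assoc)
      then have I: "matrix_inv (G ** Q) = matrix_inv Q ** matrix_inv G"
        by (intro matrix_inv_eqI) (simp add: matrix_inv_mult True Q(3))
      have "?ct (matrix_inv (G ** Q)) ** V ** matrix_inv (G ** Q)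
          = ?ct (matrix_inv G) ** (?ct (matrix_inv Q) ** (?ct Q ** mat 1 ** Q) ** matrix_inv Q) ** matrix_inv G"
        by (simp add: I conj_transpose_mult matrix_mul_assoc Q(4) flip: Q(2))
      also have "\<dots> = ?ct (matrix_inv G) ** matrix_inv G"
        by (subst congruence_inverse(1)[OF Q(3)]) simp
      finally show ?thesis using True Q(3) by (simp add: gl_def invertible_mult j_mult mult_ac)
    next
      case False
      then have "\<not> invertible (G ** Q)"
        by (metis Q(3) invertible_mult invertible_def matrix_inv_mult matrix_mul_assoc matrix_mul_rid)
      with False show ?thesis by (simp add: gl_def)
    qed
    have "r Q * (\<integral>\<^sup>+G. ?E G \<partial>lborel) = (\<integral>\<^sup>+G. ?E (G ** Q) \<partial>lborel)"
      by (rule r'(3)[OF Q(3), symmetric]) measurable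
    also have "\<dots> = r Q * c2" unfolding E c2_def jr[OF Q(1)] by (rule nn_integral_cmult) measurable
    finally have "(\<integral>\<^sup>+G. ?E G \<partial>lborel) = c2" using r'(1,2)[OF Q(3)] by (simp add: ennreal_mult_cancel_left)
    then show ?thesis using True by (simp add: pd_def)
  qed
  have sf: "sigma_finite_measure ?H" "sigma_finite_measure (lborel :: (complex^'n^'n) measure)"
    using translation_invariant_sigma_finite[OF herm_lebesgue] lborel.sigma_finite_measure_axioms by auto
  have key: "c1 * (\<integral>\<^sup>+G. gl G * f (?ct G ** G) \<partial>lborel) = c2 * (\<integral>\<^sup>+X. pd X * f X \<partial>?H)"
    if f [measurable]: "f \<in> borel_measurable borel" for f
  proof -
    let ?a = "\<integral>\<^sup>+G. gl G * f (?ct G ** G) \<partial>lborel"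
    have 1: "(\<integral>\<^sup>+G. h W * (gl G * f (?ct G ** W ** G)) \<partial>lborel) = pd W * ind W * ?a" for W
    proof (cases "pos_def W")
      case True
      define Q where "Q = msqrt W"
      have Q: "pos_def Q" "Q ** Q = W" "invertible Q" "?ct Q = Q"
        using msqrt[OF True] pos_def_hermitian[of Q] by (auto simp: Q_def pos_def_iff hermitian_def)
      have "invertible (Q ** G) \<longleftrightarrow> invertible G" for G :: "complex^'n^'n"
        using Q(3) by (metis invertible_mult invertible_def matrix_inv_mult matrix_mul_assoc matrix_mul_lid)
      then have "gl G * f (?ct G ** W ** G) = gl (Q ** G) * f (?ct (Q ** G) ** (Q ** G))" for G
        by (simp add: gl_def conj_transpose_mult Q(4) matrix_mul_assoc indicator_def flip: Q(2))
      then have "(\<integral>\<^sup>+G. h W * (gl G * f (?ct G ** W ** G)) \<partial>lborel)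
          = h W * (\<integral>\<^sup>+G. gl (Q ** G) * f (?ct (Q ** G) ** (Q ** G)) \<partial>lborel)"
        by (simp add: nn_integral_cmult)
      also have "(\<integral>\<^sup>+G. gl (Q ** G) * f (?ct (Q ** G) ** (Q ** G)) \<partial>lborel) = l Q * ?a"
        by (rule l'(3)[OF Q(3)]) measurable
      finally show ?thesis by (simp add: Q_def hl flip: mult.assoc)
    qed (simp add: h0 pd_def)
    have c1: "(\<integral>\<^sup>+W. pd W * ind W \<partial>?H) = c1"
    proof -
      have "pd W * ind W = indicator (?P \<inter> cball 0 n) W" for W
        by (simp add: pd_def ind_def indicator_def)
      then show ?thesis using borel_pos_def borel_closed[OF closed_cball] by (simp add: c1_def sets.Int)
    qed
    have 2: "(\<integral>\<^sup>+W. h W * (gl G * f (?ct G ** W ** G)) \<partial>?H)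
        = (\<integral>\<^sup>+V. gl G * j G * h (?ct (matrix_inv G) ** V ** matrix_inv G) * f V \<partial>?H)" for G
    proof (cases "invertible G")
      case True
      let ?F = "\<lambda>V. h (?ct (matrix_inv G) ** V ** matrix_inv G) * f V"
      have "(\<integral>\<^sup>+W. h W * (gl G * f (?ct G ** W ** G)) \<partial>?H) = (\<integral>\<^sup>+W. ?F (?ct G ** W ** G) \<partial>?H)"
        using True by (simp add: gl_def congruence_inverse)
      also have "\<dots> = j G * (\<integral>\<^sup>+V. ?F V \<partial>?H)" by (rule j'(3)[OF True]) measurable
      also have "\<dots> = (\<integral>\<^sup>+V. j G * ?F V \<partial>?H)" by (rule nn_integral_cmult[symmetric]) measurable
      finally show ?thesis using True by (simp add: gl_def mult_ac)
    qed (simp add: gl_def)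
    have "c1 * ?a = (\<integral>\<^sup>+W. pd W * ind W * ?a \<partial>?H)" by (simp add: nn_integral_multc c1)
    also have "\<dots> = (\<integral>\<^sup>+W. \<integral>\<^sup>+G. h W * (gl G * f (?ct G ** W ** G)) \<partial>lborel \<partial>?H)"
      by (simp only: 1)
    also have "\<dots> = (\<integral>\<^sup>+G. \<integral>\<^sup>+W. h W * (gl G * f (?ct G ** W ** G)) \<partial>?H \<partial>lborel)"
      by (rule nn_integral_swap_borel) (use sf in auto)
    also have "\<dots> = (\<integral>\<^sup>+G. \<integral>\<^sup>+V. gl G * j G * h (?ct (matrix_inv G) ** V ** matrix_inv G) * f V \<partial>?H \<partial>lborel)"
      by (simp only: 2)
    also have "\<dots> = (\<integral>\<^sup>+V. \<integral>\<^sup>+G. gl G * j G * h (?ct (matrix_inv G) ** V ** matrix_inv G) * f V \<partial>lborel \<partial>?H)"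
      by (rule nn_integral_swap_borel) (use sf in auto)
    also have "\<dots> = (\<integral>\<^sup>+V. pd V * c2 * f V \<partial>?H)"
      by (subst nn_integral_multc) (simp_all add: inner)
    also have "\<dots> = c2 * (\<integral>\<^sup>+V. pd V * f V \<partial>?H)"
      by (subst nn_integral_cmult[symmetric]) (simp_all add: mult_ac)
    finally show ?thesis .
  qed
  have AE: "(\<integral>\<^sup>+G. gl G * f (?ct G ** G) \<partial>lborel) = (\<integral>\<^sup>+G. f (?ct G ** G) \<partial>lborel)" for f
    by (intro nn_integral_cong_AE, use singular_null_lborel in eventually_elim) (simp add: gl_def)
  have c1: "c1 \<noteq> 0" "c1 \<noteq> \<infinity>" using n by (simp_all add: c1_def)
  \<comment> \<open>The integral defining \<open>c2\<close> is not estimated directly. Instead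
    \<open>key\<close> is tested on the unit ball: the matrices whose Gram matrix lies in it form a
    bounded set with interior, so the left-hand side is positive and finite.\<close>
  have c2: "c2 \<noteq> 0" "c2 \<noteq> \<infinity>"
  proof -
    define f :: "complex^'n^'n \<Rightarrow> ennreal" where "f = indicator (cball 0 1)"
    have f: "f \<in> borel_measurable borel"
      unfolding f_def by (intro borel_measurable_indicator borel_closed closed_cball)
    let ?K = "{G::complex^'n^'n. ?ct G ** G \<in> cball 0 1}"
    have "closed {G::complex^'n^'n. dist 0 (?ct G ** G) \<le> 1}"
      by (intro closed_Collect_le continuous_intros)
    then have K [measurable]: "?K \<in> sets borel" by (intro borel_closed) simp
    have a: "(\<integral>\<^sup>+G. f (?ct G ** G) \<partial>lborel) = emeasure lborel ?K"
    proof -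
      have "f (?ct G ** G) = indicator ?K G" for G by (simp add: f_def indicator_def)
      then show ?thesis using K by simp
    qed
    have "norm G \<le> sqrt (norm (mat 1 :: complex^'n^'n))" if "G \<in> ?K" for G
    proof (rule real_le_rsqrt)
      have "(norm G)\<^sup>2 \<le> norm (mat 1 :: complex^'n^'n) * norm (?ct G ** G)"
        unfolding norm_gram by (rule norm_cauchy_schwarz)
      also have "\<dots> \<le> norm (mat 1 :: complex^'n^'n) * 1" using that by (intro mult_left_mono) auto
      finally show "(norm G)\<^sup>2 \<le> norm (mat 1 :: complex^'n^'n)" by simp
    qed
    then have "bounded ?K" by (rule boundedI)
    then have fin: "emeasure lborel ?K \<noteq> \<infinity>" using emeasure_bounded_finite[of ?K] by simp
    have "open {G::complex^'n^'n. dist 0 (?ct G ** G) < 1}" by (intro open_Collect_less continuous_intros)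
    then obtain e where e: "e > 0" "cball 0 e \<subseteq> {G::complex^'n^'n. dist 0 (?ct G ** G) < 1}"
      unfolding open_contains_cball by (metis (mono_tags, lifting) dist_self mem_Collect_eq mm.zero_right zero_less_one)
    have "0 < emeasure lborel (cball (0 :: complex^'n^'n) e)"
      using content_cball_pos[OF e(1), of "0 :: complex^'n^'n"] by (simp add: measure_def enn2real_positive_iff)
    also have "\<dots> \<le> emeasure lborel ?K" using e(2) K by (intro emeasure_mono) auto
    finally have pos: "emeasure lborel ?K \<noteq> 0" by simp
    have "c1 * emeasure lborel ?K = c2 * (\<integral>\<^sup>+X. pd X * f X \<partial>?H)"
      using key[OF f] by (simp add: AE a)
    moreover have "c1 * emeasure lborel ?K \<noteq> 0" "c1 * emeasure lborel ?K \<noteq> \<infinity>"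
      using c1 pos fin by (auto simp: ennreal_mult_eq_top_iff)
    ultimately show "c2 \<noteq> 0" "c2 \<noteq> \<infinity>" by (auto simp: ennreal_mult_eq_top_iff)
  qed
  show thesis
  proof (rule that[of "c2 / c1"])
    show "c2 / c1 \<noteq> 0" "c2 / c1 \<noteq> \<infinity>"
      using c1 c2 by (auto simp: ennreal_divide_eq_top_iff ennreal_divide_eq_0_iff)
    fix f :: "complex^'n^'n \<Rightarrow> ennreal" assume f: "f \<in> borel_measurable borel"
    have "c1 * (\<integral>\<^sup>+G. f (?ct G ** G) \<partial>lborel) = c1 * (c2 / c1 * (\<integral>\<^sup>+X. pd X * f X \<partial>?H))"
    proof -
      have "c1 * (c2 / c1) = c2"
        using c1 by (simp add: ennreal_times_divide mult.commute[of c1] ennreal_mult_divide_eq)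
      then show ?thesis using key[OF f] by (simp add: AE flip: mult.assoc)
    qed
    then show "(\<integral>\<^sup>+G. f (?ct G ** G) \<partial>lborel) = c2 / c1 * (\<integral>\<^sup>+X. indicator ?P X * f X \<partial>?H)"
      using c1 by (simp add: ennreal_mult_cancel_left pd_def)
  qed
qed

section \<open>The density of square Wishart matrices\<close>

lemma PiM_density:
  assumes M: "\<And>i. sigma_finite_measure (M i)" and D: "\<And>i. sigma_finite_measure (density (M i) (g i))"
    and I: "finite I" and g: "\<And>i. g i \<in> borel_measurable (M i)"
  shows "PiM I (\<lambda>i. density (M i) (g i)) = density (PiM I M) (\<lambda>x. \<Prod>i\<in>I. g i (x i))"
proof -
  interpret D: product_sigma_finite "\<lambda>i. density (M i) (g i)" using D by (simp add: product_sigma_finite_def)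
  interpret M: product_sigma_finite M using M by (simp add: product_sigma_finite_def)
  note [measurable] = g
  have meas [measurable]: "(\<lambda>x. \<Prod>i\<in>I. g i (x i)) \<in> borel_measurable (PiM I M)" by measurable
  show ?thesis
  proof (rule D.PiM_eqI[OF I, symmetric])
    show "sets (density (PiM I M) (\<lambda>x. \<Prod>i\<in>I. g i (x i))) = sets (PiM I (\<lambda>i. density (M i) (g i)))"
      by (simp cong: sets_PiM_cong)
    fix A assume A: "\<And>i. i \<in> I \<Longrightarrow> A i \<in> sets (density (M i) (g i))"
    then have A' [measurable]: "\<And>i. i \<in> I \<Longrightarrow> A i \<in> sets (M i)" by simp
    have "emeasure (density (PiM I M) (\<lambda>x. \<Prod>i\<in>I. g i (x i))) (Pi\<^sub>E I A)
        = (\<integral>\<^sup>+x. (\<Prod>i\<in>I. g i (x i)) * indicator (Pi\<^sub>E I A) x \<partial>PiM I M)"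
      by (rule emeasure_density[OF meas]) (auto intro!: sets_PiM_I_finite I A')
    also have "\<dots> = (\<integral>\<^sup>+x. (\<Prod>i\<in>I. g i (x i) * indicator (A i) (x i)) \<partial>PiM I M)"
    proof (rule nn_integral_cong)
      fix x assume x: "x \<in> space (PiM I M)"
      have "indicator (Pi\<^sub>E I A) x = (\<Prod>i\<in>I. indicator (A i) (x i) :: ennreal)"
        using x I by (auto simp: indicator_def space_PiM PiE_iff)
      then show "(\<Prod>i\<in>I. g i (x i)) * indicator (Pi\<^sub>E I A) x = (\<Prod>i\<in>I. g i (x i) * indicator (A i) (x i))"
        by (simp add: prod.distrib)
    qed
    also have "\<dots> = (\<Prod>i\<in>I. \<integral>\<^sup>+x. g i x * indicator (A i) x \<partial>M i)"
      by (rule M.product_nn_integral_prod[OF I]) (auto intro!: borel_measurable_times_ennreal g borel_measurable_indicator A')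
    also have "\<dots> = (\<Prod>i\<in>I. emeasure (density (M i) (g i)) (A i))"
      by (intro prod.cong refl) (simp add: emeasure_density A' g)
    finally show "emeasure (density (PiM I M) (\<lambda>x. \<Prod>i\<in>I. g i (x i))) (Pi\<^sub>E I A)
        = (\<Prod>i\<in>I. emeasure (density (M i) (g i)) (A i))" .
  qed
qed

lemma sigma_finite_density:
  assumes "sigma_finite_measure M" "f \<in> borel_measurable M" "\<And>x. f x \<noteq> \<infinity>"
  shows "sigma_finite_measure (density M f)"
  using sigma_finite_measure.sigma_finite_iff_density_finite[OF assms(1,2)] assms(3) by auto

text \<open>\<open>wishart\<close> numbers the rows of \<open>G\<close> by naturals, whereas the
  Gram theorem needs square matrices indexed by \<open>'d\<close>. A bijection \<open>e\<close>
  relabels the rows, which leaves the Gram matrix unchanged, and \<open>T\<close> assembles the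
  entries into a matrix. The product of the entry densities depends only on the norm of that matrix,
  that is, on the trace of its Gram matrix.\<close>

theorem wishart_density:
  obtains k where "k \<noteq> 0" "k \<noteq> \<infinity>"
    "(wishart CARD('d) :: (complex^'d^'d) measure) =
       density herm_lebesgue (\<lambda>X. k * (indicator {X. pos_def X} X * ennreal (exp (- (mat 1 \<bullet> X)))))"
proof -
  let ?n = "CARD('d)"
  let ?I = "{..<?n} \<times> (UNIV :: 'd set)"
  let ?L = "PiM ?I (\<lambda>_. lborel :: complex measure)"
  obtain e' where "bij_betw e' {0..<?n} (UNIV :: 'd set)" using ex_bij_betw_nat_finite[OF finite] by blast
  then obtain e where e: "bij_betw e (UNIV :: 'd set) {..<?n}"
    by (metis bij_betw_inv lessThan_atLeast0)
  have eI: "(e i, j) \<in> ?I" for i and j :: 'd using e by (auto simp: bij_betw_def)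
  have inv_e: "inv e (e i) = i" for i using e by (simp add: bij_betw_def)
  have e_inv: "e (inv e r) = r" if "r < ?n" for r
    using e that by (metis bij_betw_def f_inv_into_f lessThan_iff)
  have bij: "bij_betw (\<lambda>(i, j). (e i, j)) (UNIV :: ('d \<times> 'd) set) ?I"
    using bij_betw_map_prod[OF e bij_betw_id[of UNIV]] by (simp add: map_prod_def)
  define \<iota> :: "nat \<times> 'd \<Rightarrow> complex \<Rightarrow> complex^'d^'d"
    where "\<iota> = (\<lambda>p z. \<chi> i j. if (e i, j) = p then z else 0)"
  define \<pi> :: "nat \<times> 'd \<Rightarrow> complex^'d^'d \<Rightarrow> complex" where "\<pi> = (\<lambda>(r, a) G. G $ inv e r $ a)"
  define T where "T = (\<lambda>x. \<Sum>p\<in>?I. \<iota> p (x p))"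
  have T: "T x $ i $ j = x (e i, j)" for x i j
    unfolding T_def using eI[of i j] by (simp add: \<iota>_def)
  have T_surj: "T (\<lambda>p. \<pi> p G) = G" for G by (simp add: vec_eq_iff T \<pi>_def inv_e)
  have lin: "linear (\<iota> p)" for p by (rule linearI) (auto simp: \<iota>_def vec_eq_iff)
  have "translation_invariant_measure_on UNIV (distr ?L borel T)"
    unfolding T_def
  proof (rule translation_invariant_PiM[OF translation_invariant_lborel])
    show "linear (\<iota> p)" for p by (rule lin)
    show "continuous_on UNIV (\<pi> p)" for p by (cases p) (auto simp: \<pi>_def intro!: continuous_intros)
    show "\<pi> p (\<Sum>p\<in>?I. \<iota> p (x p)) = x p" if "p \<in> ?I" for p x
    proof -
      have "(\<Sum>p\<in>?I. \<iota> p (x p)) = T x" by (simp add: T_def)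
      then show ?thesis using that by (cases p) (simp add: \<pi>_def T e_inv)
    qed
    show "G \<in> UNIV \<longleftrightarrow> (\<exists>x. (\<forall>p\<in>?I. x p \<in> UNIV) \<and> G = (\<Sum>p\<in>?I. \<iota> p (x p)))" for G
      using T_surj[of G] by (auto simp: T_def intro: sym)
  qed auto
  from translation_invariant_unique[OF translation_invariant_lborel this]
  obtain c where c: "c \<noteq> 0" "c \<noteq> \<infinity>" "distr ?L borel T = scale_measure c lborel" by blast
  have "\<iota> p \<in> borel_measurable borel" for p
    using lin by (simp add: borel_measurable_continuous_onI linear_continuous_on linear_conv_bounded_linear)
  then have Tm [measurable]: "T \<in> borel_measurable ?L"
    unfolding T_def by (intro borel_measurable_sum measurable_compose[OF measurable_component_singleton]) auto
  define g :: "complex \<Rightarrow> ennreal" where "g = (\<lambda>z. ennreal (exp (- (cmod z)\<^sup>2) / pi))"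
  have gm [measurable]: "g \<in> borel_measurable borel" unfolding g_def by measurable
  have gauss: "std_complex_gaussian = density lborel g" by (simp add: std_complex_gaussian_def g_def)
  have PiM: "PiM ?I (\<lambda>_. std_complex_gaussian) = density ?L (\<lambda>x. \<Prod>p\<in>?I. g (x p))"
    unfolding gauss
    by (rule PiM_density)
      (auto intro!: sigma_finite_density lborel.sigma_finite_measure_axioms simp: g_def)
  define C where "C = ennreal (1 / pi ^ card ?I)"
  have C: "C \<noteq> 0" "C \<noteq> \<infinity>" by (simp_all add: C_def)
  have prod_g: "(\<Prod>p\<in>?I. g (x p)) = C * ennreal (exp (- (norm (T x))\<^sup>2))" for x
  proof -
    have "(norm (T x))\<^sup>2 = (\<Sum>i\<in>UNIV. \<Sum>j\<in>UNIV. (cmod (x (e i, j)))\<^sup>2)"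
      by (simp add: power2_norm_eq_inner inner_vec_def T)
    also have "\<dots> = (\<Sum>p\<in>?I. (cmod (x p))\<^sup>2)"
      by (subst sum.reindex_bij_betw[OF bij, symmetric]) (simp add: sum.cartesian_product case_prod_unfold)
    finally have n: "(norm (T x))\<^sup>2 = (\<Sum>p\<in>?I. (cmod (x p))\<^sup>2)" .
    have "(\<Prod>p\<in>?I. g (x p)) = ennreal (\<Prod>p\<in>?I. exp (- (cmod (x p))\<^sup>2) / pi)"
      unfolding g_def by (rule prod_ennreal) simp
    also have "(\<Prod>p\<in>?I. exp (- (cmod (x p))\<^sup>2) / pi) = 1 / pi ^ card ?I * exp (- (norm (T x))\<^sup>2)"
      by (simp only: prod_dividef prod_constant n exp_sum[symmetric] finite_cartesian_product finite_lessThan finite sum_negf)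
        simp
    also have "ennreal \<dots> = C * ennreal (exp (- (norm (T x))\<^sup>2))" unfolding C_def by (rule ennreal_mult) simp_all
    finally show ?thesis .
  qed
  have gram: "(\<chi> a b. \<Sum>r<?n. cnj (x (r, a)) * x (r, b)) = conj_transpose (T x) ** T x" for x
    by (simp add: vec_eq_iff matrix_matrix_mult_def conj_transpose_def T)
      (simp add: sum.reindex_bij_betw[OF e, of "\<lambda>r. cnj (x (r, _)) * x (r, _)"])
  obtain k where k: "k \<noteq> 0" "k \<noteq> \<infinity>"
    "\<And>f. f \<in> borel_measurable borel \<Longrightarrow> (\<integral>\<^sup>+G. f (conj_transpose G ** G) \<partial>(lborel :: (complex^'d^'d) measure))
       = k * (\<integral>\<^sup>+X. indicator {X. pos_def X} X * f X \<partial>(herm_lebesgue :: (complex^'d^'d) measure))"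
    using gram_pushforward[where 'n = 'd] by blast
  let ?P = "{X :: complex^'d^'d. pos_def X}"
  let ?w = "\<lambda>X :: complex^'d^'d. ennreal (exp (- (mat 1 \<bullet> X)))"
  have w [measurable]: "?w \<in> borel_measurable borel" by measurable
  have pdm [measurable]: "(indicator ?P :: _ \<Rightarrow> ennreal) \<in> borel_measurable borel"
    by (rule borel_measurable_indicator[OF borel_pos_def])
  show thesis
  proof (rule that[of "C * c * k"])
    show "C * c * k \<noteq> 0" "C * c * k \<noteq> \<infinity>" using C c(1,2) k(1,2) by (auto simp: ennreal_mult_eq_top_iff)
    show "(wishart CARD('d) :: (complex^'d^'d) measure) = density herm_lebesgue (\<lambda>X. C * c * k * (indicator ?P X * ?w X))"
    proof (rule measure_eqI)
      fix B :: "(complex^'d^'d) set" assume "B \<in> sets (wishart CARD('d))"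
      then have B [measurable]: "B \<in> sets borel" by (simp add: wishart_def)
      have meas: "(\<lambda>x. conj_transpose (T x) ** T x) \<in> measurable (density ?L (\<lambda>x. \<Prod>p\<in>?I. g (x p))) borel"
        by measurable
      have "emeasure (wishart CARD('d)) B
          = (\<integral>\<^sup>+X. indicator B X \<partial>distr (density ?L (\<lambda>x. \<Prod>p\<in>?I. g (x p))) borel (\<lambda>x. conj_transpose (T x) ** T x))"
        unfolding wishart_def gram PiM by simp
      also have "\<dots> = (\<integral>\<^sup>+x. indicator B (conj_transpose (T x) ** T x) \<partial>density ?L (\<lambda>x. \<Prod>p\<in>?I. g (x p)))"
        by (rule nn_integral_distr[OF meas]) simp
      also have "\<dots> = (\<integral>\<^sup>+x. (C * ?w (conj_transpose (T x) ** T x)) * indicator B (conj_transpose (T x) ** T x) \<partial>?L)"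
        unfolding prod_g norm_gram by (rule nn_integral_density) measurable
      also have "\<dots> = (\<integral>\<^sup>+G. (C * ?w (conj_transpose G ** G)) * indicator B (conj_transpose G ** G) \<partial>distr ?L borel T)"
        by (rule nn_integral_distr[symmetric]) measurable
      also have "\<dots> = c * (\<integral>\<^sup>+G. (C * ?w (conj_transpose G ** G)) * indicator B (conj_transpose G ** G)
          \<partial>(lborel :: (complex^'d^'d) measure))"
        unfolding c(3) by (rule nn_integral_scale_measure) measurable
      also have "\<dots> = c * (k * (\<integral>\<^sup>+X. indicator ?P X * (C * ?w X * indicator B X) \<partial>herm_lebesgue))"
        by (subst k(3)[of "\<lambda>X. C * ?w X * indicator B X"]) auto
      also have "\<dots> = (\<integral>\<^sup>+X. (c * k) * (indicator ?P X * (C * ?w X * indicator B X)) \<partial>herm_lebesgue)"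
        by (subst nn_integral_cmult) (auto simp: mult.assoc)
      also have "\<dots> = emeasure (density herm_lebesgue (\<lambda>X. C * c * k * (indicator ?P X * ?w X))) B"
        by (subst emeasure_density) (auto simp: mult_ac)
      finally show "emeasure (wishart CARD('d)) B = emeasure (density herm_lebesgue (\<lambda>X. C * c * k * (indicator ?P X * ?w X))) B" .
    qed (simp add: wishart_def)
  qed
qed

section \<open>Wishart-random POVMs\<close>

lemma linear_axis: "linear (axis i :: 'a::real_vector \<Rightarrow> 'a^'k)"
  by (rule linearI) (auto simp: axis_def vec_eq_iff)

lemma sum_axis [simp]: "(\<Sum>i\<in>UNIV. axis i (x i)) = (\<chi> i. x i)"
  for x :: "'k::finite \<Rightarrow> 'a::comm_monoid_add"
  by (simp add: vec_eq_iff axis_def)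

lemma borel_measurable_vec_lambda [measurable (raw)]:
  fixes f :: "'k::finite \<Rightarrow> 'x \<Rightarrow> 'a::euclidean_space"
  assumes "\<And>i. f i \<in> borel_measurable M"
  shows "(\<lambda>x. \<chi> i. f i x) \<in> borel_measurable M"
proof -
  have [measurable]: "(axis i :: 'a \<Rightarrow> 'a^'k) \<in> borel_measurable borel" for i
    by (intro borel_measurable_continuous_onI linear_continuous_on linear_conv_bounded_linear[THEN iffD1] linear_axis)
  note [measurable] = assms
  have "(\<lambda>x. \<Sum>i\<in>UNIV. axis i (f i x)) \<in> borel_measurable M" by measurable
  then show ?thesis by simp
qed

lemma borel_measurable_vec_nth [measurable]:
  "(\<lambda>m::'a::euclidean_space^'k. m $ i) \<in> borel_measurable borel"
  by (intro borel_measurable_continuous_onI continuous_intros)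

section \<open>Lebesgue measure on Hermitian tuples\<close>

definition herm_tuple_lebesgue :: "(complex^'d^'d^'k) measure" where
  "herm_tuple_lebesgue = distr (PiM UNIV (\<lambda>_. herm_lebesgue)) borel (\<lambda>x. \<Sum>i\<in>UNIV. axis i (x i))"

lemma sets_herm_tuple_lebesgue [measurable_cong, simp]: "sets herm_tuple_lebesgue = sets borel"
  by (simp add: herm_tuple_lebesgue_def)

abbreviation herm_tuples :: "(complex^'d^'d^'k) set" where
  "herm_tuples \<equiv> {m. \<forall>i. hermitian (m $ i)}"

lemma subspace_herm_tuples: "subspace (herm_tuples :: (complex^'d^'d^'k) set)"
  by (auto simp: subspace_def hermitian_def conj_transpose_add conj_transpose_scaleR)

lemma closed_herm_tuples: "closed (herm_tuples :: (complex^'d^'d^'k) set)"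
  unfolding hermitian_def by (intro closed_Collect_all closed_Collect_eq continuous_intros)

lemma herm_tuple_lebesgue:
  "translation_invariant_measure_on (herm_tuples :: (complex^'d^'d^'k) set) herm_tuple_lebesgue"
  unfolding herm_tuple_lebesgue_def
proof (rule translation_invariant_PiM[OF herm_lebesgue, of UNIV axis "\<lambda>i m. m $ i"])
  show "m \<in> herm_tuples \<longleftrightarrow> (\<exists>x. (\<forall>i\<in>UNIV. x i \<in> {A. hermitian A}) \<and> m = (\<Sum>i\<in>UNIV. axis i (x i)))"
    for m :: "complex^'d^'d^'k"
  proof
    assume "m \<in> herm_tuples"
    then show "\<exists>x. (\<forall>i\<in>UNIV. x i \<in> {A. hermitian A}) \<and> m = (\<Sum>i\<in>UNIV. axis i (x i))"
      by (intro exI[of _ "\<lambda>i. m $ i"]) simp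
  qed auto
qed (auto intro!: linear_axis continuous_intros borel_closed closed_herm_tuples)

lemma AE_herm_tuple_lebesgue:
  assumes "AE X in herm_lebesgue. Q X" "{X. Q X} \<in> sets borel"
  shows "AE m in (herm_tuple_lebesgue :: (complex^'d^'d^'k) measure). \<forall>i. Q (m $ i)"
proof -
  have meas: "(\<lambda>x. \<Sum>i\<in>UNIV. axis i (x i) :: complex^'d^'d^'k)
      \<in> measurable (PiM UNIV (\<lambda>_. herm_lebesgue)) borel"
  proof -
    have "(\<lambda>x. x i) \<in> borel_measurable (PiM UNIV (\<lambda>_. herm_lebesgue))" for i :: 'k
      using measurable_component_singleton[of i UNIV "\<lambda>_. herm_lebesgue"] by simp
    then show ?thesis by (simp add: borel_measurable_vec_lambda)
  qed
  have "AE x in PiM (UNIV :: 'k set) (\<lambda>_. herm_lebesgue). \<forall>i\<in>UNIV. Q (x i)"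
    by (rule AE_PiM_finite) (auto intro!: translation_invariant_sigma_finite[OF herm_lebesgue] assms)
  moreover have "{m :: complex^'d^'d^'k. \<forall>i. Q (m $ i)} \<in> sets borel"
  proof -
    have "{m :: complex^'d^'d^'k. \<forall>i. Q (m $ i)} = (\<Inter>i. (\<lambda>m. m $ i) -` {X. Q X})" by auto
    also have "\<dots> \<in> sets borel"
      using measurable_sets_borel[OF borel_measurable_vec_nth assms(2)] by (intro sets.finite_INT) auto
    finally show ?thesis .
  qed
  ultimately show ?thesis
    unfolding herm_tuple_lebesgue_def by (subst AE_distr_iff[OF meas]) simp_all
qed

section \<open>Normalization of tuples\<close>

definition povm_of :: "complex^'d^'d^'k \<Rightarrow> complex^'d^'d^'k" where
  "povm_of m = (let R = inv_sqrt (\<Sum>j\<in>UNIV. m $ j) in \<chi> i. R ** m $ i ** R)"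

lemma borel_measurable_povm_of [measurable]: "povm_of \<in> borel_measurable borel"
  unfolding povm_of_def Let_def by measurable

lemma sum_congruence: "A ** (\<Sum>i\<in>I. f i) ** B = (\<Sum>i\<in>I. A ** f i ** B)"
  for A B :: "complex^'d^'d"
  by (simp add: mm.sum_left mm.sum_right)

lemma povm_of_sum:
  fixes m :: "complex^'d^'d^'k"
  assumes "pos_def (\<Sum>j\<in>UNIV. m $ j)"
  shows "(\<Sum>i\<in>UNIV. povm_of m $ i) = mat 1"
  using inv_sqrt_congruence[OF assms] by (simp add: povm_of_def Let_def sum_congruence)

lemma povm_of_congruence:
  fixes m :: "complex^'d^'d^'k"
  assumes "pos_def (\<Sum>j\<in>UNIV. m $ j)"
  shows "m $ i = msqrt (\<Sum>j\<in>UNIV. m $ j) ** povm_of m $ i ** msqrt (\<Sum>j\<in>UNIV. m $ j)"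
proof -
  let ?S = "\<Sum>j\<in>UNIV. m $ j"
  have "msqrt ?S ** povm_of m $ i ** msqrt ?S = (msqrt ?S ** inv_sqrt ?S) ** m $ i ** (inv_sqrt ?S ** msqrt ?S)"
    by (simp add: povm_of_def Let_def matrix_mul_assoc)
  then show ?thesis by (simp add: inv_sqrt_msqrt[OF assms])
qed

lemma conj_transpose_pos_def: "pos_def A \<Longrightarrow> conj_transpose A = A"
  using pos_def_hermitian by (auto simp: hermitian_def)

lemma povm_of_hermitian:
  fixes m :: "complex^'d^'d^'k"
  assumes "pos_def (\<Sum>j\<in>UNIV. m $ j)" "hermitian (m $ i)"
  shows "hermitian (povm_of m $ i)"
  using hermitian_congruence[OF assms(2), of "inv_sqrt (\<Sum>j\<in>UNIV. m $ j)"]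
  by (simp add: povm_of_def Let_def conj_transpose_pos_def[OF pos_def_inv_sqrt[OF assms(1)]])

text \<open>Normalization is a congruence that \<open>msqrt\<close> of the sum undoes, so
  semidefiniteness may be tested after it. Hence the constraint on the Wishart matrices becomes a
  restriction to \<open>povms\<close> in the target space.\<close>

lemma povm_of_pos_semidef_iff:
  fixes m :: "complex^'d^'d^'k"
  assumes S: "pos_def (\<Sum>j\<in>UNIV. m $ j)"
  shows "pos_semidef (povm_of m $ i) \<longleftrightarrow> pos_semidef (m $ i)"
proof
  assume "pos_semidef (povm_of m $ i)"
  from pos_semidef_congruence[OF this, of "msqrt (\<Sum>j\<in>UNIV. m $ j)"]
  show "pos_semidef (m $ i)"
    by (subst povm_of_congruence[OF S]) (simp add: conj_transpose_pos_def[OF pos_def_msqrt[OF S]])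
next
  assume "pos_semidef (m $ i)"
  from pos_semidef_congruence[OF this, of "inv_sqrt (\<Sum>j\<in>UNIV. m $ j)"]
  show "pos_semidef (povm_of m $ i)"
    by (simp add: povm_of_def Let_def conj_transpose_pos_def[OF pos_def_inv_sqrt[OF S]])
qed

lemma pos_def_sum:
  fixes f :: "'k::finite \<Rightarrow> complex^'d^'d"
  assumes "\<And>i. pos_def (f i)"
  shows "pos_def (\<Sum>i\<in>UNIV. f i)"
  unfolding pos_def_def
proof (intro conjI allI impI)
  show "hermitian (\<Sum>i\<in>UNIV. f i)"
    using subspace_sum[OF subspace_hermitian, of UNIV f] assms by (simp add: pos_def_hermitian)
  fix x :: "complex^'d" assume "x \<noteq> 0"
  then have "0 < (\<Sum>i\<in>UNIV. x \<bullet> (f i *v x))"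
    using assms by (intro sum_pos) (auto simp: pos_def_def)
  then show "0 < x \<bullet> ((\<Sum>i\<in>UNIV. f i) *v x)" by (simp add: mv.sum_left inner_sum_right)
qed

section \<open>Topology of the set of POVMs\<close>

lemma closed_povms: "closed (povms :: (complex^'d^'d^'k) set)"
proof -
  have "closed {m::complex^'d^'d^'k. pos_semidef (m $ i)}" for i
    using closed_vimage[OF closed_pos_semidef, of "\<lambda>m. m $ i"] by (simp add: vimage_def continuous_on_component)
  then show ?thesis
    unfolding povms_def by (intro closed_Collect_conj closed_Collect_all closed_Collect_eq continuous_intros) 
qed

lemma closed_hermitian_tuples_sum_id: "closed (hermitian_tuples_sum_id :: (complex^'d^'d^'k) set)"
  unfolding hermitian_tuples_sum_id_def hermitian_def
  by (intro closed_Collect_conj closed_Collect_all closed_Collect_eq continuous_intros)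

lemma povms_subset: "povms \<subseteq> hermitian_tuples_sum_id"
  by (auto simp: povms_def hermitian_tuples_sum_id_def pos_semidef_def)

text \<open>The centre is the uniform POVM, all of whose members are the identity divided by
  \<open>CARD('k)\<close>. Its form equals the squared norm divided by \<open>CARD('k)\<close>,
  which a Hermitian perturbation of norm at most the reciprocal of \<open>CARD('k)\<close> cannot
  make negative.\<close>

lemma povms_interior:
  obtains c :: "complex^'d^'d^'k" and r where "r > 0" "c \<in> hermitian_tuples_sum_id"
    "hermitian_tuples_sum_id \<inter> cball c r \<subseteq> povms"
proof -
  let ?k = "real CARD('k)"
  have k: "?k > 0" by simp
  define c :: "complex^'d^'d^'k" where "c = (\<chi> i. (1 / ?k) *\<^sub>R mat 1)"
  show thesis
  proof (rule that[of "1 / ?k" c])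
    show "1 / ?k > 0" using k by simp
    have "(\<Sum>i\<in>UNIV. c $ i) = (?k * (1 / ?k)) *\<^sub>R mat 1" by (simp add: c_def sum_constant_scaleR del: sum_constant)
    then show "c \<in> hermitian_tuples_sum_id"
      by (simp add: hermitian_tuples_sum_id_def c_def hermitian_def conj_transpose_scaleR)
    show "hermitian_tuples_sum_id \<inter> cball c (1 / ?k) \<subseteq> povms"
    proof
      fix m assume m: "m \<in> hermitian_tuples_sum_id \<inter> cball c (1 / ?k)"
      have "0 \<le> x \<bullet> (m $ i *v x)" for i x
      proof -
        have "norm ((m - c) $ i) \<le> norm (m - c)" by (rule Finite_Cartesian_Product.norm_nth_le)
        also have "\<dots> \<le> 1 / ?k" using m by (simp add: dist_norm norm_minus_commute)
        finally have "norm ((m - c) $ i) * (norm x)\<^sup>2 \<le> 1 / ?k * (norm x)\<^sup>2" by (rule mult_right_mono) simp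
        with abs_form_le[of x "(m - c) $ i"] have "- (1 / ?k * (norm x)\<^sup>2) \<le> x \<bullet> ((m - c) $ i *v x)" by linarith
        moreover have "m $ i *v x = (m - c) $ i *v x + (1 / ?k) *\<^sub>R x"
          by (simp add: c_def mv.diff_left mv.scaleR_left)
        ultimately show ?thesis by (simp add: inner_add_right power2_norm_eq_inner)
      qed
      then show "m \<in> povms" using m by (auto simp: povms_def hermitian_tuples_sum_id_def pos_semidef_iff_inner)
    qed
  qed
qed

text \<open>The measure \<open>N\<close> of the overview. Its total mass may be infinite; finiteness
  on compact sets is derived later from the mass it gives to \<open>povms\<close>.\<close>

definition povm_measure :: "(complex^'d^'d^'k) measure" where
  "povm_measure = distr (density herm_tuple_lebesgue
     (\<lambda>m. indicator {S. pos_def S} (\<Sum>i\<in>UNIV. m $ i) * ennreal (exp (- (mat 1 \<bullet> (\<Sum>i\<in>UNIV. m $ i)))))) borel povm_of"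

lemma sets_povm_measure [measurable_cong, simp]: "sets povm_measure = sets borel"
  by (simp add: povm_measure_def)

lemma nn_integral_povm_measure:
  fixes f :: "complex^'d^'d^'k \<Rightarrow> ennreal"
  assumes [measurable]: "f \<in> borel_measurable borel"
  shows "(\<integral>\<^sup>+z. f z \<partial>povm_measure) = (\<integral>\<^sup>+m. indicator {S. pos_def S} (\<Sum>i\<in>UNIV. m $ i)
     * ennreal (exp (- (mat 1 \<bullet> (\<Sum>i\<in>UNIV. m $ i)))) * f (povm_of m) \<partial>herm_tuple_lebesgue)"
proof -
  have [measurable]: "(indicator {S. pos_def S} :: complex^'d^'d \<Rightarrow> ennreal) \<in> borel_measurable borel"
    by (rule borel_measurable_indicator[OF borel_pos_def])
  have [measurable]: "(\<lambda>m::complex^'d^'d^'k. indicator {S. pos_def S} (\<Sum>i\<in>UNIV. m $ i)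
      * ennreal (exp (- (mat 1 \<bullet> (\<Sum>i\<in>UNIV. m $ i))))) \<in> borel_measurable borel"
    by measurable
  show ?thesis
    unfolding povm_measure_def by (subst nn_integral_distr) (simp_all add: nn_integral_density)
qed

text \<open>A shift of the normalized tuple by \<open>u\<close> is the shift \<open>S\<^sup>1\<^sup>/\<^sup>2 u S\<^sup>1\<^sup>/\<^sup>2\<close> of the unnormalized one, which
  preserves the sum \<open>S\<close>.\<close>

lemma povm_measure_translate:
  fixes u :: "complex^'d^'d^'k"
  assumes u: "u \<in> herm_tuples" "(\<Sum>i\<in>UNIV. u $ i) = 0" and f [measurable]: "f \<in> borel_measurable borel"
  shows "(\<integral>\<^sup>+z. f (z + u) \<partial>povm_measure) = (\<integral>\<^sup>+z. f z \<partial>povm_measure)"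
proof -
  define \<pi> :: "complex^'d^'d^'k \<Rightarrow> complex^'d^'d" where "\<pi> = (\<lambda>m. \<Sum>i\<in>UNIV. m $ i)"
  \<comment> \<open>The value 0 off the positive definite matrices makes \<open>v S\<close> a
    Hermitian tuple with sum 0 for every \<open>S\<close>, as the shear lemma demands; the weight
    \<open>q\<close> vanishes there.\<close>
  define v :: "complex^'d^'d \<Rightarrow> complex^'d^'d^'k"
    where "v = (\<lambda>S. if pos_def S then \<chi> i. msqrt S ** u $ i ** msqrt S else 0)"
  define q :: "complex^'d^'d \<Rightarrow> ennreal"
    where "q = (\<lambda>S. indicator {S. pos_def S} S * ennreal (exp (- (mat 1 \<bullet> S))))"
  have pd [measurable]: "{S::complex^'d^'d. pos_def S} \<in> sets borel" by (rule borel_pos_def)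
  have [measurable]: "Measurable.pred borel (pos_def :: complex^'d^'d \<Rightarrow> bool)"
    using borel_pos_def by (simp add: pred_def)
  have [measurable]: "v \<in> borel_measurable borel" unfolding v_def by measurable
  have [measurable]: "q \<in> borel_measurable borel" unfolding q_def by measurable
  have lin: "linear \<pi>" by (rule linearI) (simp_all add: \<pi>_def sum.distrib scaleR_sum_right)
  then have [measurable]: "\<pi> \<in> borel_measurable borel"
    by (simp add: borel_measurable_continuous_onI linear_continuous_on linear_conv_bounded_linear)
  have pv: "\<pi> (v S) = 0" for S
    using sum_congruence[of "msqrt S" "\<lambda>i. u $ i" UNIV "msqrt S"] u(2) by (simp add: \<pi>_def v_def)
  have hv: "v S \<in> herm_tuples" for S
  proof (cases "pos_def S")
    case True
    then show ?thesis
      using hermitian_congruence[of "u $ _" "msqrt S"] u(1)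
      by (simp add: v_def conj_transpose_pos_def[OF pos_def_msqrt])
  qed (simp add: v_def hermitian_def)
  let ?F = "\<lambda>m. q (\<pi> m) * f (povm_of m)"
  have eq: "?F (m + v (\<pi> m)) = q (\<pi> m) * f (povm_of m + u)" for m
  proof (cases "pos_def (\<pi> m)")
    case True
    have "\<pi> (m + v (\<pi> m)) = \<pi> m" using linear_add[OF lin] pv by simp
    moreover have "povm_of (m + v (\<pi> m)) = povm_of m + u"
    proof -
      let ?R = "inv_sqrt (\<pi> m)" and ?Q = "msqrt (\<pi> m)"
      have P: "povm_of m' $ i = inv_sqrt (\<pi> m') ** m' $ i ** inv_sqrt (\<pi> m')" for m' i
        by (simp add: povm_of_def \<pi>_def Let_def)
      have "povm_of (m + v (\<pi> m)) $ i = ?R ** m $ i ** ?R + (?R ** ?Q) ** u $ i ** (?Q ** ?R)" for i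
        unfolding P \<open>\<pi> (m + v (\<pi> m)) = \<pi> m\<close>
        using True by (simp add: v_def mm.add_left mm.add_right matrix_mul_assoc)
      then show ?thesis unfolding vec_eq_iff[of _ "povm_of m + u"] by (simp add: inv_sqrt_msqrt[OF True] P)
    qed
    ultimately show ?thesis by simp
  next
    case False
    then show ?thesis using linear_add[OF lin] pv by (simp add: q_def)
  qed
  have "(\<integral>\<^sup>+z. f (z + u) \<partial>povm_measure) = (\<integral>\<^sup>+m. ?F (m + v (\<pi> m)) \<partial>herm_tuple_lebesgue)"
    unfolding eq by (subst nn_integral_povm_measure) (simp_all add: q_def \<pi>_def)
  also have "\<dots> = (\<integral>\<^sup>+m. ?F m \<partial>herm_tuple_lebesgue)"
  \<comment> \<open>The section of \<open>\<pi>\<close> puts the whole sum into a single coordinate;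
    \<open>undefined\<close> names an arbitrary one.\<close>
  proof (rule translation_invariant_shear[OF herm_tuple_lebesgue herm_lebesgue subspace_herm_tuples
        subspace_hermitian lin _ linear_axis[of undefined]])
    show "\<pi> m \<in> {A. hermitian A}" if "m \<in> herm_tuples" for m
      using subspace_sum[OF subspace_hermitian, of UNIV "\<lambda>i. m $ i"] that by (simp add: \<pi>_def)
    show "\<pi> (axis undefined h) = h" for h by (simp add: \<pi>_def axis_def)
    show "axis undefined h \<in> herm_tuples" if "h \<in> {A. hermitian A}" for h
      using that by (simp add: axis_def hermitian_def)
  qed (auto simp: pv hv[simplified])
  also have "\<dots> = (\<integral>\<^sup>+z. f z \<partial>povm_measure)"
    by (subst nn_integral_povm_measure) (simp_all add: q_def \<pi>_def)
  finally show ?thesis .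
qed

text \<open>Independence turns the joint law of the Wishart matrices into a density on Hermitian
  tuples. The factor \<open>k\<close> arises as the \<open>CARD('k)\<close>-th power of the unknown
  constant in the density of one matrix.\<close>

theorem wishart_povm_law:
  fixes P :: "'w measure" and M :: "'w \<Rightarrow> complex^'d^'d^'k"
  assumes "wishart_random_povm P (\<lambda>_. CARD('d)) M"
  obtains k where "M \<in> borel_measurable P" "k \<noteq> 0" "k \<noteq> \<infinity>"
    "\<And>B. B \<in> sets borel \<Longrightarrow> emeasure (distr P borel M) B = k * emeasure povm_measure (povms \<inter> B)"
proof -
  interpret prob_space P using assms by (simp add: wishart_random_povm_def)
  obtain W :: "'k \<Rightarrow> 'w \<Rightarrow> complex^'d^'d" where indep: "indep_vars (\<lambda>_. borel) W UNIV"
    and W: "\<And>i. distr P borel (W i) = wishart CARD('d)"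
    and M: "\<And>\<omega> i. \<omega> \<in> space P \<Longrightarrow> M \<omega> $ i =
             (let R = inv_sqrt (\<Sum>j\<in>UNIV. W j \<omega>) in R ** W i \<omega> ** R)"
    using assms unfolding wishart_random_povm_def by blast
  have [measurable]: "W i \<in> borel_measurable P" for i using indep by (simp add: indep_vars_def)
  have M': "M \<omega> = povm_of (\<chi> i. W i \<omega>)" if "\<omega> \<in> space P" for \<omega>
    unfolding vec_eq_iff[of "M \<omega>"] using M[OF that] by (simp add: povm_of_def Let_def)
  let ?H = "herm_lebesgue :: (complex^'d^'d) measure"
  let ?L = "herm_tuple_lebesgue :: (complex^'d^'d^'k) measure"
  let ?PD = "{X::complex^'d^'d. pos_def X}"
  obtain k where k: "k \<noteq> 0" "k \<noteq> \<infinity>"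
    "(wishart CARD('d) :: (complex^'d^'d) measure) =
       density ?H (\<lambda>X. k * (indicator ?PD X * ennreal (exp (- (mat 1 \<bullet> X)))))"
    using wishart_density[where 'd = 'd] by blast
  define g where "g = (\<lambda>X. k * (indicator ?PD X * ennreal (exp (- (mat 1 \<bullet> X)))))"
  define S where "S = (\<lambda>m::complex^'d^'d^'k. \<Sum>i\<in>UNIV. m $ i)"
  have [measurable]: "(indicator ?PD :: _ \<Rightarrow> ennreal) \<in> borel_measurable borel"
    by (rule borel_measurable_indicator[OF borel_pos_def])
  have gm [measurable]: "g \<in> borel_measurable borel" unfolding g_def by measurable
  have [measurable]: "povms \<in> sets (borel :: (complex^'d^'d^'k) measure)"
    by (rule borel_closed[OF closed_povms])
  have [measurable]: "(\<lambda>x. \<chi> i. x i) \<in> borel_measurable (PiM UNIV (\<lambda>_::'k. ?H))"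
  proof (rule borel_measurable_vec_lambda)
    show "(\<lambda>x. x i) \<in> borel_measurable (PiM UNIV (\<lambda>_::'k. ?H))" for i
      using measurable_component_singleton[of i UNIV "\<lambda>_. ?H"] by simp
  qed
  have [measurable]: "(\<lambda>x. \<chi> i. x i) \<in> borel_measurable (PiM UNIV (\<lambda>_::'k. borel :: (complex^'d^'d) measure))"
    by (rule borel_measurable_vec_lambda) measurable
  have joint: "distr P (PiM UNIV (\<lambda>_. borel)) (\<lambda>\<omega>. \<lambda>i\<in>UNIV. W i \<omega>) = density (PiM UNIV (\<lambda>_. ?H)) (\<lambda>x. \<Prod>i\<in>UNIV. g (x i))"
  proof -
    have "distr P (PiM UNIV (\<lambda>_. borel)) (\<lambda>\<omega>. \<lambda>i\<in>UNIV. W i \<omega>) = PiM UNIV (\<lambda>i. distr P borel (W i))"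
      using indep by (subst (asm) indep_vars_iff_distr_eq_PiM) auto
    also have "\<dots> = PiM UNIV (\<lambda>_. density ?H g)" by (simp add: W k(3) g_def)
    also have "\<dots> = density (PiM UNIV (\<lambda>_. ?H)) (\<lambda>x. \<Prod>i\<in>UNIV. g (x i))"
    proof (rule PiM_density)
      show "sigma_finite_measure ?H" by (rule translation_invariant_sigma_finite[OF herm_lebesgue])
      then show "sigma_finite_measure (density ?H g)"
      proof (rule sigma_finite_density)
        show "g X \<noteq> \<infinity>" for X
          using k(2) unfolding g_def by (simp add: ennreal_mult_eq_top_iff split: split_indicator)
      qed measurable
    qed auto
    finally show ?thesis .
  qed
  \<comment> \<open>Almost everywhere a semidefinite member is definite, so all members are definite
    exactly when the sum is and the normalized tuple is a POVM. This trades a product of indicators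
    for one of the sum and one of the image; the exponentials combine because the trace is
    additive.\<close>
  have prod_g: "AE m in ?L. (\<Prod>i\<in>UNIV. g (m $ i)) =
      k ^ CARD('k) * (indicator ?PD (S m) * ennreal (exp (- (mat 1 \<bullet> S m))) * indicator povms (povm_of m))"
  proof -
    have 1: "AE m in ?L. \<forall>i. hermitian (m $ i)"
      using translation_invariant_AE[OF herm_tuple_lebesgue] by simp
    have 2: "AE m in ?L. \<forall>i. pos_semidef (m $ i) \<longrightarrow> pos_def (m $ i)"
    proof (rule AE_herm_tuple_lebesgue[OF pos_semidef_singular_null])
      have "{X::complex^'d^'d. pos_semidef X \<longrightarrow> pos_def X} = - {X. pos_semidef X} \<union> ?PD" by auto
      also have "\<dots> \<in> sets borel" 
        by (rule sets.Un[OF borel_comp[OF borel_closed[OF closed_pos_semidef]] borel_pos_def])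
      finally show "{X::complex^'d^'d. pos_semidef X \<longrightarrow> pos_def X} \<in> sets borel" .
    qed
    from 1 2 show ?thesis
    proof eventually_elim
      fix m :: "complex^'d^'d^'k" assume m: "\<forall>i. hermitian (m $ i)" "\<forall>i. pos_semidef (m $ i) \<longrightarrow> pos_def (m $ i)"
      have "(\<forall>i. pos_def (m $ i)) \<longleftrightarrow> pos_def (S m) \<and> povm_of m \<in> povms"
        using m(2) povm_of_pos_semidef_iff[of m] povm_of_sum[of m] pos_def_sum[of "\<lambda>i. m $ i"]
          pos_def_imp_pos_semidef by (auto simp: S_def povms_def)
      moreover have "(\<Prod>i\<in>UNIV. indicator ?PD (m $ i)) = (if \<forall>i. pos_def (m $ i) then 1 else 0 :: ennreal)"
        by (auto simp: indicator_def)
      ultimately have ind: "(\<Prod>i\<in>UNIV. indicator ?PD (m $ i)) = (indicator ?PD (S m) * indicator povms (povm_of m) :: ennreal)"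
        by (auto simp: indicator_def)
      have "(\<Prod>i\<in>UNIV. ennreal (exp (- (mat 1 \<bullet> (m $ i))))) = ennreal (\<Prod>i\<in>UNIV. exp (- (mat 1 \<bullet> (m $ i))))"
        by (rule prod_ennreal) simp
      also have "(\<Prod>i\<in>UNIV. exp (- (mat 1 \<bullet> (m $ i)))) = exp (- (mat 1 \<bullet> S m))"
        by (simp add: S_def inner_sum_right sum_negf flip: exp_sum)
      finally have "(\<Prod>i\<in>UNIV. ennreal (exp (- (mat 1 \<bullet> (m $ i))))) = ennreal (exp (- (mat 1 \<bullet> S m)))" .
      with ind show "(\<Prod>i\<in>UNIV. g (m $ i)) =
          k ^ CARD('k) * (indicator ?PD (S m) * ennreal (exp (- (mat 1 \<bullet> S m))) * indicator povms (povm_of m))"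
        unfolding g_def prod.distrib by (simp add: mult_ac)
    qed
  qed
  have [measurable]: "S \<in> borel_measurable borel" unfolding S_def by measurable
  show thesis
  proof (rule that[of "k ^ CARD('k)"])
    have "(\<lambda>\<omega>. povm_of (\<chi> i. W i \<omega>)) \<in> borel_measurable P" by measurable
    then show "M \<in> borel_measurable P" by (subst measurable_cong[OF M'])
    show "k ^ CARD('k) \<noteq> 0" "k ^ CARD('k) \<noteq> \<infinity>" using k(1,2) by (auto simp: power_eq_top_ennreal)
    fix B :: "(complex^'d^'d^'k) set" assume [measurable]: "B \<in> sets borel"
    let ?f = "\<lambda>m. indicator B (povm_of m) :: ennreal"
    have "distr P borel M = distr P borel (\<lambda>\<omega>. povm_of (\<chi> i. W i \<omega>))"
      by (rule distr_cong) (simp_all add: M')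
    then have "emeasure (distr P borel M) B = (\<integral>\<^sup>+z. indicator B z \<partial>distr P borel (\<lambda>\<omega>. povm_of (\<chi> i. W i \<omega>)))"
      by simp
    also have "\<dots> = (\<integral>\<^sup>+\<omega>. ?f (\<chi> i. W i \<omega>) \<partial>P)"
      by (rule nn_integral_distr) measurable
    also have "\<dots> = (\<integral>\<^sup>+x. ?f (\<chi> i. x i) \<partial>distr P (PiM UNIV (\<lambda>_. borel)) (\<lambda>\<omega>. \<lambda>i\<in>UNIV. W i \<omega>))"
      unfolding restrict_UNIV
      by (rule nn_integral_distr[symmetric]) (auto intro!: measurable_PiM_single' simp: space_PiM)
    also have "\<dots> = (\<integral>\<^sup>+x. (\<Prod>i\<in>UNIV. g (x i)) * ?f (\<chi> i. x i) \<partial>PiM UNIV (\<lambda>_. ?H))"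
      unfolding joint by (rule nn_integral_density) measurable
    also have "\<dots> = (\<integral>\<^sup>+m. (\<Prod>i\<in>UNIV. g (m $ i)) * ?f m \<partial>?L)"
      unfolding herm_tuple_lebesgue_def by (subst nn_integral_distr) simp_all
    also have "\<dots> = (\<integral>\<^sup>+m. k ^ CARD('k) * (indicator ?PD (S m) * ennreal (exp (- (mat 1 \<bullet> S m)))
        * indicator (povms \<inter> B) (povm_of m)) \<partial>?L)"
      by (intro nn_integral_cong_AE, use prod_g in eventually_elim) (simp add: indicator_inter_arith mult_ac)
    also have "\<dots> = k ^ CARD('k) * (\<integral>\<^sup>+m. indicator ?PD (S m) * ennreal (exp (- (mat 1 \<bullet> S m)))
        * indicator (povms \<inter> B) (povm_of m) \<partial>?L)"
      by (rule nn_integral_cmult) measurable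
    also have "\<dots> = k ^ CARD('k) * emeasure povm_measure (povms \<inter> B)"
      using nn_integral_povm_measure[of "indicator (povms \<inter> B)"] by (simp add: S_def)
    finally show "emeasure (distr P borel M) B = k ^ CARD('k) * emeasure povm_measure (povms \<inter> B)" .
  qed
qed

text \<open>The delicate clause is finiteness on compact sets. Since \<open>povms\<close> contains a
  ball of radius \<open>r\<close> in the affine space, translation bounds the mass of every ball of
  radius \<open>r\<close> centred there by that of \<open>povms\<close>, and finitely many such
  balls cover the relevant part of a compact set.\<close>

lemma povm_measure_translation_invariant:
  assumes pos: "emeasure povm_measure (povms :: (complex^'d^'d^'k) set) \<noteq> 0"
    and fin: "emeasure povm_measure (povms :: (complex^'d^'d^'k) set) \<noteq> \<infinity>"
  shows "translation_invariant_measure_on (hermitian_tuples_sum_id :: (complex^'d^'d^'k) set) povm_measure"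
  unfolding translation_invariant_measure_on_def
proof (intro conjI ballI allI impI)
  let ?N = "povm_measure :: (complex^'d^'d^'k) measure"
  let ?A = "hermitian_tuples_sum_id :: (complex^'d^'d^'k) set"
  have A [measurable]: "?A \<in> sets borel" by (rule borel_closed[OF closed_hermitian_tuples_sum_id])
  have diff: "y - x \<in> herm_tuples" "(\<Sum>i\<in>UNIV. (y - x) $ i) = 0" if "x \<in> ?A" "y \<in> ?A" for x y
    using that by (auto simp: hermitian_tuples_sum_id_def hermitian_def conj_transpose_diff sum_subtractf)
  show compl: "emeasure ?N (- ?A) = 0"
  proof -
    have "emeasure ?N (- ?A) = (\<integral>\<^sup>+z. indicator (- ?A) z \<partial>?N)" using A by simp
    also have "\<dots> = (\<integral>\<^sup>+m. 0 \<partial>(herm_tuple_lebesgue :: (complex^'d^'d^'k) measure))"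
      unfolding nn_integral_povm_measure[OF borel_measurable_indicator[OF borel_comp[OF A]]]
    proof (rule nn_integral_cong_AE, use translation_invariant_AE[OF herm_tuple_lebesgue] in eventually_elim)
      fix m :: "complex^'d^'d^'k" assume "m \<in> herm_tuples"
      then have "povm_of m \<in> ?A" if "pos_def (\<Sum>i\<in>UNIV. m $ i)"
        using that povm_of_sum[OF that] povm_of_hermitian[OF that] by (simp add: hermitian_tuples_sum_id_def)
      then show "indicator {S. pos_def S} (\<Sum>i\<in>UNIV. m $ i) * ennreal (exp (- (mat 1 \<bullet> (\<Sum>i\<in>UNIV. m $ i)))) *
          indicator (- ?A) (povm_of m) = (0::ennreal)"
        by (auto simp: indicator_def)
    qed
    finally show ?thesis by simp
  qed
  have "emeasure ?N povms \<le> emeasure ?N ?A" using povms_subset A by (intro emeasure_mono) auto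
  with pos show "emeasure ?N ?A \<noteq> 0" by (metis le_zero_eq)
  show "distr ?N borel (\<lambda>z. z + (y - x)) = ?N" if "x \<in> ?A" "y \<in> ?A" for x y
  proof (rule measure_eqI)
    fix B assume "B \<in> sets (distr ?N borel (\<lambda>z. z + (y - x)))"
    then have [measurable]: "B \<in> sets borel" by simp
    have "emeasure (distr ?N borel (\<lambda>z. z + (y - x))) B = (\<integral>\<^sup>+z. indicator B z \<partial>distr ?N borel (\<lambda>z. z + (y - x)))"
      by simp
    also have "\<dots> = (\<integral>\<^sup>+z. indicator B (z + (y - x)) \<partial>?N)" by (rule nn_integral_distr) measurable
    also have "\<dots> = emeasure ?N B" by (subst povm_measure_translate[OF diff[OF that]]) simp_all
    finally show "emeasure (distr ?N borel (\<lambda>z. z + (y - x))) B = emeasure ?N B" .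
  qed simp
  fix K :: "(complex^'d^'d^'k) set" assume K: "compact K"
  obtain c :: "complex^'d^'d^'k" and r where r: "r > 0" and c: "c \<in> ?A" and sub: "?A \<inter> cball c r \<subseteq> povms"
    using povms_interior[where 'd = 'd and 'k = 'k] by blast
  have AE_A: "AE z in ?N. z \<in> ?A"
    by (rule AE_I[of _ _ "- ?A"]) (use compl A in auto)
  have ball: "emeasure ?N (cball x r) \<le> emeasure ?N povms" if "x \<in> ?A" for x
  proof -
    have "emeasure ?N (cball x r) = (\<integral>\<^sup>+z. indicator (cball x r) z \<partial>?N)" by (simp add: borel_closed)
    also have "\<dots> = (\<integral>\<^sup>+z. indicator (cball x r) (z + (x - c)) \<partial>?N)"
      by (rule povm_measure_translate[OF diff[OF c that], symmetric])
        (intro borel_measurable_indicator borel_closed closed_cball)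
    also have "\<dots> = (\<integral>\<^sup>+z. indicator (cball c r) z \<partial>?N)"
    proof -
      have "indicator (cball x r) (z + (x - c)) = (indicator (cball c r) z :: ennreal)" for z
        by (simp add: indicator_def dist_norm algebra_simps)
      then show ?thesis by simp
    qed
    also have "\<dots> = emeasure ?N (cball c r)" by (simp add: borel_closed)
    also have "\<dots> \<le> emeasure ?N povms"
    proof (rule emeasure_mono_AE)
      show "AE z in ?N. z \<in> cball c r \<longrightarrow> z \<in> povms" using AE_A by eventually_elim (use sub in blast)
      show "povms \<in> sets ?N" using borel_closed[OF closed_povms] by simp
    qed
    finally show ?thesis .
  qed
  have cK: "compact (K \<inter> ?A)" using K closed_hermitian_tuples_sum_id by (rule compact_Int_closed)
  have cover: "K \<inter> ?A \<subseteq> (\<Union>x\<in>K \<inter> ?A. ball x r)" using r by auto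
  obtain D where D: "D \<subseteq> K \<inter> ?A" "finite D" "K \<inter> ?A \<subseteq> (\<Union>x\<in>D. ball x r)"
    using compactE_image[OF cK open_ball cover] by blast
  have cb: "cball x r \<in> sets ?N" for x by (simp add: borel_closed)
  have "emeasure ?N K \<le> emeasure ?N (\<Union>x\<in>D. cball x r)"
  proof (rule emeasure_mono_AE)
    show "AE z in ?N. z \<in> K \<longrightarrow> z \<in> (\<Union>x\<in>D. cball x r)"
      using AE_A by eventually_elim (use D(3) in force)
    show "(\<Union>x\<in>D. cball x r) \<in> sets ?N" using D(2) cb by (intro sets.finite_UN) auto
  qed
  also have "\<dots> \<le> (\<Sum>x\<in>D. emeasure ?N (cball x r))"
    using D(2) cb by (intro emeasure_subadditive_finite) auto
  also have "\<dots> < \<infinity>"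
  proof -
    have "emeasure ?N (cball x r) < top" if "x \<in> D" for x
      using ball[of x] D(1) that fin by (metis IntD2 infinity_ennreal_def le_less_trans subsetD top.not_eq_extremum)
    then show ?thesis using D(2) by simp
  qed
  finally show "emeasure ?N K < \<infinity>" .
qed simp

theorem corollary5p14:
  fixes P :: "'w measure" and M :: "'w \<Rightarrow> complex^'d^'d^'k"
  assumes "wishart_random_povm P (\<lambda>_. CARD('d)) M"
  shows "is_normalized_lebesgue hermitian_tuples_sum_id povms (distr P borel M)"
proof -
  interpret prob_space P using assms by (simp add: wishart_random_povm_def)
  let ?K = "povms :: (complex^'d^'d^'k) set"
  let ?N = "povm_measure :: (complex^'d^'d^'k) measure"
  obtain k where M: "M \<in> borel_measurable P" and k: "k \<noteq> 0" "k \<noteq> \<infinity>"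
    "\<And>B. B \<in> sets borel \<Longrightarrow> emeasure (distr P borel M) B = k * emeasure ?N (?K \<inter> B)"
    using wishart_povm_law[OF assms] by blast
  have K [measurable]: "?K \<in> sets borel" by (rule borel_closed[OF closed_povms])
  \<comment> \<open>The total mass 1 of the law determines the mass of \<open>povms\<close> under
    \<open>?N\<close>. This makes it positive and finite, which is exactly what the invariance of
    \<open>?N\<close> requires.\<close>
  have one: "k * emeasure ?N ?K = 1"
  proof -
    have "prob_space (distr P borel M)" by (rule prob_space_distr[OF M])
    then have "emeasure (distr P borel M) UNIV = 1" using prob_space.emeasure_space_1 by fastforce
    then show ?thesis using k(3)[of UNIV] by simp
  qed
  have N: "emeasure ?N ?K \<noteq> 0" "emeasure ?N ?K \<noteq> \<infinity>"
    using one k(1,2) by (auto simp: ennreal_mult_eq_top_iff)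
  note tN = povm_measure_translation_invariant[OF N]
  show ?thesis
    unfolding is_normalized_lebesgue_def
  proof (intro conjI exI[of _ ?N] allI impI tN)
    fix L :: "(complex^'d^'d^'k) measure"
    assume L: "translation_invariant_measure_on hermitian_tuples_sum_id L"
    obtain c where c: "c \<noteq> 0" "c \<noteq> \<infinity>" "L = scale_measure c ?N"
      using translation_invariant_unique[OF tN L] by blast
    show "0 < emeasure L ?K" using c N by (simp add: zero_less_iff_neq_zero)
    show "emeasure L ?K < \<infinity>" using c N by (simp add: ennreal_mult_less_top less_top)
    show "distr P borel M = uniform_measure L ?K"
    proof (rule measure_eqI)
      fix B assume "B \<in> sets (distr P borel M)"
      then have B [measurable]: "B \<in> sets borel" by simp
      have "emeasure (uniform_measure L ?K) B = (c * emeasure ?N (?K \<inter> B)) / (c * emeasure ?N ?K)"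
        using B K by (simp add: c(3))
      \<comment> \<open>Inserting \<open>k * emeasure ?N ?K = 1\<close> makes the denominator a
        factor of the numerator; the arbitrary \<open>c\<close> cancels, so every choice of
        \<open>L\<close> gives the same normalized measure.\<close>
      also have "c * emeasure ?N (?K \<inter> B) = (k * emeasure ?N (?K \<inter> B)) * (c * emeasure ?N ?K)"
        using one by (metis (no_types, lifting) mult.assoc mult.commute mult.right_neutral)
      also have "\<dots> / (c * emeasure ?N ?K) = k * emeasure ?N (?K \<inter> B)"
        using c(1,2) N by (intro ennreal_mult_divide_eq) (auto simp: ennreal_mult_eq_top_iff)
      finally show "emeasure (distr P borel M) B = emeasure (uniform_measure L ?K) B" by (simp add: k(3))
    qed (simp add: c(3))
  qed
qed

end
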